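(* Let $n\ge1$, $s\in(0,1)$, and let $\Omega\subset\mathbb{R}^n$ be a bounded domain. Let $(\psi_h)$ be a sequence in $H^s(\mathbb{R}^n)$ such that $\psi_h^+\in\widetilde H^s(\Omega)$ for every $h$, and let $(f_h)$ be a sequence in $\widetilde H^s(\Omega)'$. Assume that $$\psi_h\to\psi\ \text{ in }H^s(\mathbb{R}^n)\qquad\text{and}\qquad f_h\to f\ \text{ in }\widetilde H^s(\Omega)'.$$ Denote by $u_h$ the solution to the obstacle problem $\mathcal P(\psi_h,f_h)$. Then $u_h\to u$ in $\widetilde H^s(\Omega)$, where $u$ is the solution to the limiting obstacle problem $\mathcal P(\psi,f)$.
   Context: No regularity of $\partial\Omega$ is assumed. The fractional Laplacian is defined through the Fourier transform, $\mathcal F[(-\Delta)^s u]=|\xi|^{2s}\mathcal F[u]$. $H^s(\mathbb{R}^n)=\{u\in L^2(\mathbb{R}^n): (-\Delta)^{s/2}u\in L^2(\mathbb{R}^n)\}$ with its natural Hilbert structure, and $\widetilde H^s(\Omega)=\{u\in H^s(\mathbb{R}^n): u=0 \text{ a.e. on }\mathbb{R}^n\setminus\overline\Omega\}$, a Hilbert space with norm $\|(-\Delta)^{s/2}u\|_{L^2(\mathbb{R}^n)}$; $\widetilde H^s(\Omega)'$ is its dual and $\langle\cdot,\cdot\rangle$ the duality product. For $u\in\widetilde H^s(\Omega)$, $\langle(-\Delta)^s u,v\rangle=\int_{\mathbb{R}^n}(-\Delta)^{s/2}u\,(-\Delta)^{s/2}v\,dx$. For a measurable $\psi$ let $K^s_\psi=\{v\in\widetilde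 H^s(\Omega): v\ge\psi\text{ a.e. on }\Omega\}$. The problem $\mathcal P(\psi,f)$ is: find $u\in K^s_\psi$ such that $\langle(-\Delta)^s u-f,v-u\rangle\ge0$ for all $v\in K^s_\psi$. When $K^s_\psi\neq\emptyset$ it has a unique solution. Notation: $v^+=\max\{v,0\}$. *)

theory Defs
  imports "HOL-Analysis.Analysis"
begin

text \<open>
  The space R^n is an arbitrary Euclidean space \<open>'a\<close> with its Lebesgue measure, n = \<open>DIM('a)\<close>.
  Elements of function spaces are represented by Borel functions (every Lebesgue class has a Borel
  representative); functions that agree almost everywhere are not identified, so the norms
  below are seminorms on representatives.
\<close>

definition L2_space :: "('a::euclidean_space \<Rightarrow> 'b::{banach, second_countable_topology}) set" where
  "L2_space = {u \<in> borel_measurable lborel. integrable lborel (\<lambda>x. (norm (u x))\<^sup>2)}"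

definition L2_norm :: "('a::euclidean_space \<Rightarrow> 'b::{banach, second_countable_topology}) \<Rightarrow> real" where
  "L2_norm u = sqrt (LINT x|lborel. (norm (u x))\<^sup>2)"

definition fourier_L1 :: "('a::euclidean_space \<Rightarrow> complex) \<Rightarrow> 'a \<Rightarrow> complex" where
  "fourier_L1 u \<xi> =
     of_real ((2 * pi) powr (- real DIM('a) / 2)) * (LINT x|lborel. cis (- (\<xi> \<bullet> x)) * u x)"

text \<open>
  \<open>has_fourier u g\<close>: \<open>g\<close> is the Fourier transform of the square integrable \<open>u\<close>, i.e. the value at
  \<open>u\<close> of the continuous extension to L^2 of the integral transform on the intersection of
  L^1 and L^2. By Plancherel's theorem \<open>g\<close> exists and is unique up to null sets.
\<close>

definition has_fourier :: "('a::euclidean_space \<Rightarrow> complex) \<Rightarrow> ('a \<Rightarrow> complex) \<Rightarrow> bool" where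
  "has_fourier u g \<longleftrightarrow>
     u \<in> L2_space \<and> g \<in> L2_space \<and>
     (\<exists>w :: nat \<Rightarrow> 'a \<Rightarrow> complex.
        (\<forall>k. w k \<in> L2_space \<and> integrable lborel (w k) \<and> fourier_L1 (w k) \<in> L2_space) \<and>
        (\<lambda>k. L2_norm (\<lambda>x. w k x - u x)) \<longlonglongrightarrow> 0 \<and>
        (\<lambda>k. L2_norm (\<lambda>\<xi>. fourier_L1 (w k) \<xi> - g \<xi>)) \<longlonglongrightarrow> 0)"

text \<open>
  \<open>has_frac_lap \<sigma> u w\<close>: both \<open>u\<close> and \<open>w\<close> are real square integrable functions and \<open>w\<close> is the
  fractional Laplacian of \<open>u\<close> of order \<open>\<sigma>\<close>, with Fourier symbol \<open>norm \<xi> powr (2 * \<sigma>)\<close>.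
\<close>

definition has_frac_lap :: "real \<Rightarrow> ('a::euclidean_space \<Rightarrow> real) \<Rightarrow> ('a \<Rightarrow> real) \<Rightarrow> bool" where
  "has_frac_lap \<sigma> u w \<longleftrightarrow>
     u \<in> L2_space \<and> w \<in> L2_space \<and>
     (\<exists>g. has_fourier (\<lambda>x. complex_of_real (u x)) g \<and>
          has_fourier (\<lambda>x. complex_of_real (w x)) (\<lambda>\<xi>. of_real (norm \<xi> powr (2 * \<sigma>)) * g \<xi>))"

text \<open>A representative of the fractional Laplacian; it is determined up to null sets.\<close>

definition frac_lap :: "real \<Rightarrow> ('a::euclidean_space \<Rightarrow> real) \<Rightarrow> 'a \<Rightarrow> real" where
  "frac_lap \<sigma> u = (SOME w. has_frac_lap \<sigma> u w)"

definition Hs_space :: "real \<Rightarrow> ('a::euclidean_space \<Rightarrow> real) set" where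
  "Hs_space s = {u \<in> L2_space. \<exists>w. has_frac_lap (s / 2) u w}"

definition Hs_norm :: "real \<Rightarrow> ('a::euclidean_space \<Rightarrow> real) \<Rightarrow> real" where
  "Hs_norm s u = sqrt ((L2_norm u)\<^sup>2 + (L2_norm (frac_lap (s / 2) u))\<^sup>2)"

definition Ht_space :: "real \<Rightarrow> 'a::euclidean_space set \<Rightarrow> ('a \<Rightarrow> real) set" where
  "Ht_space s \<Omega> = {u \<in> Hs_space s. AE x in lborel. x \<notin> closure \<Omega> \<longrightarrow> u x = 0}"

definition Ht_norm :: "real \<Rightarrow> ('a::euclidean_space \<Rightarrow> real) \<Rightarrow> real" where
  "Ht_norm s u = L2_norm (frac_lap (s / 2) u)"

text \<open>
  Elements of the dual are functionals on representatives; only their values on \<open>Ht_space s \<Omega>\<close>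
  matter. Linearity and boundedness force equal values on functions that agree
  almost everywhere.
\<close>

definition Ht_dual :: "real \<Rightarrow> 'a::euclidean_space set \<Rightarrow> (('a \<Rightarrow> real) \<Rightarrow> real) set" where
  "Ht_dual s \<Omega> = {f.
     (\<forall>v \<in> Ht_space s \<Omega>. \<forall>w \<in> Ht_space s \<Omega>. f (\<lambda>x. v x + w x) = f v + f w) \<and>
     (\<forall>c. \<forall>v \<in> Ht_space s \<Omega>. f (\<lambda>x. c * v x) = c * f v) \<and>
     (\<exists>C. \<forall>v \<in> Ht_space s \<Omega>. \<bar>f v\<bar> \<le> C * Ht_norm s v)}"

definition Ht_dual_norm :: "real \<Rightarrow> 'a::euclidean_space set \<Rightarrow> (('a \<Rightarrow> real) \<Rightarrow> real) \<Rightarrow> real" where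
  "Ht_dual_norm s \<Omega> f = (SUP v \<in> {v \<in> Ht_space s \<Omega>. Ht_norm s v \<le> 1}. \<bar>f v\<bar>)"

text \<open>For \<open>u \<in> Ht_space s \<Omega>\<close>, the fractional Laplacian of order \<open>s\<close> as a functional.\<close>

definition frac_lap_dual :: "real \<Rightarrow> ('a::euclidean_space \<Rightarrow> real) \<Rightarrow> ('a \<Rightarrow> real) \<Rightarrow> real" where
  "frac_lap_dual s u v = (LINT x|lborel. frac_lap (s / 2) u x * frac_lap (s / 2) v x)"

definition obstacle_set :: "real \<Rightarrow> 'a::euclidean_space set \<Rightarrow> ('a \<Rightarrow> real) \<Rightarrow> ('a \<Rightarrow> real) set" where
  "obstacle_set s \<Omega> \<psi> = {v \<in> Ht_space s \<Omega>. AE x in lborel. x \<in> \<Omega> \<longrightarrow> \<psi> x \<le> v x}"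

definition solves_obstacle ::
  "real \<Rightarrow> 'a::euclidean_space set \<Rightarrow> ('a \<Rightarrow> real) \<Rightarrow> (('a \<Rightarrow> real) \<Rightarrow> real) \<Rightarrow> ('a \<Rightarrow> real) \<Rightarrow> bool" where
  "solves_obstacle s \<Omega> \<psi> f u \<longleftrightarrow>
     u \<in> obstacle_set s \<Omega> \<psi> \<and>
     (\<forall>v \<in> obstacle_set s \<Omega> \<psi>.
        frac_lap_dual s u (\<lambda>x. v x - u x) - f (\<lambda>x. v x - u x) \<ge> 0)"

end

theory Submission
  imports Defs "HOL-Probability.Characteristic_Functions"
begin

text \<open>
  Write \<open>L\<close> for the fractional Laplacian of order \<open>s / 2\<close> and \<open>a u v\<close> for the integral of \<open>L u * L v\<close>. Let \<open>u\<close> solve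
  the limiting problem, which has a solution because the energy attains its minimum on the
  admissible set, and let \<open>uh\<close> solve the perturbed problems. Test the problem for \<open>uh\<close> with \<open>u + m\<close> and
  the problem for \<open>u\<close> with \<open>uh + m'\<close>, where the corrections \<open>m\<close> and \<open>m'\<close> lift each function above the obstacle of
  the other problem. Adding the two inequalities (\<open>obstacle_comparison\<close>) bounds the squared norm of
  \<open>uh - u\<close> by \<open>a uh m - fh m\<close>, \<open>a u m' - f m'\<close> and \<open>(fh - f) (uh - u)\<close>. The \<open>uh\<close> are bounded
  (\<open>obstacle_Ht_bound\<close>), so the last term tends to 0 and it remains to choose corrections with \<open>m\<close> tending
  to 0 in norm and \<open>m'\<close> tending to 0 weakly.

  The correction (\<open>obstacle_correction\<close>) is the minimum of \<open>(\<psi>' - u)\<^sup>+\<close> and \<open>(\<psi>' - \<psi>)\<^sup>+\<close>, where \<open>u\<close> lies above \<open>\<psi>\<close> on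
  the domain and is lifted above \<open>\<psi>'\<close>. It is bounded by \<open>\<bar>\<psi>' - \<psi>\<bar>\<close>, hence null in the mean, and bounded in the energy
  norm, hence weakly null (\<open>frac_lap_dual_weakly_null\<close>); the functional \<open>f\<close> is itself represented by the
  energy form (\<open>Ht_Riesz\<close>). For the fixed function \<open>u\<close> the correction is the positive part of a sequence that
  converges to a nonpositive limit, and then it converges in norm (\<open>Ht_norm_pos_part_tendsto_0\<close>).

  All this rests on two properties of the energy. First, \<open>\<bar>u\<bar>\<close> has at most the energy of \<open>u\<close>
  (\<open>has_frac_lap_abs\<close>), so that positive parts stay in the space and have nonpositive mutual energy with
  negative parts. Second, on functions supported in a fixed ball the energy controls the mean square
  (\<open>frac_Poincare\<close>), which gives completeness. Both are read off the Gagliardo form of the energy, an integral of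
  squared differences of \<open>u\<close>, whose equality with a multiple of the spectral form (\<open>gagliardo_eq_frac_lap\<close>) is a
  computation with Plancherel's theorem. The Fourier transform of square integrable functions is developed
  from Gaussian damping (\<open>fourier_L1_Plancherel\<close>) up to inversion (\<open>has_fourier_inverse\<close>).
\<close>

section \<open>Square integrable functions\<close>

text \<open>A real inner product for complex functions too. Real parts suffice throughout, because identities are
  tested against all functions, and one development serves real and complex values.\<close>

definition L2_inner :: "('a::euclidean_space \<Rightarrow> 'b::euclidean_space) \<Rightarrow> ('a \<Rightarrow> 'b) \<Rightarrow> real" where
  "L2_inner u v = (LINT x|lborel. u x \<bullet> v x)"

lemma L2_space_measurable [measurable_dest]: "u \<in> L2_space \<Longrightarrow> u \<in> borel_measurable borel"
  by (simp add: L2_space_def)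

lemma L2_space_integrable: "u \<in> L2_space \<Longrightarrow> integrable lborel (\<lambda>x. (norm (u x))\<^sup>2)"
  by (simp add: L2_space_def)

lemma L2_spaceI:
  "u \<in> borel_measurable borel \<Longrightarrow> integrable lborel (\<lambda>x. (norm (u x))\<^sup>2) \<Longrightarrow> u \<in> L2_space"
  by (simp add: L2_space_def)

lemma L2_space_bound:
  assumes "u \<in> L2_space" "v \<in> borel_measurable borel" "AE x in lborel. norm (v x) \<le> norm (u x)"
  shows "v \<in> L2_space"
proof (rule L2_spaceI)
  show "integrable lborel (\<lambda>x. (norm (v x))\<^sup>2)"
    by (rule Bochner_Integration.integrable_bound[OF L2_space_integrable[OF assms(1)]])
       (use assms in \<open>auto intro: power_mono elim: eventually_mono\<close>)
qed fact

lemma L2_space_zero: "(\<lambda>x. 0) \<in> L2_space"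
  by (rule L2_spaceI) auto

lemma norm_add_sq_le: "(norm (a + b))\<^sup>2 \<le> 2 * (norm a)\<^sup>2 + 2 * (norm (b::'b::real_normed_vector))\<^sup>2"
proof -
  have "(norm (a + b))\<^sup>2 \<le> (norm a + norm b)\<^sup>2"
    by (intro power_mono norm_triangle_ineq) auto
  also have "\<dots> \<le> 2 * (norm a)\<^sup>2 + 2 * (norm b)\<^sup>2"
    using sum_squares_bound[of "norm a" "norm b"] by (simp add: power2_sum)
  finally show ?thesis .
qed

lemma L2_space_add:
  assumes "u \<in> L2_space" "v \<in> L2_space"
  shows "(\<lambda>x. u x + v x) \<in> L2_space"
proof (rule L2_spaceI)
  note [measurable] = assms[THEN L2_space_measurable]
  show "(\<lambda>x. u x + v x) \<in> borel_measurable borel" by measurable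
  have "integrable lborel (\<lambda>x. 2 * (norm (u x))\<^sup>2 + 2 * (norm (v x))\<^sup>2)"
    using assms[THEN L2_space_integrable] by auto
  then show "integrable lborel (\<lambda>x. (norm (u x + v x))\<^sup>2)"
    by (rule Bochner_Integration.integrable_bound) (auto simp: norm_add_sq_le)
qed

lemma L2_space_scaleR:
  assumes "u \<in> L2_space"
  shows "(\<lambda>x. c *\<^sub>R u x) \<in> L2_space"
proof (rule L2_spaceI)
  note [measurable] = assms[THEN L2_space_measurable]
  show "(\<lambda>x. c *\<^sub>R u x) \<in> borel_measurable borel" by measurable
  show "integrable lborel (\<lambda>x. (norm (c *\<^sub>R u x))\<^sup>2)"
    using L2_space_integrable[OF assms] by (simp add: power_mult_distrib)
qed

lemma L2_space_cmult: "u \<in> L2_space \<Longrightarrow> (\<lambda>x. c * u x :: real) \<in> L2_space"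
  using L2_space_scaleR[of u c] by simp

lemma L2_space_minus: "u \<in> L2_space \<Longrightarrow> (\<lambda>x. - u x) \<in> L2_space"
  using L2_space_scaleR[of u "-1"] by simp

lemma L2_space_diff:
  assumes "u \<in> L2_space" "v \<in> L2_space"
  shows "(\<lambda>x. u x - v x) \<in> L2_space"
  using L2_space_add[OF assms(1) L2_space_minus[OF assms(2)]] by simp

lemma L2_space_cong_AE:
  assumes "u \<in> L2_space" "v \<in> borel_measurable borel" "AE x in lborel. v x = u x"
  shows "v \<in> L2_space"
  by (rule L2_space_bound[OF assms(1,2)]) (use assms(3) in auto)

lemma L2_norm_sq: "(L2_norm u)\<^sup>2 = (LINT x|lborel. (norm (u x))\<^sup>2)"
  by (simp add: L2_norm_def)

lemma L2_norm_nonneg [simp]: "0 \<le> L2_norm u"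
  by (simp add: L2_norm_def)

lemma L2_norm_cong_AE:
  assumes "u \<in> borel_measurable borel" "v \<in> borel_measurable borel" "AE x in lborel. u x = v x"
  shows "L2_norm u = L2_norm v"
proof -
  have "(LINT x|lborel. (norm (u x))\<^sup>2) = (LINT x|lborel. (norm (v x))\<^sup>2)"
    by (rule integral_cong_AE) (use assms in auto)
  then show ?thesis by (simp add: L2_norm_def)
qed

lemma L2_norm_mono:
  assumes "u \<in> L2_space" "v \<in> borel_measurable borel" "AE x in lborel. norm (v x) \<le> norm (u x)"
  shows "L2_norm v \<le> L2_norm u"
  unfolding L2_norm_def
  by (intro real_sqrt_le_mono integral_mono_AE L2_space_integrable L2_space_bound[OF assms] assms)
     (use assms(3) in \<open>auto intro: power_mono elim: eventually_mono\<close>)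

lemma L2_norm_eq_0:
  assumes "u \<in> L2_space" "L2_norm u = 0"
  shows "AE x in lborel. u x = 0"
  using integral_nonneg_eq_0_iff_AE[OF L2_space_integrable[OF assms(1)]] assms(2)
  by (simp add: L2_norm_def)

lemma L2_inner_integrable:
  assumes "u \<in> L2_space" "v \<in> L2_space"
  shows "integrable lborel (\<lambda>x. u x \<bullet> v x)"
proof -
  note [measurable] = assms[THEN L2_space_measurable]
  have "integrable lborel (\<lambda>x. (norm (u x))\<^sup>2 + (norm (v x))\<^sup>2)"
    using assms[THEN L2_space_integrable] by auto
  then show ?thesis
  proof (rule Bochner_Integration.integrable_bound)
    have "norm (a \<bullet> b) \<le> (norm a)\<^sup>2 + (norm b)\<^sup>2" for a b :: 'b
    proof -
      have "norm (a \<bullet> b) \<le> norm a * norm b" using Cauchy_Schwarz_ineq2 by simp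
      also have "\<dots> \<le> (norm a)\<^sup>2 + (norm b)\<^sup>2"
      proof -
        have "2 * (norm a * norm b) \<le> (norm a)\<^sup>2 + (norm b)\<^sup>2"
          using sum_squares_bound[of "norm a" "norm b"] by (simp add: mult.assoc)
        moreover have "0 \<le> norm a * norm b" by simp
        ultimately show ?thesis by linarith
      qed
      finally show ?thesis .
    qed
    then show "AE x in lborel. norm (u x \<bullet> v x) \<le> norm ((norm (u x))\<^sup>2 + (norm (v x))\<^sup>2)" by simp
  qed simp
qed

lemma L2_inner_self: "L2_inner u u = (L2_norm u)\<^sup>2"
  by (simp add: L2_norm_sq L2_inner_def power2_norm_eq_inner)

lemma L2_inner_commute: "L2_inner u v = L2_inner v u"
  by (simp add: L2_inner_def inner_commute)

lemma L2_inner_add: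
  assumes "u \<in> L2_space" "v \<in> L2_space" "w \<in> L2_space"
  shows "L2_inner (\<lambda>x. u x + v x) w = L2_inner u w + L2_inner v w"
  using assms by (simp add: L2_inner_def inner_add_left L2_inner_integrable)

lemma L2_inner_diff:
  assumes "u \<in> L2_space" "v \<in> L2_space" "w \<in> L2_space"
  shows "L2_inner (\<lambda>x. u x - v x) w = L2_inner u w - L2_inner v w"
  using assms by (simp add: L2_inner_def inner_diff_left L2_inner_integrable)

lemma L2_inner_scaleR: "L2_inner (\<lambda>x. c *\<^sub>R u x) w = c * L2_inner u w"
  by (simp add: L2_inner_def)

lemma L2_inner_cong_AE:
  assumes "u \<in> borel_measurable borel" "u' \<in> borel_measurable borel" "AE x in lborel. u x = u' x"
    "v \<in> borel_measurable borel" "v' \<in> borel_measurable borel" "AE x in lborel. v x = v' x"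
  shows "L2_inner u v = L2_inner u' v'"
  unfolding L2_inner_def by (rule integral_cong_AE) (use assms in auto)

lemma L2_norm_add_sq:
  assumes "u \<in> L2_space" "v \<in> L2_space"
  shows "(L2_norm (\<lambda>x. u x + v x))\<^sup>2 = (L2_norm u)\<^sup>2 + 2 * L2_inner u v + (L2_norm v)\<^sup>2"
proof -
  have "L2_inner (\<lambda>x. u x + v x) w = L2_inner u w + L2_inner v w" if "w \<in> L2_space" for w
    by (rule L2_inner_add[OF assms that])
  note e = this[OF L2_space_add[OF assms]] this[OF assms(1)] this[OF assms(2)]
  show ?thesis
    unfolding L2_inner_self[symmetric]
    using e L2_inner_commute[of u "\<lambda>x. u x + v x"] L2_inner_commute[of v "\<lambda>x. u x + v x"]
      L2_inner_commute[of v u] by linarith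
qed

lemma L2_norm_scaleR: "L2_norm (\<lambda>x. c *\<^sub>R u x) = \<bar>c\<bar> * L2_norm u"
  by (simp add: L2_norm_def power_mult_distrib real_sqrt_mult)

lemma L2_norm_diff_sq:
  assumes "u \<in> L2_space" "v \<in> L2_space"
  shows "(L2_norm (\<lambda>x. u x - v x))\<^sup>2 = (L2_norm u)\<^sup>2 - 2 * L2_inner u v + (L2_norm v)\<^sup>2"
  using L2_norm_add_sq[OF assms(1) L2_space_scaleR[OF assms(2), of "-1"]]
    L2_inner_scaleR[of "-1" v u] L2_norm_scaleR[of "-1" v]
  by (simp add: L2_inner_commute[of _ u])

text \<open>
  For \<open>C > 0\<close> the choice \<open>t = B / C\<close> minimizes the polynomial. For \<open>C = 0\<close> the polynomial is affine in
  \<open>t\<close>, and a nonconstant affine function takes negative values, so \<open>B = 0\<close>.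
\<close>

lemma discriminant_bound:
  fixes A B C :: real
  assumes "\<And>t. 0 \<le> A - 2 * t * B + t\<^sup>2 * C" "0 \<le> C"
  shows "B\<^sup>2 \<le> A * C"
proof (cases "C = 0")
  case False
  have "0 \<le> A - 2 * (B / C) * B + (B / C)\<^sup>2 * C" by (rule assms)
  also have "\<dots> = A - B\<^sup>2 / C" using False by (simp add: field_simps power2_eq_square)
  finally show ?thesis using False assms(2) by (simp add: field_simps)
next
  case True
  show ?thesis
  proof (cases "B = 0")
    case False
    have "0 \<le> A - 2 * ((A + 1) / (2 * B)) * B + ((A + 1) / (2 * B))\<^sup>2 * C" by (rule assms)
    also have "\<dots> = -1" using False True by (simp add: field_simps)
    finally show ?thesis by simp
  qed (simp add: True)
qed

lemma L2_Cauchy_Schwarz: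
  assumes "u \<in> L2_space" "v \<in> L2_space"
  shows "\<bar>L2_inner u v\<bar> \<le> L2_norm u * L2_norm v"
proof -
  have "(L2_inner u v)\<^sup>2 \<le> (L2_norm u)\<^sup>2 * (L2_norm v)\<^sup>2"
  proof (rule discriminant_bound)
    fix t :: real
    have "0 \<le> (L2_norm (\<lambda>x. u x - t *\<^sub>R v x))\<^sup>2" by simp
    also have "\<dots> = (L2_norm u)\<^sup>2 - 2 * t * L2_inner u v + t\<^sup>2 * (L2_norm v)\<^sup>2"
      using L2_norm_diff_sq[OF assms(1) L2_space_scaleR[OF assms(2), of t]]
        L2_inner_scaleR[of t v u] L2_norm_scaleR[of t v]
      by (simp add: L2_inner_commute[of u] power_mult_distrib)
    finally show "0 \<le> (L2_norm u)\<^sup>2 - 2 * t * L2_inner u v + t\<^sup>2 * (L2_norm v)\<^sup>2" .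
  qed simp
  then show ?thesis
    by (metis L2_norm_nonneg mult_nonneg_nonneg power_mult_distrib abs_le_square_iff abs_of_nonneg)
qed

lemma L2_triangle:
  fixes u v :: "'a::euclidean_space \<Rightarrow> 'b::euclidean_space"
  assumes "u \<in> L2_space" "v \<in> L2_space"
  shows "L2_norm (\<lambda>x. u x + v x) \<le> L2_norm u + L2_norm v"
proof (rule power2_le_imp_le)
  show "(L2_norm (\<lambda>x. u x + v x))\<^sup>2 \<le> (L2_norm u + L2_norm v)\<^sup>2"
    using L2_norm_add_sq[OF assms] L2_Cauchy_Schwarz[OF assms] by (simp add: power2_sum)
qed simp

lemma L2_norm_minus_commute: "L2_norm (\<lambda>x. u x - v x) = L2_norm (\<lambda>x. v x - u x)"
  by (simp add: L2_norm_def norm_minus_commute)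

lemma L2_triangle_diff:
  fixes u v :: "'a::euclidean_space \<Rightarrow> 'b::euclidean_space"
  assumes "u \<in> L2_space" "v \<in> L2_space" "w \<in> L2_space"
  shows "L2_norm (\<lambda>x. u x - w x) \<le> L2_norm (\<lambda>x. u x - v x) + L2_norm (\<lambda>x. v x - w x)"
  using L2_triangle[OF L2_space_diff[OF assms(1,2)] L2_space_diff[OF assms(2,3)]] by simp

lemma L2_triangle_diff':
  fixes u v :: "'a::euclidean_space \<Rightarrow> 'b::euclidean_space"
  assumes "u \<in> L2_space" "v \<in> L2_space" "w \<in> L2_space"
  shows "L2_norm (\<lambda>x. u x - w x) \<le> L2_norm (\<lambda>x. u x - v x) + L2_norm (\<lambda>x. w x - v x)"
  using L2_triangle_diff[OF assms] L2_norm_minus_commute[of v w] by simp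

lemma L2_norm_diff_le:
  fixes u v :: "'a::euclidean_space \<Rightarrow> 'b::euclidean_space"
  assumes "u \<in> L2_space" "v \<in> L2_space"
  shows "\<bar>L2_norm u - L2_norm v\<bar> \<le> L2_norm (\<lambda>x. u x - v x)"
  using L2_triangle[OF L2_space_diff[OF assms] assms(2)]
    L2_triangle[OF L2_space_diff[OF assms(2,1)] assms(1)] L2_norm_minus_commute[of u v] by simp

lemma L2_norm_tendsto:
  fixes v :: "'a::euclidean_space \<Rightarrow> 'b::euclidean_space"
  assumes "\<And>k. u k \<in> L2_space" "v \<in> L2_space" "(\<lambda>k. L2_norm (\<lambda>x. u k x - v x)) \<longlonglongrightarrow> 0"
  shows "(\<lambda>k. L2_norm (u k)) \<longlonglongrightarrow> L2_norm v"
  by (rule LIM_zero_cancel, rule Lim_null_comparison[OF _ assms(3)])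
     (use L2_norm_diff_le[OF assms(1,2)] in auto)

lemma L2_inner_tendsto:
  assumes "\<And>k. u k \<in> L2_space" "v \<in> L2_space" "w \<in> L2_space"
    "(\<lambda>k. L2_norm (\<lambda>x. u k x - v x)) \<longlonglongrightarrow> 0"
  shows "(\<lambda>k. L2_inner (u k) w) \<longlonglongrightarrow> L2_inner v w"
proof (rule LIM_zero_cancel, rule Lim_null_comparison)
  show "\<forall>\<^sub>F k in sequentially.
      norm (L2_inner (u k) w - L2_inner v w) \<le> L2_norm (\<lambda>x. u k x - v x) * L2_norm w"
    using L2_Cauchy_Schwarz[OF L2_space_diff[OF assms(1,2)] assms(3)] L2_inner_diff[OF assms(1-3)]
    by auto
  show "(\<lambda>k. L2_norm (\<lambda>x. u k x - v x) * L2_norm w) \<longlonglongrightarrow> 0"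
    using tendsto_mult_right[OF assms(4), of "L2_norm w"] by simp
qed

lemma L2_AE_subseq:
  assumes "\<And>k. u k \<in> L2_space" "v \<in> L2_space" "(\<lambda>k. L2_norm (\<lambda>x. u k x - v x)) \<longlonglongrightarrow> 0"
  shows "\<exists>r::nat\<Rightarrow>nat. strict_mono r \<and> (AE x in lborel. (\<lambda>n. u (r n) x) \<longlonglongrightarrow> v x)"
proof -
  have "(\<lambda>k. (L2_norm (\<lambda>x. u k x - v x))\<^sup>2) \<longlonglongrightarrow> 0"
    using tendsto_power[OF assms(3), of 2] by simp
  then have "(\<lambda>k. LINT x|lborel. norm ((norm (u k x - v x))\<^sup>2)) \<longlonglongrightarrow> 0"
    by (simp add: L2_norm_sq)
  from tendsto_L1_AE_subseq[OF L2_space_integrable[OF L2_space_diff[OF assms(1,2)]] this]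
  obtain r :: "nat \<Rightarrow> nat" where r: "strict_mono r"
    "AE x in lborel. (\<lambda>n. (norm (u (r n) x - v x))\<^sup>2) \<longlonglongrightarrow> 0" by auto
  from r(2) have "AE x in lborel. (\<lambda>n. u (r n) x) \<longlonglongrightarrow> v x"
  proof eventually_elim
    case (elim x)
    then have "(\<lambda>n. sqrt ((norm (u (r n) x - v x))\<^sup>2)) \<longlonglongrightarrow> sqrt 0" by (rule tendsto_real_sqrt)
    then show ?case by (simp add: tendsto_norm_zero_iff LIM_zero_iff)
  qed
  with r(1) show ?thesis by blast
qed

lemma L2_dominated_convergence:
  fixes v :: "'a::euclidean_space \<Rightarrow> 'b::euclidean_space"
  assumes meas: "\<And>k. u k \<in> borel_measurable borel" and v: "v \<in> borel_measurable borel"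
    and g: "g \<in> L2_space" and le: "\<And>k. AE x in lborel. norm (u k x - v x) \<le> norm (g x)"
    and lim: "AE x in lborel. (\<lambda>k. u k x) \<longlonglongrightarrow> v x"
  shows "(\<lambda>k. L2_norm (\<lambda>x. u k x - v x)) \<longlonglongrightarrow> 0"
proof -
  have "(\<lambda>k. LINT x|lborel. (norm (u k x - v x))\<^sup>2) \<longlonglongrightarrow> (LINT x|(lborel :: 'a measure). (0::real))"
  proof (rule integral_dominated_convergence[OF _ _ L2_space_integrable[OF g]])
    show "AE x in lborel. (\<lambda>k. (norm (u k x - v x))\<^sup>2) \<longlonglongrightarrow> 0"
      using lim
    proof eventually_elim
      case (elim x)
      then have "(\<lambda>k. (norm (u k x - v x))\<^sup>2) \<longlonglongrightarrow> (norm (v x - v x))\<^sup>2"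
        by (intro tendsto_intros)
      then show ?case by simp
    qed
    show "AE x in lborel. norm ((norm (u k x - v x))\<^sup>2) \<le> (norm (g x))\<^sup>2" for k
      using le[of k] by eventually_elim (auto intro: power_mono)
  qed (use meas v in auto)
  then have "(\<lambda>k. sqrt (LINT x|lborel. (norm (u k x - v x))\<^sup>2)) \<longlonglongrightarrow> sqrt 0"
    by (intro tendsto_real_sqrt) simp
  then show ?thesis by (simp add: L2_norm_def)
qed

lemma L2_nn_norm:
  assumes "u \<in> L2_space"
  shows "(\<integral>\<^sup>+x. ennreal ((norm (u x))\<^sup>2) \<partial>lborel) = ennreal ((L2_norm u)\<^sup>2)"
  by (simp add: L2_norm_sq nn_integral_eq_integral[OF L2_space_integrable[OF assms]])

lemma L2_space_nn_bound:
  assumes "u \<in> borel_measurable borel" "(\<integral>\<^sup>+x. ennreal ((norm (u x))\<^sup>2) \<partial>lborel) \<le> ennreal (B\<^sup>2)" "0 \<le> B"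
  shows "u \<in> L2_space" "L2_norm u \<le> B"
proof -
  show *: "u \<in> L2_space"
  proof (rule L2_spaceI[OF assms(1)], rule integrableI_bounded)
    show "(\<integral>\<^sup>+ x. ennreal (norm ((norm (u x))\<^sup>2)) \<partial>lborel) < \<infinity>"
      using assms(2) by (simp add: order_le_less_trans)
  qed (use assms(1) in auto)
  show "L2_norm u \<le> B"
  proof (rule power2_le_imp_le[OF _ assms(3)])
    have "ennreal ((L2_norm u)\<^sup>2) \<le> ennreal (B\<^sup>2)" using assms(2) by (simp add: L2_nn_norm[OF *])
    then show "(L2_norm u)\<^sup>2 \<le> B\<^sup>2" by (subst (asm) ennreal_le_iff) auto
  qed
qed

text \<open>
  Riesz--Fischer. A subsequence whose consecutive distances are at most \<open>(1/2) ^ k\<close> converges pointwise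
  almost everywhere: the sum over \<open>k\<close> of the weighted squares \<open>2 ^ k * (d k x)\<^sup>2\<close> of its increments has a finite
  integral, so for almost every \<open>x\<close> these squares are bounded and the increments decay geometrically. Fatou's lemma then bounds the
  distance to the pointwise limit.
\<close>

lemma L2_complete:
  fixes u :: "nat \<Rightarrow> 'a::euclidean_space \<Rightarrow> 'b::euclidean_space"
  assumes u: "\<And>k. u k \<in> L2_space"
    and cauchy: "\<And>e. e > 0 \<Longrightarrow> \<exists>N. \<forall>m\<ge>N. \<forall>n\<ge>N. L2_norm (\<lambda>x. u m x - u n x) < e"
  shows "\<exists>v\<in>L2_space. (\<lambda>k. L2_norm (\<lambda>x. u k x - v x)) \<longlonglongrightarrow> 0"
proof -
  note [measurable] = u[THEN L2_space_measurable]
  have "\<exists>N. \<forall>k. (\<forall>m\<ge>N k. \<forall>n\<ge>N k. L2_norm (\<lambda>x. u m x - u n x) < (1/2)^k)"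
    using cauchy[of "(1/2)^k" for k] by (intro choice) simp
  then obtain N where N: "\<And>k m n. m \<ge> N k \<Longrightarrow> n \<ge> N k \<Longrightarrow> L2_norm (\<lambda>x. u m x - u n x) < (1/2)^k"
    by blast
  \<comment> \<open>The partial sums make the subsequence increasing and at least \<open>N\<close>, whatever the choice of \<open>N\<close>.\<close>
  define r where "r k = k + (\<Sum>j\<le>k. N j)" for k
  have rN: "N k \<le> r k" for k
    unfolding r_def by (simp add: trans_le_add2 member_le_sum)
  have rk: "k \<le> r k" for k by (simp add: r_def)
  have rS: "r k \<le> r (Suc k)" for k by (simp add: r_def)
  define d where "d k x = norm (u (r (Suc k)) x - u (r k) x)" for k x
  have [measurable]: "d k \<in> borel_measurable borel" for k
    unfolding d_def by measurable
  have dint: "(\<integral>\<^sup>+x. ennreal (2^k * (d k x)\<^sup>2) \<partial>lborel) \<le> ennreal ((1/2)^k)" for k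
  proof -
    have n: "L2_norm (\<lambda>x. u (r (Suc k)) x - u (r k) x) \<le> (1/2)^k"
      using N[of k "r (Suc k)" "r k"] rN[of k] rS[of k] by simp
    have "(\<integral>\<^sup>+x. ennreal (2^k * (d k x)\<^sup>2) \<partial>lborel)
        = ennreal (2^k) * (\<integral>\<^sup>+x. ennreal ((d k x)\<^sup>2) \<partial>lborel)"
      by (subst nn_integral_cmult[symmetric]) (auto simp: ennreal_mult)
    also have "\<dots> = ennreal (2^k * (L2_norm (\<lambda>x. u (r (Suc k)) x - u (r k) x))\<^sup>2)"
      unfolding d_def by (subst L2_nn_norm[OF L2_space_diff[OF u u]]) (simp add: ennreal_mult)
    also have "\<dots> \<le> ennreal (2^k * ((1/2)^k)\<^sup>2)"
      by (intro ennreal_leI mult_left_mono power_mono n) auto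
    also have "2^k * ((1/2)^k)\<^sup>2 = ((1/2)^k :: real)"
      by (simp add: power2_eq_square power_one_over)
    finally show ?thesis .
  qed
  have "(\<integral>\<^sup>+x. (\<Sum>k. ennreal (2^k * (d k x)\<^sup>2)) \<partial>lborel) = (\<Sum>k. \<integral>\<^sup>+x. ennreal (2^k * (d k x)\<^sup>2) \<partial>lborel)"
    by (rule nn_integral_suminf) simp
  also have "\<dots> \<le> (\<Sum>k. ennreal ((1/2)^k))"
    by (intro suminf_le dint) auto
  also have "\<dots> = ennreal (\<Sum>k. (1/2)^k)"
    by (intro suminf_ennreal2) (auto intro: summable_geometric)
  also have "\<dots> < \<infinity>" by simp
  finally have "AE x in lborel. (\<Sum>k. ennreal (2^k * (d k x)\<^sup>2)) \<noteq> \<infinity>"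
    by (intro nn_integral_PInf_AE) auto
  then have conv: "AE x in lborel. convergent (\<lambda>k. u (r k) x)"
  proof eventually_elim
    case (elim x)
    have "summable (\<lambda>k. 2^k * (d k x)\<^sup>2)"
      by (rule summable_suminf_not_top) (use elim in \<open>auto simp: d_def\<close>)
    then have "Bseq (\<lambda>k. 2^k * (d k x)\<^sup>2)"
      by (intro convergent_imp_Bseq) (auto dest: summable_LIMSEQ_zero simp: convergent_def)
    then obtain K where K: "K > 0" "\<And>k. norm (2^k * (d k x)\<^sup>2) \<le> K" by (auto elim: BseqE)
    have "d k x \<le> sqrt K * (sqrt (1/2))^k" for k
    proof (rule power2_le_imp_le)
      have "2^k * (d k x)\<^sup>2 \<le> K" using K(2)[of k] by simp
      then have "(d k x)\<^sup>2 \<le> K * (1/2)^k" by (simp add: power_one_over field_simps)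
      also have "\<dots> = (sqrt K * (sqrt (1/2))^k)\<^sup>2"
        using K(1) by (simp add: power_mult_distrib power_mult[symmetric] mult.commute[of k 2])
           (simp add: power_mult)
      finally show "(d k x)\<^sup>2 \<le> (sqrt K * (sqrt (1/2))^k)\<^sup>2" .
    qed (use K(1) in auto)
    then have le: "norm (u (r (Suc k)) x - u (r k) x) \<le> sqrt K * (sqrt (1/2))^k" for k
      unfolding d_def .
    have "summable (\<lambda>k. sqrt K * (sqrt (1/2))^k)"
      by (intro summable_mult summable_geometric) (simp add: real_sqrt_divide)
    then have "summable (\<lambda>k. u (r (Suc k)) x - u (r k) x)"
      by (rule summable_comparison_test'[where N=0]) (rule le)
    then have "convergent (\<lambda>n. \<Sum>k<n. u (r (Suc k)) x - u (r k) x)"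
      by (simp add: summable_iff_convergent)
    then have "convergent (\<lambda>n. u (r n) x - u (r 0) x)"
      using sum_lessThan_telescope[of "\<lambda>k. u (r k) x"] by simp
    then have "convergent (\<lambda>n. (u (r n) x - u (r 0) x) + u (r 0) x)"
      by (intro convergent_add convergent_const)
    then show ?case by simp
  qed
  define v where "v x = lim (\<lambda>k. u (r k) x)" for x
  have v [measurable]: "v \<in> borel_measurable borel"
    unfolding v_def by (rule borel_measurable_lim_metric) measurable
  have bound: "(\<lambda>x. u n x - v x) \<in> L2_space \<and> L2_norm (\<lambda>x. u n x - v x) \<le> (1/2)^k" if "n \<ge> N k" for n k
  proof -
    have "(\<integral>\<^sup>+x. ennreal ((norm (u n x - v x))\<^sup>2) \<partial>lborel)
        = (\<integral>\<^sup>+x. liminf (\<lambda>j. ennreal ((norm (u n x - u (r j) x))\<^sup>2)) \<partial>lborel)"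
    proof (rule nn_integral_cong_AE)
      show "AE x in lborel. ennreal ((norm (u n x - v x))\<^sup>2)
          = liminf (\<lambda>j. ennreal ((norm (u n x - u (r j) x))\<^sup>2))"
        using conv
      proof eventually_elim
        case (elim x)
        then have "(\<lambda>j. u (r j) x) \<longlonglongrightarrow> v x" by (simp add: v_def convergent_LIMSEQ_iff)
        then have "(\<lambda>j. ennreal ((norm (u n x - u (r j) x))\<^sup>2)) \<longlonglongrightarrow> ennreal ((norm (u n x - v x))\<^sup>2)"
          by (intro tendsto_ennrealI tendsto_intros)
        then show ?case by (rule lim_imp_Liminf[OF sequentially_bot, symmetric])
      qed
    qed
    also have "\<dots> \<le> liminf (\<lambda>j. \<integral>\<^sup>+x. ennreal ((norm (u n x - u (r j) x))\<^sup>2) \<partial>lborel)"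
      by (rule nn_integral_liminf) simp
    also have "\<dots> = liminf (\<lambda>j. ennreal ((L2_norm (\<lambda>x. u n x - u (r j) x))\<^sup>2))"
      by (simp add: L2_nn_norm[OF L2_space_diff[OF u u]])
    also have "\<dots> \<le> liminf (\<lambda>j. ennreal (((1/2)^k)\<^sup>2))"
    proof (rule Liminf_mono)
      show "\<forall>\<^sub>F j in sequentially. ennreal ((L2_norm (\<lambda>x. u n x - u (r j) x))\<^sup>2) \<le> ennreal (((1/2)^k)\<^sup>2)"
        using eventually_ge_at_top[of "N k"]
      proof eventually_elim
        case (elim j)
        then have "r j \<ge> N k" using rk[of j] by simp
        then have "L2_norm (\<lambda>x. u n x - u (r j) x) \<le> (1/2)^k" using N[OF that] by (simp add: less_imp_le)
        then show ?case by (intro ennreal_leI power_mono) auto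
      qed
    qed
    also have "\<dots> = ennreal (((1/2)^k)\<^sup>2)" by (simp add: Liminf_const)
    finally show ?thesis using L2_space_nn_bound[of "\<lambda>x. u n x - v x" "(1/2)^k"] by simp
  qed
  have "(\<lambda>x. u (N 0) x - (u (N 0) x - v x)) \<in> L2_space"
    by (rule L2_space_diff[OF u]) (use bound[of 0 "N 0"] in simp)
  then have "v \<in> L2_space" by simp
  moreover have "(\<lambda>k. L2_norm (\<lambda>x. u k x - v x)) \<longlonglongrightarrow> 0"
  proof (rule LIMSEQ_I)
    fix e :: real assume "e > 0"
    then obtain k where "(1/2)^k < e" using real_arch_pow_inv[of e "1/2"] by auto
    then have "norm (L2_norm (\<lambda>x. u n x - v x) - 0) < e" if "n \<ge> N k" for n
      using bound[OF that] by simp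
    then show "\<exists>no. \<forall>n\<ge>no. norm (L2_norm (\<lambda>x. u n x - v x) - 0) < e" by blast
  qed
  ultimately show ?thesis by blast
qed

section \<open>Affine changes of variable and density of continuous functions\<close>

lemma nn_integral_lborel_affine:
  fixes t :: "'a::euclidean_space"
  assumes [measurable]: "f \<in> borel_measurable borel" and c: "c \<noteq> 0"
  shows "(\<integral>\<^sup>+x. f x \<partial>lborel) = ennreal (\<bar>c\<bar> ^ DIM('a)) * (\<integral>\<^sup>+x. f (t + c *\<^sub>R x) \<partial>lborel)"
  by (subst lborel_affine[OF c, of t])
     (simp add: nn_integral_density nn_integral_distr nn_integral_cmult)

lemma integrable_lborel_affine:
  fixes t :: "'a::euclidean_space" and f :: "'a \<Rightarrow> 'b::{banach, second_countable_topology}"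
  assumes f: "integrable lborel f" and c: "c \<noteq> 0"
  shows "integrable lborel (\<lambda>x. f (t + c *\<^sub>R x))"
proof -
  have [measurable]: "f \<in> borel_measurable borel" using f by auto
  have "ennreal (\<bar>c\<bar> ^ DIM('a)) * (\<integral>\<^sup>+x. ennreal (norm (f (t + c *\<^sub>R x))) \<partial>lborel) < \<infinity>"
    using f nn_integral_lborel_affine[of "\<lambda>x. ennreal (norm (f x))" c t] c
    by (simp add: integrable_iff_bounded)
  then show ?thesis
    using c by (auto simp: integrable_iff_bounded ennreal_mult_less_top)
qed

lemma integral_lborel_affine:
  fixes t :: "'a::euclidean_space" and f :: "'a \<Rightarrow> 'b::{banach, second_countable_topology}"
  assumes f: "integrable lborel f" and c: "c \<noteq> 0"
  shows "(LINT x|lborel. f x) = (\<bar>c\<bar> ^ DIM('a)) *\<^sub>R (LINT x|lborel. f (t + c *\<^sub>R x))"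
proof -
  have [measurable]: "f \<in> borel_measurable borel" using f by auto
  show ?thesis
    using integrable_lborel_affine[OF f c, of t]
    by (subst lborel_affine[OF c, of t]) (simp add: integral_density integral_distr)
qed

lemma AE_lborel_affine:
  fixes t :: "'a::euclidean_space"
  assumes "AE x in lborel. P x" "c \<noteq> 0"
  shows "AE x in lborel. P (t + c *\<^sub>R x)"
proof -
  obtain N where N: "{x. \<not> P x} \<subseteq> N" "N \<in> sets borel" "emeasure lborel N = 0"
    using assms(1) by (auto elim!: AE_E)
  have [measurable]: "N \<in> sets borel" by fact
  have "0 = (\<integral>\<^sup>+x. indicator N x \<partial>lborel)" using N by simp
  also have "\<dots> = ennreal (\<bar>c\<bar> ^ DIM('a)) * (\<integral>\<^sup>+x. indicator N (t + c *\<^sub>R x) \<partial>lborel)"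
    by (rule nn_integral_lborel_affine[OF _ assms(2)]) simp
  finally have "(\<integral>\<^sup>+x. indicator N (t + c *\<^sub>R x) \<partial>lborel) = (0::ennreal)"
    using assms(2) by simp
  then have "AE x in lborel. indicator N (t + c *\<^sub>R x) = (0::ennreal)"
    by (subst (asm) nn_integral_0_iff_AE) auto
  then show ?thesis
  proof eventually_elim
    case (elim x)
    then show ?case using N(1) by (auto simp: indicator_def split: if_splits)
  qed
qed

lemma L2_space_affine:
  assumes "u \<in> L2_space" "c \<noteq> 0"
  shows "(\<lambda>x. u (t + c *\<^sub>R x)) \<in> L2_space"
proof (rule L2_spaceI)
  note [measurable] = L2_space_measurable[OF assms(1)]
  show "(\<lambda>x. u (t + c *\<^sub>R x)) \<in> borel_measurable borel" by measurable
qed (rule integrable_lborel_affine[OF L2_space_integrable[OF assms(1)] assms(2)])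

lemma L2_space_shift: "u \<in> L2_space \<Longrightarrow> (\<lambda>x. u (x + z)) \<in> L2_space"
  using L2_space_affine[of u 1 z] by (simp add: add.commute)

lemma L2_norm_shift: "u \<in> L2_space \<Longrightarrow> L2_norm (\<lambda>x. u (x + z)) = L2_norm u"
  using integral_lborel_affine[OF L2_space_integrable[of u], of 1 z]
  by (simp add: add.commute L2_norm_def)

lemma L2_dense_bounded_support:
  fixes u :: "'a::euclidean_space \<Rightarrow> 'b::euclidean_space"
  assumes "u \<in> L2_space"
  defines "f \<equiv> \<lambda>k x. indicator {x. norm x \<le> real k \<and> norm (u x) \<le> real k} x *\<^sub>R u x"
  shows "(\<lambda>k. L2_norm (\<lambda>x. f k x - u x)) \<longlonglongrightarrow> 0"
proof (rule L2_dominated_convergence[OF _ _ assms(1)])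
  note [measurable] = L2_space_measurable[OF assms(1)]
  show "f k \<in> borel_measurable borel" for k unfolding f_def by measurable
  show "u \<in> borel_measurable borel" by measurable
  show "AE x in lborel. norm (f k x - u x) \<le> norm (u x)" for k
    by (auto simp: f_def indicator_def)
  show "AE x in lborel. (\<lambda>k. f k x) \<longlonglongrightarrow> u x"
  proof (rule AE_I2)
    fix x
    obtain K where K: "max (norm x) (norm (u x)) \<le> real K" using real_arch_simple by blast
    have "eventually (\<lambda>k. u x = f k x) sequentially"
      using eventually_ge_at_top[of K]
    proof eventually_elim
      case (elim k)
      then have "max (norm x) (norm (u x)) \<le> real k" using K by linarith
      then show ?case by (simp add: f_def)
    qed
    then show "(\<lambda>k. f k x) \<longlonglongrightarrow> u x" by (rule Lim_transform_eventually[OF tendsto_const])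
  qed
qed

lemma L2_space_bounded_support:
  fixes u :: "'a::euclidean_space \<Rightarrow> 'b::euclidean_space"
  assumes [measurable]: "u \<in> borel_measurable borel"
    and B: "\<And>x. norm (u x) \<le> B" "\<And>x. R < norm x \<Longrightarrow> u x = 0"
  shows "u \<in> L2_space"
proof (rule L2_spaceI)
  have "integrable lborel (\<lambda>x::'a. indicator (cball 0 R) x *\<^sub>R (B\<^sup>2 :: real))"
    by (intro integrable_scaleR_left impI integrable_real_indicator emeasure_bounded_finite) auto
  then show "integrable lborel (\<lambda>x. (norm (u x))\<^sup>2)"
    by (rule Bochner_Integration.integrable_bound)
       (use B in \<open>auto simp: indicator_def not_le intro!: power_mono\<close>)
qed simp

text \<open>
  After a truncation \<open>u\<close> is bounded by \<open>B\<close> and supported in a ball. Almost everywhere it is a limit of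
  continuous functions, and cutting those off at height \<open>B\<close> and outside a slightly larger ball keeps them
  continuous and the limit unchanged, but makes the convergence dominated.
\<close>

lemma L2_dense_continuous:
  fixes u :: "'a::euclidean_space \<Rightarrow> 'b::euclidean_space"
  assumes u: "u \<in> L2_space" and e: "e > 0"
  obtains g B where "continuous_on UNIV g" "g \<in> L2_space" "\<And>x. norm (g x) \<le> B"
    "\<And>x. B < norm x \<Longrightarrow> g x = 0" "L2_norm (\<lambda>x. g x - u x) < e"
proof -
  note [measurable] = L2_space_measurable[OF u]
  define f where "f k x = indicator {x. norm x \<le> real k \<and> norm (u x) \<le> real k} x *\<^sub>R u x" for k x
  have "eventually (\<lambda>k. L2_norm (\<lambda>x. f k x - u x) < e / 2) sequentially"
    using order_tendstoD(2)[OF L2_dense_bounded_support[OF u], of "e / 2"] e unfolding f_def by simp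
  then obtain k where k: "L2_norm (\<lambda>x. f k x - u x) < e / 2"
    by (auto simp: eventually_sequentially)
  define B where "B = real k + 1"
  have [measurable]: "f k \<in> borel_measurable borel" unfolding f_def by measurable
  have fB: "norm (f k x) \<le> B" "norm x > B \<Longrightarrow> f k x = 0" for x
    by (auto simp: f_def B_def indicator_def)
  have fL: "f k \<in> L2_space" by (rule L2_space_bounded_support[OF _ fB]) auto
  have "f k \<in> borel_measurable lebesgue" by (simp add: measurable_completion)
  then have "f k measurable_on UNIV" by (rule lebesgue_measurable_imp_measurable_on) simp
  then obtain N G where N: "negligible N" and G: "\<And>n. continuous_on UNIV (G n)"
      "\<And>x. x \<notin> N \<Longrightarrow> (\<lambda>n. G n x) \<longlonglongrightarrow> f k x"
    unfolding measurable_on_def by auto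
  define cut where "cut x = max 0 (min 1 (B + 1 - norm x))" for x :: 'a
  define clamp where "clamp v = (B / max B (norm v)) *\<^sub>R v" for v :: 'b
  define h where "h n x = cut x *\<^sub>R clamp (G n x)" for n x
  have B0: "B > 0" by (simp add: B_def)
  have mB: "max B t \<noteq> 0" for t using B0 by (simp add: max_def)
  have hc: "continuous_on UNIV (h n)" for n
    unfolding h_def cut_def clamp_def using G(1)[of n] mB by (intro continuous_intros) auto
  then have [measurable]: "h n \<in> borel_measurable borel" for n
    by (rule borel_measurable_continuous_onI)
  have clampB: "norm (clamp v) \<le> B" for v
    using B0 by (auto simp: clamp_def max_def field_simps)
  have cut01: "0 \<le> cut x" "cut x \<le> 1" for x by (auto simp: cut_def)
  have hB: "norm (h n x) \<le> B" for n x
    using mult_mono[OF cut01(2)[of x] clampB[of "G n x"]] cut01(1)[of x] by (simp add: h_def)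
  have hB0: "h n x = 0" if "B + 1 < norm x" for n x using that by (simp add: h_def cut_def)
  have "(\<lambda>n. L2_norm (\<lambda>x. h n x - f k x)) \<longlonglongrightarrow> 0"
  proof (rule L2_dominated_convergence)
    show "(\<lambda>x::'a. indicator (cball 0 (B + 1)) x * (2 * B)) \<in> L2_space"
      by (rule L2_space_bounded_support[where B="2 * B" and R="B + 1"])
         (use B0 in \<open>auto simp: indicator_def\<close>)
    show "AE x in lborel. norm (h n x - f k x) \<le> norm (indicator (cball 0 (B + 1)) x * (2 * B))" for n
    proof (rule AE_I2)
      fix x :: 'a
      show "norm (h n x - f k x) \<le> norm (indicator (cball 0 (B + 1)) x * (2 * B))"
        using hB[of n x] fB[of x] hB0[of x n] norm_triangle_ineq4[of "h n x" "f k x"] B0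
        by (cases "B + 1 < norm x") (auto simp: indicator_def)
    qed
    have "AE x in lebesgue. x \<notin> N" using N by (simp add: AE_not_in negligible_iff_null_sets)
    then have "AE x in lborel. x \<notin> N" by (simp add: AE_completion_iff)
    then show "AE x in lborel. (\<lambda>n. h n x) \<longlonglongrightarrow> f k x"
    proof eventually_elim
      case (elim x)
      have "(\<lambda>n. h n x) \<longlonglongrightarrow> cut x *\<^sub>R ((B / max B (norm (f k x))) *\<^sub>R f k x)"
        unfolding h_def clamp_def by (intro tendsto_intros G(2) elim mB)
      moreover have "cut x *\<^sub>R ((B / max B (norm (f k x))) *\<^sub>R f k x) = f k x"
      proof (cases "norm x \<le> B")
        case True
        then have "cut x = 1" by (simp add: cut_def)
        moreover have "max B (norm (f k x)) = B" using fB(1)[of x] by simp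
        ultimately show ?thesis using B0 by simp
      qed (use fB(2)[of x] in simp)
      ultimately show ?case by simp
    qed
  qed auto
  then have "eventually (\<lambda>n. L2_norm (\<lambda>x. h n x - f k x) < e / 2) sequentially"
    using order_tendstoD(2)[of _ 0 sequentially "e / 2"] e by simp
  then obtain n where n: "L2_norm (\<lambda>x. h n x - f k x) < e / 2"
    by (auto simp: eventually_sequentially)
  have hL: "h n \<in> L2_space" by (rule L2_space_bounded_support[OF _ hB hB0]) auto
  show ?thesis
  proof (rule that[of "h n" "B + 1"])
    show "L2_norm (\<lambda>x. h n x - u x) < e"
      using L2_triangle_diff[OF hL fL u] n k by linarith
    show "norm (h n x) \<le> B + 1" for x using hB[of n x] by linarith
  qed (use hc hL hB0 in auto)
qed

text \<open>For a continuous function of bounded support the claim is dominated convergence, and translations are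
  isometries, so the error of an approximation by such a function is the same before and after the shift.\<close>

lemma L2_translation_continuous:
  fixes u :: "'a::euclidean_space \<Rightarrow> 'b::euclidean_space"
  assumes u: "u \<in> L2_space" and z: "z \<longlonglongrightarrow> 0"
  shows "(\<lambda>k. L2_norm (\<lambda>x. u (x + z k) - u x)) \<longlonglongrightarrow> 0"
proof (rule LIMSEQ_I)
  fix e :: real assume "e > 0"
  then have "e / 3 > 0" by simp
  then obtain g B where g: "continuous_on UNIV g" "g \<in> L2_space" "\<And>x. norm (g x) \<le> B"
    "\<And>x. B < norm x \<Longrightarrow> g x = 0" "L2_norm (\<lambda>x. g x - u x) < e / 3"
    by (rule L2_dense_continuous[OF u]) (rule that)
  have [measurable]: "g \<in> borel_measurable borel" using g(1) by (rule borel_measurable_continuous_onI)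
  have B0: "0 \<le> B" using g(3)[of 0] norm_ge_zero order_trans by blast
  obtain M where M: "\<And>k. norm (z k) \<le> M"
    using convergent_imp_Bseq[OF convergentI[OF z]] by (auto simp: Bseq_def)
  have "(\<lambda>k. L2_norm (\<lambda>x. g (x + z k) - g x)) \<longlonglongrightarrow> 0"
  proof (rule L2_dominated_convergence)
    show "(\<lambda>x::'a. indicator (cball 0 (B + M)) x * (2 * B)) \<in> L2_space"
      by (rule L2_space_bounded_support[where B="2 * B" and R="B + M"])
         (use B0 in \<open>auto simp: indicator_def\<close>)
    show "AE x in lborel. norm (g (x + z k) - g x) \<le> norm (indicator (cball 0 (B + M)) x * (2 * B))" for k
    proof (rule AE_I2)
      fix x :: 'a
      show "norm (g (x + z k) - g x) \<le> norm (indicator (cball 0 (B + M)) x * (2 * B))"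
      proof (cases "norm x > B + M")
        case True
        have "norm x - M \<le> norm (x + z k)"
          using norm_diff_ineq[of x "z k"] M[of k] by linarith
        then have "norm (x + z k) > B" "norm x > B"
          using True M[of k] norm_ge_zero[of "z k"] by linarith+
        then show ?thesis using g(4) by simp
      next
        case False
        then show ?thesis
          using g(3)[of x] g(3)[of "x + z k"] norm_triangle_ineq4[of "g (x + z k)" "g x"] B0
          by (auto simp: indicator_def)
      qed
    qed
    show "AE x in lborel. (\<lambda>k. g (x + z k)) \<longlonglongrightarrow> g x"
    proof (rule AE_I2)
      fix x
      have "(\<lambda>k. x + z k) \<longlonglongrightarrow> x + 0" by (intro tendsto_intros z)
      then show "(\<lambda>k. g (x + z k)) \<longlonglongrightarrow> g x"
        using continuous_on_tendsto_compose[OF g(1)] by simp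
    qed
  qed auto
  then have "eventually (\<lambda>k. L2_norm (\<lambda>x. g (x + z k) - g x) < e / 3) sequentially"
    using order_tendstoD(2)[of _ 0 sequentially "e / 3"] \<open>e > 0\<close> by simp
  then obtain N where N: "\<And>k. k \<ge> N \<Longrightarrow> L2_norm (\<lambda>x. g (x + z k) - g x) < e / 3"
    by (auto simp: eventually_sequentially)
  have "norm (L2_norm (\<lambda>x. u (x + z k) - u x) - 0) < e" if "k \<ge> N" for k
  proof -
    note us = L2_space_shift[OF u, of "z k"] and gs = L2_space_shift[OF g(2), of "z k"]
    have "L2_norm (\<lambda>x. u (x + z k) - g (x + z k)) < e / 3"
      using L2_norm_shift[OF L2_space_diff[OF u g(2)], of "z k"] g(5) L2_norm_minus_commute[of u g]
      by simp
    then show ?thesis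
      using L2_triangle_diff[OF us gs u] L2_triangle_diff[OF gs g(2) u] N[OF that] g(5) by simp
  qed
  then show "\<exists>no. \<forall>k\<ge>no. norm (L2_norm (\<lambda>x. u (x + z k) - u x) - 0) < e" by blast
qed

section \<open>Gaussians and the Fourier transform of integrable functions\<close>

text \<open>The standard Gaussian density, as a product over coordinates: its Fourier transform is then a product
  of one-dimensional characteristic functions.\<close>

definition gauss :: "'a::euclidean_space \<Rightarrow> real" where
  "gauss x = (\<Prod>b\<in>Basis. std_normal_density (x \<bullet> b))"

lemma gauss_measurable [measurable]: "gauss \<in> borel_measurable borel"
  unfolding gauss_def by measurable

lemma gauss_eq: "gauss x = (2 * pi) powr (- real DIM('a) / 2) * exp (- (norm (x::'a::euclidean_space))\<^sup>2 / 2)"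
proof -
  have "gauss x = (1 / sqrt (2 * pi)) ^ DIM('a) * exp (\<Sum>b\<in>Basis. - (x \<bullet> b)\<^sup>2 / 2)"
    by (simp add: gauss_def std_normal_density_def prod.distrib exp_sum prod_dividef power_one_over)
  also have "(\<Sum>b\<in>Basis. - (x \<bullet> b)\<^sup>2 / 2) = - (norm x)\<^sup>2 / 2"
    unfolding power2_norm_eq_inner by (subst euclidean_inner[of x x])
      (simp add: sum_negf sum_divide_distrib power2_eq_square)
  also have "(1 / sqrt (2 * pi)) ^ DIM('a) = ((2 * pi) powr (- 1 / 2)) powr real DIM('a)"
    by (simp add: powr_realpow powr_minus powr_half_sqrt inverse_eq_divide)
  also have "\<dots> = (2 * pi) powr (- real DIM('a) / 2)"
    by (subst powr_powr) (simp add: field_simps)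
  finally show ?thesis .
qed

lemma gauss_nonneg: "0 \<le> gauss x"
  by (simp add: gauss_eq)

lemma gauss_pos: "0 < gauss x"
  by (simp add: gauss_eq)

lemma gauss_bounded: "gauss (x::'a::euclidean_space) \<le> (2 * pi) powr (- real DIM('a) / 2)"
  unfolding gauss_eq by (simp add: mult_left_le)

lemma
  fixes f :: "'a::euclidean_space \<Rightarrow> real \<Rightarrow> 'c::{real_normed_field,banach,second_countable_topology}"
  assumes f: "\<And>b. b \<in> Basis \<Longrightarrow> integrable lborel (f b)"
  shows integrable_prod_Basis: "integrable lborel (\<lambda>x. \<Prod>b\<in>Basis. f b (x \<bullet> b))"
    and integral_prod_Basis: "(LINT x|lborel. (\<Prod>b\<in>Basis. f b (x \<bullet> b))) = (\<Prod>b\<in>Basis. (LINT t|lborel. f b t))"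
proof -
  interpret P: product_sigma_finite "\<lambda>_::'a. lborel :: real measure" ..
  have [measurable]: "b \<in> Basis \<Longrightarrow> f b \<in> borel_measurable borel" for b
    using f[of b] by auto
  have m: "(\<lambda>x::'a. \<Prod>b\<in>Basis. f b (x \<bullet> b)) \<in> borel_measurable borel" by measurable
  have eq: "(\<Prod>b\<in>Basis. f b ((\<Sum>c\<in>Basis. g c *\<^sub>R c) \<bullet> b)) = (\<Prod>b\<in>Basis. f b (g b))" for g :: "'a \<Rightarrow> real"
    by (intro prod.cong) auto
  show "integrable lborel (\<lambda>x. \<Prod>b\<in>Basis. f b (x \<bullet> b))"
    by (subst lborel_eq, subst integrable_distr_eq)
       (auto simp: eq m intro!: P.product_integrable_prod f)
  show "(LINT x|lborel. (\<Prod>b\<in>Basis. f b (x \<bullet> b))) = (\<Prod>b\<in>Basis. (LINT t|lborel. f b t))"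
    by (subst lborel_eq, subst integral_distr)
       (auto simp: eq m intro!: P.product_integral_prod f)
qed

lemma borel_measurable_cis [measurable (raw)]:
  assumes "f \<in> borel_measurable M"
  shows "(\<lambda>x. cis (f x)) \<in> borel_measurable M"
  using assms by (rule measurable_compose) (intro borel_measurable_continuous_onI continuous_intros)

lemma cis_inner_eq_prod: "cis (\<xi> \<bullet> x) = (\<Prod>b\<in>Basis. cis ((\<xi> \<bullet> b) * (x \<bullet> b)))"
  by (subst euclidean_inner) (simp add: cis_conv_exp exp_sum[symmetric] sum_distrib_left)

lemma std_normal_fourier:
  "integrable lborel (\<lambda>x. cis (t * x) * complex_of_real (std_normal_density x))"
  "(LINT x|lborel. cis (t * x) * complex_of_real (std_normal_density x)) = of_real (exp (- t\<^sup>2 / 2))"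
proof -
  have i: "integrable lborel std_normal_density"
    by (rule integrable_normal_density) simp
  show "integrable lborel (\<lambda>x. cis (t * x) * complex_of_real (std_normal_density x))"
    by (rule Bochner_Integration.integrable_bound[OF i]) (auto simp: norm_mult)
  have "of_real (exp (- t\<^sup>2 / 2)) = char std_normal_distribution t"
    by (simp add: char_std_normal_distribution)
  also have "\<dots> = (LINT x|lborel. std_normal_density x *\<^sub>R iexp (t * x))"
    unfolding char_def by (subst integral_density) (auto simp: normal_density_nonneg)
  also have "\<dots> = (LINT x|lborel. cis (t * x) * complex_of_real (std_normal_density x))"
    by (simp add: cis_conv_exp scaleR_conv_of_real mult.commute)
  finally show "(LINT x|lborel. cis (t * x) * complex_of_real (std_normal_density x))
    = of_real (exp (- t\<^sup>2 / 2))" ..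
qed

lemma gauss_fourier:
  fixes \<xi> :: "'a::euclidean_space"
  shows "(LINT x|lborel. cis (\<xi> \<bullet> x) * complex_of_real (gauss x)) = of_real (exp (- (norm \<xi>)\<^sup>2 / 2))"
proof -
  have "(LINT x|lborel. cis (\<xi> \<bullet> x) * complex_of_real (gauss x))
      = (LINT x|lborel. (\<Prod>b\<in>Basis. cis ((\<xi> \<bullet> b) * (x \<bullet> b)) * complex_of_real (std_normal_density (x \<bullet> b))))"
    by (simp add: gauss_def prod.distrib cis_inner_eq_prod)
  also have "\<dots> = (\<Prod>b\<in>Basis. complex_of_real (exp (- (\<xi> \<bullet> b)\<^sup>2 / 2)))"
    by (subst integral_prod_Basis) (auto simp: std_normal_fourier)
  also have "\<dots> = of_real (exp (\<Sum>b\<in>Basis. - (\<xi> \<bullet> b)\<^sup>2 / 2))"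
    by (simp add: exp_sum)
  also have "(\<Sum>b\<in>Basis. - (\<xi> \<bullet> b)\<^sup>2 / 2) = - (norm \<xi>)\<^sup>2 / 2"
    unfolding power2_norm_eq_inner by (subst euclidean_inner[of \<xi> \<xi>])
      (simp add: sum_negf sum_divide_distrib power2_eq_square)
  finally show ?thesis .
qed

lemma integrable_gauss: "integrable lborel (gauss :: 'a::euclidean_space \<Rightarrow> real)"
  unfolding gauss_def by (intro integrable_prod_Basis integrable_normal_density) simp

lemma integral_gauss: "(LINT x::'a::euclidean_space|lborel. gauss x) = 1"
proof -
  have "complex_of_real (LINT x::'a|lborel. gauss x) = 1"
    using gauss_fourier[of "0::'a"] by (simp add: integral_complex_of_real)
  then show ?thesis by simp
qed

lemma integrable_pair_bound:
  fixes u :: "'a::euclidean_space \<Rightarrow> complex" and v :: "'b::euclidean_space \<Rightarrow> complex"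
  assumes u: "integrable lborel u" and v: "integrable lborel v"
    and b [measurable]: "f \<in> borel_measurable (borel \<Otimes>\<^sub>M borel)"
    and le: "\<And>x y. norm (f (x, y)) \<le> norm (u x) * norm (v y)"
  shows "integrable (lborel \<Otimes>\<^sub>M lborel) (f :: _ \<Rightarrow> complex)"
proof -
  have [measurable]: "u \<in> borel_measurable borel" "v \<in> borel_measurable borel" using u v by auto
  have "integrable (lborel \<Otimes>\<^sub>M lborel) (\<lambda>(x, y). u x * v y)"
  proof (rule lborel_pair.Fubini_integrable)
    show "integrable lborel (\<lambda>x. LINT y|lborel. norm (case (x, y) of (x, y) \<Rightarrow> u x * v y))"
      using u by (simp add: norm_mult)
    show "AE x in lborel. integrable lborel (\<lambda>y. case (x, y) of (x, y) \<Rightarrow> u x * v y)"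
      using v by simp
  qed simp
  then show ?thesis
  proof (rule Bochner_Integration.integrable_bound)
    show "AE z in lborel \<Otimes>\<^sub>M lborel. norm (f z) \<le> norm (case z of (x, y) \<Rightarrow> u x * v y)"
      using le by (auto simp: norm_mult)
  qed simp
qed

lemma fourier_L1_measurable [measurable]:
  assumes [measurable]: "u \<in> borel_measurable borel"
  shows "fourier_L1 u \<in> borel_measurable borel"
  unfolding fourier_L1_def by measurable

lemma fourier_L1_bound:
  fixes u :: "'a::euclidean_space \<Rightarrow> complex"
  assumes "integrable lborel u"
  shows "norm (fourier_L1 u \<xi>) \<le> (2 * pi) powr (- real DIM('a) / 2) * (LINT x|lborel. norm (u x))"
proof -
  have "norm (LINT x|lborel. cis (- (\<xi> \<bullet> x)) * u x) \<le> (LINT x|lborel. norm (cis (- (\<xi> \<bullet> x)) * u x))"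
    by (rule integral_norm_bound)
  then show ?thesis
    unfolding fourier_L1_def norm_mult by (simp add: norm_mult mult_left_mono)
qed

lemma integrable_cis_mult:
  fixes u :: "'a::euclidean_space \<Rightarrow> complex"
  assumes "integrable lborel u"
  shows "integrable lborel (\<lambda>x. cis (\<xi> \<bullet> x) * u x)" "integrable lborel (\<lambda>x. cis (- (\<xi> \<bullet> x)) * u x)"
proof -
  have [measurable]: "u \<in> borel_measurable borel" using assms by auto
  show "integrable lborel (\<lambda>x. cis (\<xi> \<bullet> x) * u x)" "integrable lborel (\<lambda>x. cis (- (\<xi> \<bullet> x)) * u x)"
    by (rule Bochner_Integration.integrable_bound[OF assms]; simp add: norm_mult)+
qed

text \<open>Fubini: both sides are the double integral of \<open>cis (- (x \<bullet> y)) * u x * v y\<close>.\<close>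

lemma fourier_L1_multiplication:
  fixes u v :: "'a::euclidean_space \<Rightarrow> complex"
  assumes u: "integrable lborel u" and v: "integrable lborel v"
  shows "(LINT x|lborel. fourier_L1 u x * v x) = (LINT x|lborel. u x * fourier_L1 v x)"
proof -
  have [measurable]: "u \<in> borel_measurable borel" "v \<in> borel_measurable borel" using u v by auto
  let ?k = "complex_of_real ((2 * pi) powr (- real DIM('a) / 2))"
  have int: "integrable (lborel \<Otimes>\<^sub>M lborel) (\<lambda>(x, y). cis (- (x \<bullet> y)) * (u x * v y))"
    by (rule integrable_pair_bound[OF u v]) (auto simp: norm_mult)
  have "(LINT y|lborel. fourier_L1 u y * v y)
      = (LINT y|lborel. ?k * (LINT x|lborel. cis (- (x \<bullet> y)) * (u x * v y)))"
  proof (intro Bochner_Integration.integral_cong refl)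
    fix y
    have "(LINT x|lborel. cis (- (x \<bullet> y)) * (u x * v y)) = (LINT x|lborel. cis (- (y \<bullet> x)) * u x) * v y"
      by (subst integral_mult_left_zero[symmetric]) (simp add: inner_commute mult.assoc)
    then show "fourier_L1 u y * v y = ?k * (LINT x|lborel. cis (- (x \<bullet> y)) * (u x * v y))"
      by (simp add: fourier_L1_def)
  qed
  also have "\<dots> = ?k * (LINT y|lborel. LINT x|lborel. cis (- (x \<bullet> y)) * (u x * v y))"
    by (rule integral_mult_right_zero)
  also have "\<dots> = ?k * (LINT x|lborel. LINT y|lborel. cis (- (x \<bullet> y)) * (u x * v y))"
    by (subst lborel_pair.Fubini_integral[OF int]) rule
  also have "\<dots> = (LINT x|lborel. ?k * (LINT y|lborel. cis (- (x \<bullet> y)) * (u x * v y)))"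
    by (rule integral_mult_right_zero[symmetric])
  also have "\<dots> = (LINT x|lborel. u x * fourier_L1 v x)"
  proof (intro Bochner_Integration.integral_cong refl)
    fix x
    have "(LINT y|lborel. cis (- (x \<bullet> y)) * (u x * v y)) = u x * (LINT y|lborel. cis (- (x \<bullet> y)) * v y)"
      by (subst integral_mult_right_zero[symmetric]) (simp add: mult_ac)
    then show "?k * (LINT y|lborel. cis (- (x \<bullet> y)) * (u x * v y)) = u x * fourier_L1 v x"
      by (simp add: fourier_L1_def)
  qed
  finally show ?thesis .
qed

section \<open>Plancherel's theorem\<close>

lemma gauss_scaled_integrable:
  fixes e :: real
  assumes "e > 0"
  shows "integrable lborel (\<lambda>\<xi>::'a::euclidean_space. exp (- (e * norm \<xi>)\<^sup>2 / 2))"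
proof -
  have "integrable lborel (\<lambda>\<xi>::'a. gauss (0 + e *\<^sub>R \<xi>) * (2 * pi) powr (real DIM('a) / 2))"
    using assms by (intro integrable_mult_left integrable_lborel_affine integrable_gauss) auto
  moreover have "gauss (0 + e *\<^sub>R \<xi>) * (2 * pi) powr (real DIM('a) / 2) = exp (- (e * norm \<xi>)\<^sup>2 / 2)"
    for \<xi> :: 'a
    using assms by (simp add: gauss_eq powr_minus power_mult_distrib)
  ultimately show ?thesis by (simp only:)
qed

lemma borel_measurable_cnj [measurable (raw)]:
  assumes "f \<in> borel_measurable M"
  shows "(\<lambda>x. cnj (f x)) \<in> borel_measurable M"
  using assms by (rule measurable_compose) (intro borel_measurable_continuous_onI continuous_intros)

text \<open>The substitution \<open>\<xi> = \<eta> / e\<close> reduces this to the standard Gaussian, which up to its normalizing factor is its own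
  Fourier transform.\<close>

lemma gauss_scaled_fourier:
  fixes v :: "'a::euclidean_space"
  assumes "e > 0"
  shows "complex_of_real (((2 * pi) powr (- real DIM('a) / 2))\<^sup>2)
      * (LINT \<xi>|lborel. cis (\<xi> \<bullet> v) * complex_of_real (exp (- (e * norm \<xi>)\<^sup>2 / 2)))
    = complex_of_real (gauss ((1 / e) *\<^sub>R v) * (1 / e) ^ DIM('a))"
proof -
  let ?k = "(2 * pi) powr (- real DIM('a) / 2)"
  have k0: "?k > 0" by simp
  have int: "integrable lborel (\<lambda>\<xi>. cis (\<xi> \<bullet> v) * complex_of_real (exp (- (e * norm \<xi>)\<^sup>2 / 2)))"
    by (rule Bochner_Integration.integrable_bound[OF gauss_scaled_integrable[OF assms]]) (auto simp: norm_mult)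
  have pt: "cis ((0 + (1 / e) *\<^sub>R \<eta>) \<bullet> v) * complex_of_real (exp (- (e * norm (0 + (1 / e) *\<^sub>R \<eta>))\<^sup>2 / 2))
      = cis (((1 / e) *\<^sub>R v) \<bullet> \<eta>) * complex_of_real (gauss \<eta>) * complex_of_real (1 / ?k)" for \<eta> :: 'a
    using assms k0 by (simp add: gauss_eq inner_commute)
  have "(LINT \<xi>|lborel. cis (\<xi> \<bullet> v) * complex_of_real (exp (- (e * norm \<xi>)\<^sup>2 / 2)))
    = (\<bar>1 / e\<bar> ^ DIM('a)) *\<^sub>R (LINT \<eta>|lborel. cis (((1 / e) *\<^sub>R v) \<bullet> \<eta>) * complex_of_real (gauss \<eta>) * complex_of_real (1 / ?k))"
    using assms by (subst integral_lborel_affine[OF int, of "1 / e" 0]) (simp_all only: pt, auto)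
  also have "\<dots> = (\<bar>1 / e\<bar> ^ DIM('a)) *\<^sub>R (complex_of_real (exp (- (norm ((1 / e) *\<^sub>R v))\<^sup>2 / 2)) * complex_of_real (1 / ?k))"
    by (simp only: integral_mult_left_zero gauss_fourier)
  also have "\<dots> = complex_of_real ((1 / e) ^ DIM('a) * exp (- (norm ((1 / e) *\<^sub>R v))\<^sup>2 / 2) * (1 / ?k))"
    using assms by (simp add: scaleR_conv_of_real)
  finally show ?thesis
    unfolding of_real_mult[symmetric] using k0
    by (simp only: gauss_eq of_real_mult[symmetric]) (simp add: power2_eq_square)
qed

lemma Re_mult_cnj: "Re (a * cnj b) = a \<bullet> b"
  by (simp add: inner_complex_def)

lemma L2_space_norm: "u \<in> L2_space \<Longrightarrow> (\<lambda>x. norm (u x)) \<in> L2_space"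
  by (rule L2_spaceI) (auto dest: L2_space_measurable L2_space_integrable)

lemma L2_norm_norm: "L2_norm (\<lambda>x. norm (u x)) = L2_norm u"
  by (simp add: L2_norm_def)

text \<open>
  Plancherel's identity damped by a Gaussian, which makes every integral absolutely convergent. It is the
  multiplication formula for \<open>w\<close> and the damped conjugate \<open>\<phi>\<close> of its transform: the transform of \<open>\<phi>\<close> at \<open>x\<close> is the
  Gaussian average of \<open>cnj w\<close> at scale \<open>e\<close> around \<open>x\<close>.
\<close>

lemma fourier_L1_smoothed:
  fixes w :: "'a::euclidean_space \<Rightarrow> complex"
  assumes w1: "integrable lborel w" and w2: "w \<in> L2_space" and e: "e > 0"
  shows "(LINT \<xi>|lborel. exp (- (e * norm \<xi>)\<^sup>2 / 2) * (norm (fourier_L1 w \<xi>))\<^sup>2)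
    = (LINT z|lborel. gauss z * L2_inner w (\<lambda>x. w (x + e *\<^sub>R z)))"
proof -
  have [measurable]: "w \<in> borel_measurable borel" using w1 by auto
  let ?k = "complex_of_real ((2 * pi) powr (- real DIM('a) / 2))"
  let ?G = "\<lambda>z x. complex_of_real (gauss z) * (w x * cnj (w (x + e *\<^sub>R z)))"
  define E where "E \<xi> = complex_of_real (exp (- (e * norm \<xi>)\<^sup>2 / 2))" for \<xi> :: 'a
  have Em [measurable]: "E \<in> borel_measurable borel" unfolding E_def by measurable
  have Ei: "integrable lborel E"
    unfolding E_def using gauss_scaled_integrable[OF e] by (rule integrable_of_real)
  define \<phi> where "\<phi> \<xi> = E \<xi> * cnj (fourier_L1 w \<xi>)" for \<xi>
  define C where "C = (2 * pi) powr (- real DIM('a) / 2) * (LINT x|lborel. norm (w x))"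
  have \<phi>i: "integrable lborel \<phi>"
  proof (rule Bochner_Integration.integrable_bound)
    show "integrable lborel (\<lambda>\<xi>. E \<xi> * complex_of_real C)" by (intro integrable_mult_left Ei)
    show "\<phi> \<in> borel_measurable lborel" unfolding \<phi>_def by measurable
    have "norm (\<phi> \<xi>) \<le> norm (E \<xi> * complex_of_real C)" for \<xi>
      using fourier_L1_bound[OF w1, of \<xi>, folded C_def]
      by (auto simp: \<phi>_def norm_mult intro!: mult_left_mono)
    then show "AE \<xi> in lborel. norm (\<phi> \<xi>) \<le> norm (E \<xi> * complex_of_real C)" by simp
  qed
  have w1c: "integrable lborel (\<lambda>y. cnj (w y))" using w1 by simp
  have \<phi>hat: "fourier_L1 \<phi> x = (LINT z|lborel. complex_of_real (gauss z) * cnj (w (x + e *\<^sub>R z)))" for x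
  proof -
    let ?h = "\<lambda>y. complex_of_real (gauss ((1 / e) *\<^sub>R (y - x)) * (1 / e) ^ DIM('a)) * cnj (w y)"
    have pair: "integrable (lborel \<Otimes>\<^sub>M lborel) (\<lambda>(\<xi>, y). cis (\<xi> \<bullet> (y - x)) * E \<xi> * cnj (w y))"
      by (rule integrable_pair_bound[OF Ei w1c]) (auto simp: norm_mult)
    have c: "cnj (fourier_L1 w \<xi>) = ?k * (LINT y|lborel. cis (\<xi> \<bullet> y) * cnj (w y))" for \<xi>
      unfolding fourier_L1_def by (simp add: Bochner_Integration.integral_cnj[symmetric] cis_cnj del: Bochner_Integration.integral_cnj)
    have inner: "cis (- (x \<bullet> \<xi>)) * \<phi> \<xi> = ?k * (LINT y|lborel. cis (\<xi> \<bullet> (y - x)) * E \<xi> * cnj (w y))" for \<xi>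
    proof -
      have "cis (\<xi> \<bullet> (y - x)) * E \<xi> * cnj (w y) = (cis (- (x \<bullet> \<xi>)) * E \<xi>) * (cis (\<xi> \<bullet> y) * cnj (w y))" for y
      proof -
        have "cis (\<xi> \<bullet> (y - x)) = cis (- (x \<bullet> \<xi>)) * cis (\<xi> \<bullet> y)"
          by (simp add: cis_mult inner_diff_right inner_commute)
        then show ?thesis by (simp only: mult_ac)
      qed
      then have "(LINT y|lborel. cis (\<xi> \<bullet> (y - x)) * E \<xi> * cnj (w y))
          = (cis (- (x \<bullet> \<xi>)) * E \<xi>) * (LINT y|lborel. cis (\<xi> \<bullet> y) * cnj (w y))"
        by (simp only: integral_mult_right_zero)
      note eq = this
      have "cis (- (x \<bullet> \<xi>)) * \<phi> \<xi>
          = ?k * ((cis (- (x \<bullet> \<xi>)) * E \<xi>) * (LINT y|lborel. cis (\<xi> \<bullet> y) * cnj (w y)))"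
        by (simp only: \<phi>_def c mult_ac)
      then show ?thesis by (simp only: eq)
    qed
    have gi: "integrable lborel (\<lambda>y. ?h y)"
    proof (rule Bochner_Integration.integrable_bound)
      show "integrable lborel (\<lambda>y. complex_of_real ((2 * pi) powr (- real DIM('a) / 2) * (1 / e) ^ DIM('a)) * cnj (w y))"
        by (intro integrable_mult_right w1c)
      have "norm (?h y)
        \<le> norm (complex_of_real ((2 * pi) powr (- real DIM('a) / 2) * (1 / e) ^ DIM('a)) * cnj (w y))" for y
        unfolding norm_mult norm_of_real complex_mod_cnj abs_mult
        using gauss_bounded[of "(1 / e) *\<^sub>R (y - x)"] gauss_nonneg[of "(1 / e) *\<^sub>R (y - x)"]
        by (intro mult_right_mono) auto
      then show "AE y in lborel. norm (?h y)
        \<le> norm (complex_of_real ((2 * pi) powr (- real DIM('a) / 2) * (1 / e) ^ DIM('a)) * cnj (w y))" by simp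
    qed measurable
    have "fourier_L1 \<phi> x = ?k * (LINT \<xi>|lborel. ?k * (LINT y|lborel. cis (\<xi> \<bullet> (y - x)) * E \<xi> * cnj (w y)))"
      unfolding fourier_L1_def by (simp only: inner)
    also have "\<dots> = ?k * (?k * (LINT \<xi>|lborel. LINT y|lborel. cis (\<xi> \<bullet> (y - x)) * E \<xi> * cnj (w y)))"
      by (simp only: integral_mult_right_zero)
    also have "\<dots> = ?k * (?k * (LINT y|lborel. LINT \<xi>|lborel. cis (\<xi> \<bullet> (y - x)) * E \<xi> * cnj (w y)))"
      by (subst lborel_pair.Fubini_integral[OF pair]) rule
    also have "\<dots> = (LINT y|lborel. complex_of_real (((2 * pi) powr (- real DIM('a) / 2))\<^sup>2)
        * (LINT \<xi>|lborel. cis (\<xi> \<bullet> (y - x)) * E \<xi>) * cnj (w y))"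
      unfolding integral_mult_left_zero
      by (simp only: integral_mult_right_zero mult.assoc power2_eq_square of_real_mult)
    also have "\<dots> = (LINT y|lborel. ?h y)"
      unfolding E_def by (simp only: gauss_scaled_fourier[OF e])
    also have "\<dots> = (LINT z|lborel. complex_of_real (gauss z) * cnj (w (x + e *\<^sub>R z)))"
    proof -
      have pt: "complex_of_real (gauss ((1 / e) *\<^sub>R (x + e *\<^sub>R z - x)) * (1 / e) ^ DIM('a)) * cnj (w (x + e *\<^sub>R z))
        = complex_of_real ((1 / e) ^ DIM('a)) * (complex_of_real (gauss z) * cnj (w (x + e *\<^sub>R z)))" for z
        using e by simp
      have c1: "\<bar>e\<bar> ^ DIM('a) * (1 / e) ^ DIM('a) = 1"
        using e by (simp add: power_mult_distrib[symmetric])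
      show ?thesis
        using e
        by (subst integral_lborel_affine[OF gi, of e x])
           (simp, simp only: pt integral_mult_right_zero, simp only: scaleR_scaleR scaleR_conv_of_real[symmetric] c1 scaleR_one)
    qed
    finally show ?thesis .
  qed
  have wsh: "(\<lambda>x. w (x + e *\<^sub>R z)) \<in> L2_space" for z by (rule L2_space_shift[OF w2])
  have pair: "integrable (lborel \<Otimes>\<^sub>M lborel) (\<lambda>(z, x). ?G z x)"
  proof (rule lborel_pair.Fubini_integrable)
    have int: "integrable lborel (\<lambda>x. w x * cnj (w (x + e *\<^sub>R z)))" for z
      using L2_inner_integrable[OF L2_space_norm[OF w2] L2_space_norm[OF wsh[of z]]]
      by (rule Bochner_Integration.integrable_bound) (auto simp: norm_mult)
    show "AE z in lborel. integrable lborel (\<lambda>x. case (z, x) of (z, x) \<Rightarrow> ?G z x)"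
      using int by simp
    have "integrable lborel (\<lambda>z::'a. gauss z * (L2_norm w)\<^sup>2)"
      by (intro integrable_mult_left integrable_gauss)
    then show "integrable lborel (\<lambda>z. LINT x|lborel. norm (case (z, x) of (z, x) \<Rightarrow> ?G z x))"
    proof (rule Bochner_Integration.integrable_bound)
      have "norm (LINT x|lborel. norm (?G z x)) \<le> norm (gauss z * (L2_norm w)\<^sup>2)" for z
      proof -
        have "(LINT x|lborel. norm (?G z x))
          = gauss z * L2_inner (\<lambda>x. norm (w x)) (\<lambda>x. norm (w (x + e *\<^sub>R z)))"
          unfolding L2_inner_def by (simp add: norm_mult gauss_nonneg)
        moreover have "\<bar>L2_inner (\<lambda>x. norm (w x)) (\<lambda>x. norm (w (x + e *\<^sub>R z)))\<bar> \<le> (L2_norm w)\<^sup>2"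
          using L2_Cauchy_Schwarz[OF L2_space_norm[OF w2] L2_space_norm[OF wsh[of z]]]
          by (simp add: L2_norm_norm L2_norm_shift[OF w2] power2_eq_square)
        ultimately show ?thesis by (simp add: abs_mult gauss_nonneg mult_left_mono)
      qed
      then show "AE z in lborel. norm (LINT x|lborel. norm (case (z, x) of (z, x) \<Rightarrow> ?G z x)) \<le> norm (gauss z * (L2_norm w)\<^sup>2)"
        by simp
    qed measurable
  qed measurable
  have "complex_of_real (LINT \<xi>|lborel. exp (- (e * norm \<xi>)\<^sup>2 / 2) * (norm (fourier_L1 w \<xi>))\<^sup>2)
      = (LINT \<xi>|lborel. fourier_L1 w \<xi> * \<phi> \<xi>)"
    unfolding integral_complex_of_real[symmetric]
    by (intro Bochner_Integration.integral_cong refl)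
       (simp only: \<phi>_def E_def of_real_mult complex_norm_square mult_ac)
  also have "\<dots> = (LINT x|lborel. w x * fourier_L1 \<phi> x)"
    by (rule fourier_L1_multiplication[OF w1 \<phi>i])
  also have "\<dots> = (LINT x|lborel. LINT z|lborel. ?G z x)"
    unfolding \<phi>hat by (simp add: mult_ac flip: integral_mult_right_zero)
  also have "\<dots> = (LINT z|lborel. LINT x|lborel. ?G z x)"
    by (rule lborel_pair.Fubini_integral[OF pair])
  finally have "(LINT \<xi>|lborel. exp (- (e * norm \<xi>)\<^sup>2 / 2) * (norm (fourier_L1 w \<xi>))\<^sup>2)
      = Re (LINT z|lborel. LINT x|lborel. ?G z x)"
    by (metis Re_complex_of_real)
  also have "\<dots> = (LINT z|lborel. Re (LINT x|lborel. ?G z x))"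
    by (rule integral_Re[symmetric]) (use lborel_pair.integrable_fst'[OF pair] in simp)
  also have "\<dots> = (LINT z|lborel. gauss z * L2_inner w (\<lambda>x. w (x + e *\<^sub>R z)))"
  proof (intro Bochner_Integration.integral_cong refl)
    fix z
    have int: "integrable lborel (\<lambda>x. w x * cnj (w (x + e *\<^sub>R z)))"
      using L2_inner_integrable[OF L2_space_norm[OF w2] L2_space_norm[OF wsh[of z]]]
      by (rule Bochner_Integration.integrable_bound) (auto simp: norm_mult)
    have "Re (LINT x|lborel. ?G z x)
        = gauss z * Re (LINT x|lborel. w x * cnj (w (x + e *\<^sub>R z)))"
      by simp
    also have "Re (LINT x|lborel. w x * cnj (w (x + e *\<^sub>R z))) = L2_inner w (\<lambda>x. w (x + e *\<^sub>R z))"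
      unfolding L2_inner_def Re_mult_cnj[symmetric] by (rule integral_Re[OF int, symmetric])
    finally show "Re (LINT x|lborel. ?G z x)
      = gauss z * L2_inner w (\<lambda>x. w (x + e *\<^sub>R z))" .
  qed
  finally show ?thesis .
qed

text \<open>Let the damping \<open>e\<close> tend to 0. The left side of the damped identity increases to the squared norm of the
  transform, and the autocorrelation on the right side tends to the squared norm of \<open>w\<close>
  because translations are continuous in the mean. Monotone convergence also yields that the transform is
  square integrable.\<close>

theorem fourier_L1_Plancherel:
  fixes w :: "'a::euclidean_space \<Rightarrow> complex"
  assumes w1: "integrable lborel w" and w2: "w \<in> L2_space"
  shows "fourier_L1 w \<in> L2_space" and "L2_norm (fourier_L1 w) = L2_norm w"
proof -
  have [measurable]: "w \<in> borel_measurable borel" using w1 by auto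
  define e where "e k = 1 / real (Suc k)" for k
  have e0: "e k > 0" for k by (simp add: e_def)
  have elim: "e \<longlonglongrightarrow> 0" unfolding e_def by (rule LIMSEQ_Suc[OF lim_1_over_n])
  define F where "F k \<xi> = exp (- (e k * norm \<xi>)\<^sup>2 / 2) * (norm (fourier_L1 w \<xi>))\<^sup>2" for k \<xi>
  define C where "C = (2 * pi) powr (- real DIM('a) / 2) * (LINT x|lborel. norm (w x))"
  have Fi: "integrable lborel (F k)" for k
  proof (rule Bochner_Integration.integrable_bound)
    show "integrable lborel (\<lambda>\<xi>::'a. exp (- (e k * norm \<xi>)\<^sup>2 / 2) * C\<^sup>2)"
      by (intro integrable_mult_left gauss_scaled_integrable e0)
    have "norm (F k \<xi>) \<le> norm (exp (- (e k * norm \<xi>)\<^sup>2 / 2) * C\<^sup>2)" for \<xi>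
      using fourier_L1_bound[OF w1, of \<xi>, folded C_def]
      by (auto simp: F_def norm_mult abs_mult intro!: mult_left_mono power_mono)
    then show "AE \<xi> in lborel. norm (F k \<xi>) \<le> norm (exp (- (e k * norm \<xi>)\<^sup>2 / 2) * C\<^sup>2)" by simp
    show "F k \<in> borel_measurable lborel" unfolding F_def by measurable
  qed
  have "(\<lambda>k. LINT z|lborel. gauss z * L2_inner w (\<lambda>x. w (x + e k *\<^sub>R z)))
      \<longlonglongrightarrow> (LINT z::'a|lborel. gauss z * (L2_norm w)\<^sup>2)"
  proof (rule integral_dominated_convergence)
    show "integrable lborel (\<lambda>z::'a. gauss z * (L2_norm w)\<^sup>2)"
      by (intro integrable_mult_left integrable_gauss)
    have "norm (gauss z * L2_inner w (\<lambda>x. w (x + e k *\<^sub>R z))) \<le> gauss z * (L2_norm w)\<^sup>2" for z k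
      using L2_Cauchy_Schwarz[OF w2 L2_space_shift[OF w2, of "e k *\<^sub>R z"]]
      by (simp add: abs_mult gauss_nonneg L2_norm_shift[OF w2] power2_eq_square mult_left_mono)
    then show "AE z in lborel. norm (gauss z * L2_inner w (\<lambda>x. w (x + e k *\<^sub>R z))) \<le> gauss z * (L2_norm w)\<^sup>2" for k
      by simp
    have "(\<lambda>k. gauss z * L2_inner w (\<lambda>x. w (x + e k *\<^sub>R z))) \<longlonglongrightarrow> gauss z * (L2_norm w)\<^sup>2" for z
    proof -
      have "(\<lambda>k. e k *\<^sub>R z) \<longlonglongrightarrow> 0" using tendsto_scaleR[OF elim tendsto_const[of z]] by simp
      from L2_translation_continuous[OF w2 this]
      have "(\<lambda>k. L2_inner (\<lambda>x. w (x + e k *\<^sub>R z)) w) \<longlonglongrightarrow> L2_inner w w"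
        by (intro L2_inner_tendsto L2_space_shift w2)
      then show ?thesis
        by (intro tendsto_mult tendsto_const) (simp add: L2_inner_self L2_inner_commute[of w])
    qed
    then show "AE z in lborel. (\<lambda>k. gauss z * L2_inner w (\<lambda>x. w (x + e k *\<^sub>R z))) \<longlonglongrightarrow> gauss z * (L2_norm w)\<^sup>2"
      by simp
    show "(\<lambda>z. gauss z * L2_inner w (\<lambda>x. w (x + e k *\<^sub>R z))) \<in> borel_measurable lborel" for k
      unfolding L2_inner_def by measurable
  qed measurable
  then have lim: "(\<lambda>k. LINT \<xi>|lborel. F k \<xi>) \<longlonglongrightarrow> (L2_norm w)\<^sup>2"
    unfolding F_def fourier_L1_smoothed[OF w1 w2 e0] by (simp add: integral_gauss)
  have mono: "AE \<xi> in lborel. mono (\<lambda>k. F k \<xi>)"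
  proof (rule AE_I2, rule monoI)
    fix \<xi> :: 'a and i j :: nat assume "i \<le> j"
    then have "e j \<le> e i" by (simp add: e_def frac_le)
    then have "(e j * norm \<xi>)\<^sup>2 \<le> (e i * norm \<xi>)\<^sup>2"
      using e0[of j] by (intro power_mono mult_right_mono) auto
    then show "F i \<xi> \<le> F j \<xi>" unfolding F_def by (intro mult_right_mono) auto
  qed
  have ptw: "AE \<xi> in lborel. (\<lambda>k. F k \<xi>) \<longlonglongrightarrow> (norm (fourier_L1 w \<xi>))\<^sup>2"
  proof (rule AE_I2)
    fix \<xi> :: 'a
    have "(\<lambda>k. exp (- (e k * norm \<xi>)\<^sup>2 / 2) * (norm (fourier_L1 w \<xi>))\<^sup>2)
      \<longlonglongrightarrow> exp (- (0 * norm \<xi>)\<^sup>2 / 2) * (norm (fourier_L1 w \<xi>))\<^sup>2"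
      by (intro tendsto_intros elim) simp
    then show "(\<lambda>k. F k \<xi>) \<longlonglongrightarrow> (norm (fourier_L1 w \<xi>))\<^sup>2" by (simp add: F_def)
  qed
  have m: "(\<lambda>\<xi>. (norm (fourier_L1 w \<xi>))\<^sup>2) \<in> borel_measurable lborel" by measurable
  show "fourier_L1 w \<in> L2_space"
    using integrable_monotone_convergence[OF Fi mono ptw lim m] by (intro L2_spaceI) auto
  have "(L2_norm (fourier_L1 w))\<^sup>2 = (L2_norm w)\<^sup>2"
    unfolding L2_norm_sq[of "fourier_L1 w"] by (rule integral_monotone_convergence[OF Fi mono ptw lim m])
  then show "L2_norm (fourier_L1 w) = L2_norm w" by (rule power_eq_imp_eq_base) auto
qed

section \<open>The Fourier transform of square integrable functions\<close>

lemma has_fourierD: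
  assumes "has_fourier u g"
  shows "u \<in> L2_space" "g \<in> L2_space"
  using assms by (auto simp: has_fourier_def)

text \<open>The witnessing sequence in the definition of \<open>has_fourier\<close>.\<close>

definition fourier_approx ::
  "(nat \<Rightarrow> 'a::euclidean_space \<Rightarrow> complex) \<Rightarrow> ('a \<Rightarrow> complex) \<Rightarrow> ('a \<Rightarrow> complex) \<Rightarrow> bool" where
  "fourier_approx w u g \<longleftrightarrow>
     (\<forall>k. w k \<in> L2_space \<and> integrable lborel (w k) \<and> fourier_L1 (w k) \<in> L2_space) \<and>
     (\<lambda>k. L2_norm (\<lambda>x. w k x - u x)) \<longlonglongrightarrow> 0 \<and>
     (\<lambda>k. L2_norm (\<lambda>\<xi>. fourier_L1 (w k) \<xi> - g \<xi>)) \<longlonglongrightarrow> 0"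

lemma has_fourierE:
  assumes "has_fourier u g"
  obtains w where "fourier_approx w u g"
  using assms unfolding has_fourier_def fourier_approx_def by blast

lemma fourier_approxD:
  assumes "fourier_approx w u g"
  shows "\<And>k. w k \<in> L2_space" "\<And>k. integrable lborel (w k)" "\<And>k. fourier_L1 (w k) \<in> L2_space"
    "(\<lambda>k. L2_norm (\<lambda>x. w k x - u x)) \<longlonglongrightarrow> 0"
    "(\<lambda>k. L2_norm (\<lambda>\<xi>. fourier_L1 (w k) \<xi> - g \<xi>)) \<longlonglongrightarrow> 0"
  using assms unfolding fourier_approx_def by auto

lemma has_fourierI:
  assumes "u \<in> L2_space" "g \<in> L2_space" "\<And>k. w k \<in> L2_space" "\<And>k. integrable lborel (w k)"
    "(\<lambda>k::nat. L2_norm (\<lambda>x. w k x - u x)) \<longlonglongrightarrow> 0" "(\<lambda>k. L2_norm (\<lambda>\<xi>. fourier_L1 (w k) \<xi> - g \<xi>)) \<longlonglongrightarrow> 0"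
  shows "has_fourier u g"
  using assms fourier_L1_Plancherel(1) unfolding has_fourier_def by blast

lemma has_fourier_fourier_L1:
  assumes "integrable lborel u" "u \<in> L2_space"
  shows "has_fourier u (fourier_L1 u)"
proof -
  have z: "L2_norm (\<lambda>x. f x - f x) = 0" for f :: "'a \<Rightarrow> complex" by (simp add: L2_norm_def)
  show ?thesis
    by (rule has_fourierI[of _ _ "\<lambda>_. u"]) (use assms fourier_L1_Plancherel(1)[OF assms] z in auto)
qed

lemma L2_space_cmult_complex: "u \<in> L2_space \<Longrightarrow> (\<lambda>x. c * u x :: complex) \<in> L2_space"
proof (rule L2_spaceI)
  assume u: "u \<in> L2_space"
  note [measurable] = L2_space_measurable[OF u]
  show "(\<lambda>x. c * u x) \<in> borel_measurable borel" by measurable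
  show "integrable lborel (\<lambda>x. (norm (c * u x))\<^sup>2)"
    using L2_space_integrable[OF u] by (simp add: norm_mult power_mult_distrib)
qed

lemma L2_norm_cmult_complex: "L2_norm (\<lambda>x. c * u x :: complex) = norm c * L2_norm u"
  by (simp add: L2_norm_def norm_mult power_mult_distrib real_sqrt_mult)

lemma fourier_L1_add:
  assumes "integrable lborel u" "integrable lborel v"
  shows "fourier_L1 (\<lambda>x. u x + v x) \<xi> = fourier_L1 u \<xi> + fourier_L1 v \<xi>"
  unfolding fourier_L1_def distrib_left
  by (subst Bochner_Integration.integral_add) (auto intro!: integrable_cis_mult assms simp: distrib_left)

lemma fourier_L1_cmult: "fourier_L1 (\<lambda>x. c * u x) \<xi> = c * fourier_L1 u \<xi>"
  unfolding fourier_L1_def mult.left_commute[of _ c] integral_mult_right_zero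
  by (rule refl)

lemma has_fourier_add:
  assumes "has_fourier u g" "has_fourier v h"
  shows "has_fourier (\<lambda>x. u x + v x) (\<lambda>\<xi>. g \<xi> + h \<xi>)"
proof -
  obtain a where "fourier_approx a u g"
    using assms(1) by (rule has_fourierE)
  note a = fourier_approxD[OF this]
  obtain b where "fourier_approx b v h"
    using assms(2) by (rule has_fourierE)
  note b = fourier_approxD[OF this]
  have lim: "(\<lambda>k. L2_norm (\<lambda>x. (p k x + q k x) - (r x + s x))) \<longlonglongrightarrow> 0"
    if "\<And>k. p k \<in> L2_space" "\<And>k. q k \<in> L2_space" "r \<in> L2_space" "s \<in> L2_space"
      "(\<lambda>k. L2_norm (\<lambda>x. p k x - r x)) \<longlonglongrightarrow> 0" "(\<lambda>k. L2_norm (\<lambda>x. q k x - s x)) \<longlonglongrightarrow> 0"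
    for p q :: "nat \<Rightarrow> 'a \<Rightarrow> complex" and r s
  proof (rule Lim_null_comparison)
    show "(\<lambda>k. L2_norm (\<lambda>x. p k x - r x) + L2_norm (\<lambda>x. q k x - s x)) \<longlonglongrightarrow> 0"
      using tendsto_add[OF that(5,6)] by simp
    show "\<forall>\<^sub>F k in sequentially. norm (L2_norm (\<lambda>x. (p k x + q k x) - (r x + s x)))
        \<le> L2_norm (\<lambda>x. p k x - r x) + L2_norm (\<lambda>x. q k x - s x)"
      using L2_triangle[OF L2_space_diff[OF that(1,3)] L2_space_diff[OF that(2,4)]]
      by (simp add: add_diff_add)
  qed
  show ?thesis
  proof (rule has_fourierI[of _ _ "\<lambda>k x. a k x + b k x"])
    show "(\<lambda>k. L2_norm (\<lambda>x. a k x + b k x - (u x + v x))) \<longlonglongrightarrow> 0"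
      by (intro lim a b has_fourierD[OF assms(1)] has_fourierD[OF assms(2)])
    show "(\<lambda>k. L2_norm (\<lambda>\<xi>. fourier_L1 (\<lambda>x. a k x + b k x) \<xi> - (g \<xi> + h \<xi>))) \<longlonglongrightarrow> 0"
      unfolding fourier_L1_add[OF a(2) b(2)]
      by (intro lim a b has_fourierD[OF assms(1)] has_fourierD[OF assms(2)])
  qed (use a b assms[THEN has_fourierD(1)] assms[THEN has_fourierD(2)] in \<open>auto intro!: L2_space_add\<close>)
qed

lemma has_fourier_cmult:
  assumes "has_fourier u g"
  shows "has_fourier (\<lambda>x. c * u x) (\<lambda>\<xi>. c * g \<xi>)"
proof -
  obtain a where "fourier_approx a u g"
    using assms(1) by (rule has_fourierE)
  note a = fourier_approxD[OF this]
  show ?thesis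
  proof (rule has_fourierI[of _ _ "\<lambda>k x. c * a k x"])
    show "(\<lambda>k. L2_norm (\<lambda>x. c * a k x - c * u x)) \<longlonglongrightarrow> 0"
      using tendsto_mult_right_zero[OF a(4), of "norm c"]
      by (simp only: right_diff_distrib[symmetric] L2_norm_cmult_complex)
    show "(\<lambda>k. L2_norm (\<lambda>\<xi>. fourier_L1 (\<lambda>x. c * a k x) \<xi> - c * g \<xi>)) \<longlonglongrightarrow> 0"
      using tendsto_mult_right_zero[OF a(5), of "norm c"]
      by (simp only: fourier_L1_cmult right_diff_distrib[symmetric] L2_norm_cmult_complex)
  qed (use a has_fourierD[OF assms] in \<open>auto intro!: L2_space_cmult_complex\<close>)
qed

lemma has_fourier_diff:
  assumes "has_fourier u g" "has_fourier v h"
  shows "has_fourier (\<lambda>x. u x - v x) (\<lambda>\<xi>. g \<xi> - h \<xi>)"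
  using has_fourier_add[OF assms(1) has_fourier_cmult[OF assms(2), of "-1"]] by simp

theorem has_fourier_isometry:
  assumes "has_fourier u g"
  shows "L2_norm g = L2_norm u"
proof -
  obtain a where "fourier_approx a u g"
    using assms(1) by (rule has_fourierE)
  note a = fourier_approxD[OF this]
  have "(\<lambda>k. L2_norm (a k)) \<longlonglongrightarrow> L2_norm u"
    by (rule L2_norm_tendsto[OF a(1) has_fourierD(1)[OF assms] a(4)])
  moreover have "(\<lambda>k. L2_norm (a k)) \<longlonglongrightarrow> L2_norm g"
    using L2_norm_tendsto[OF a(3) has_fourierD(2)[OF assms] a(5)]
    by (simp add: fourier_L1_Plancherel(2)[OF a(2,1)])
  ultimately show ?thesis by (rule LIMSEQ_unique[symmetric])
qed

lemma has_fourier_Parseval: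
  assumes "has_fourier u g" "has_fourier v h"
  shows "L2_inner g h = L2_inner u v"
  using L2_norm_add_sq[OF has_fourierD(1)[OF assms(1)] has_fourierD(1)[OF assms(2)]]
    L2_norm_add_sq[OF has_fourierD(2)[OF assms(1)] has_fourierD(2)[OF assms(2)]]
    has_fourier_isometry[OF assms(1)] has_fourier_isometry[OF assms(2)]
    has_fourier_isometry[OF has_fourier_add[OF assms]] by simp

lemma L2_norm_0_cong:
  assumes "u \<in> borel_measurable borel" "v \<in> borel_measurable borel" "AE x in lborel. u x = v x"
  shows "L2_norm (\<lambda>x. u x - v x) = 0"
  using L2_norm_cong_AE[of "\<lambda>x. u x - v x" "\<lambda>x. 0"] assms by (simp add: L2_norm_def[of "\<lambda>x. 0"])

lemma has_fourier_unique:
  assumes "has_fourier u g" "has_fourier v h" "AE x in lborel. u x = v x"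
  shows "AE \<xi> in lborel. g \<xi> = h \<xi>"
proof -
  have "L2_norm (\<lambda>\<xi>. g \<xi> - h \<xi>) = L2_norm (\<lambda>x. u x - v x)"
    by (rule has_fourier_isometry[OF has_fourier_diff[OF assms(1,2)]])
  also have "\<dots> = 0"
    using assms(3) has_fourierD(1)[OF assms(1)] has_fourierD(1)[OF assms(2)]
    by (intro L2_norm_0_cong L2_space_measurable)
  finally show ?thesis
    using L2_norm_eq_0[OF L2_space_diff[OF has_fourierD(2)[OF assms(1)] has_fourierD(2)[OF assms(2)]]] by simp
qed

lemma has_fourier_injective:
  assumes "has_fourier u g" "has_fourier v h" "AE \<xi> in lborel. g \<xi> = h \<xi>"
  shows "AE x in lborel. u x = v x"
proof -
  have "L2_norm (\<lambda>x. u x - v x) = L2_norm (\<lambda>\<xi>. g \<xi> - h \<xi>)"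
    by (rule has_fourier_isometry[OF has_fourier_diff[OF assms(1,2)], symmetric])
  also have "\<dots> = 0"
    using assms(3) has_fourierD(2)[OF assms(1)] has_fourierD(2)[OF assms(2)]
    by (intro L2_norm_0_cong L2_space_measurable)
  finally show ?thesis
    using L2_norm_eq_0[OF L2_space_diff[OF has_fourierD(1)[OF assms(1)] has_fourierD(1)[OF assms(2)]]] by simp
qed

lemma has_fourier_cong:
  assumes "has_fourier u g"
    and "v \<in> borel_measurable borel" "AE x in lborel. v x = u x"
    and "h \<in> borel_measurable borel" "AE x in lborel. h x = g x"
  shows "has_fourier v h"
proof -
  note [measurable] = has_fourierD[OF assms(1), THEN L2_space_measurable]
  note [measurable] = assms(2,4)
  obtain a where "fourier_approx a u g"
    using assms(1) by (rule has_fourierE)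
  note a = fourier_approxD[OF this]
  note [measurable] = a(1)[THEN L2_space_measurable] a(3)[THEN L2_space_measurable]
  show ?thesis
  proof (rule has_fourierI[of _ _ a])
    have "L2_norm (\<lambda>x. a k x - v x) = L2_norm (\<lambda>x. a k x - u x)" for k
      by (rule L2_norm_cong_AE) (use assms(3) in auto)
    then show "(\<lambda>k. L2_norm (\<lambda>x. a k x - v x)) \<longlonglongrightarrow> 0" using a(4) by simp
    have "L2_norm (\<lambda>x. fourier_L1 (a k) x - h x) = L2_norm (\<lambda>x. fourier_L1 (a k) x - g x)" for k
      by (rule L2_norm_cong_AE) (use assms(5) in auto)
    then show "(\<lambda>k. L2_norm (\<lambda>\<xi>. fourier_L1 (a k) \<xi> - h \<xi>)) \<longlonglongrightarrow> 0" using a(5) by simp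
  qed (use a assms has_fourierD[OF assms(1)] in \<open>auto intro: L2_space_cong_AE\<close>)
qed

lemma L2_convergent_Cauchy:
  fixes v :: "'a::euclidean_space \<Rightarrow> 'b::euclidean_space"
  assumes "\<And>k. u k \<in> L2_space" "v \<in> L2_space" "(\<lambda>k::nat. L2_norm (\<lambda>x. u k x - v x)) \<longlonglongrightarrow> 0" "e > 0"
  shows "\<exists>N. \<forall>m\<ge>N. \<forall>n\<ge>N. L2_norm (\<lambda>x. u m x - u n x) < e"
proof -
  obtain N where N: "\<And>n. n \<ge> N \<Longrightarrow> L2_norm (\<lambda>x. u n x - v x) < e / 2"
    using order_tendstoD(2)[OF assms(3), of "e / 2"] assms(4) by (auto simp: eventually_sequentially)
  have "L2_norm (\<lambda>x. u m x - u n x) < e" if "m \<ge> N" "n \<ge> N" for m n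
    using L2_triangle_diff'[OF assms(1)[of m] assms(2) assms(1)[of n]] N[OF that(1)] N[OF that(2)] by linarith
  then show ?thesis by blast
qed

text \<open>The truncations of \<open>u\<close> in space and size are integrable and converge to \<open>u\<close>; their transforms form a Cauchy
  sequence because the transform is isometric.\<close>

theorem has_fourier_exists:
  fixes u :: "'a::euclidean_space \<Rightarrow> complex"
  assumes u: "u \<in> L2_space"
  obtains g where "has_fourier u g"
proof -
  note [measurable] = L2_space_measurable[OF u]
  define f where "f k x = indicator {x. norm x \<le> real k \<and> norm (u x) \<le> real k} x *\<^sub>R u x" for k x
  have [measurable]: "f k \<in> borel_measurable borel" for k unfolding f_def by measurable
  have f2: "f k \<in> L2_space" for k
    by (rule L2_space_bounded_support[where B="real k" and R="real k"]) (auto simp: f_def indicator_def)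
  have f1: "integrable lborel (f k)" for k
  proof (rule Bochner_Integration.integrable_bound)
    show "integrable lborel (\<lambda>x::'a. indicator (cball 0 (real k)) x *\<^sub>R real k)"
      by (intro integrable_scaleR_left impI integrable_real_indicator emeasure_bounded_finite) auto
  qed (auto simp: f_def indicator_def)
  have lim: "(\<lambda>k. L2_norm (\<lambda>x. f k x - u x)) \<longlonglongrightarrow> 0"
    unfolding f_def by (rule L2_dense_bounded_support[OF u])
  have "L2_norm (\<lambda>\<xi>. fourier_L1 (f m) \<xi> - fourier_L1 (f n) \<xi>) = L2_norm (\<lambda>x. f m x - f n x)" for m n
    by (rule has_fourier_isometry[OF has_fourier_diff[OF has_fourier_fourier_L1 has_fourier_fourier_L1]])
       (auto intro: f1 f2)
  then have "\<exists>g\<in>L2_space. (\<lambda>k. L2_norm (\<lambda>\<xi>. fourier_L1 (f k) \<xi> - g \<xi>)) \<longlonglongrightarrow> 0"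
    using L2_convergent_Cauchy[OF f2 u lim] by (intro L2_complete fourier_L1_Plancherel(1) f1 f2) auto
  then obtain g where "g \<in> L2_space" "(\<lambda>k. L2_norm (\<lambda>\<xi>. fourier_L1 (f k) \<xi> - g \<xi>)) \<longlonglongrightarrow> 0" by blast
  then have "has_fourier u g" by (intro has_fourierI[of u g f] u f1 f2 lim)
  then show ?thesis by (rule that)
qed

lemma L2_norm_cnj: "L2_norm (\<lambda>x. cnj (u x)) = L2_norm u"
  by (simp add: L2_norm_def)

lemma L2_space_cnj: "u \<in> L2_space \<Longrightarrow> (\<lambda>x. cnj (u x)) \<in> L2_space"
  by (rule L2_spaceI) (auto dest: L2_space_measurable L2_space_integrable)

lemma L2_norm_cnj_diff: "L2_norm (\<lambda>x. cnj (u x) - cnj (v x)) = L2_norm (\<lambda>x. u x - v x)"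
  using L2_norm_cnj[of "\<lambda>x. u x - v x"] by simp

lemma fourier_L1_shift:
  assumes "integrable lborel u"
  shows "fourier_L1 (\<lambda>x. u (x + z)) \<xi> = cis (\<xi> \<bullet> z) * fourier_L1 u \<xi>"
proof -
  have "(LINT x|lborel. cis (- (\<xi> \<bullet> x)) * u x) = (LINT x|lborel. cis (- (\<xi> \<bullet> (z + 1 *\<^sub>R x))) * u (z + 1 *\<^sub>R x))"
    using integral_lborel_affine[OF integrable_cis_mult(2)[OF assms], of 1 \<xi> z] by simp
  also have "\<dots> = (LINT x|lborel. cis (- (\<xi> \<bullet> z)) * (cis (- (\<xi> \<bullet> x)) * u (x + z)))"
  proof (intro Bochner_Integration.integral_cong refl)
    fix x
    have "cis (- (\<xi> \<bullet> (z + 1 *\<^sub>R x))) = cis (- (\<xi> \<bullet> z)) * cis (- (\<xi> \<bullet> x))"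
      by (simp add: inner_add_right cis_mult)
    then show "cis (- (\<xi> \<bullet> (z + 1 *\<^sub>R x))) * u (z + 1 *\<^sub>R x)
        = cis (- (\<xi> \<bullet> z)) * (cis (- (\<xi> \<bullet> x)) * u (x + z))"
      by (simp add: mult.assoc add.commute)
  qed
  finally have "(LINT x|lborel. cis (- (\<xi> \<bullet> x)) * u x) = cis (- (\<xi> \<bullet> z)) * (LINT x|lborel. cis (- (\<xi> \<bullet> x)) * u (x + z))"
    by (simp only: integral_mult_right_zero)
  then show ?thesis
    by (simp add: fourier_L1_def mult_ac) (simp add: mult.assoc[symmetric] cis_mult)
qed

lemma L2_norm_cis_mult: "L2_norm (\<lambda>\<xi>. cis (f \<xi>) * g \<xi>) = L2_norm g"
  by (simp add: L2_norm_def norm_mult)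

lemma has_fourier_shift:
  assumes "has_fourier u g"
  shows "has_fourier (\<lambda>x. u (x + z)) (\<lambda>\<xi>. cis (\<xi> \<bullet> z) * g \<xi>)"
proof -
  obtain a where "fourier_approx a u g"
    using assms(1) by (rule has_fourierE)
  note a = fourier_approxD[OF this]
  note u = has_fourierD(1)[OF assms] and g = has_fourierD(2)[OF assms]
  show ?thesis
  proof (rule has_fourierI[of _ _ "\<lambda>k x. a k (x + z)"])
    show "integrable lborel (\<lambda>x. a k (x + z))" for k
      using integrable_lborel_affine[OF a(2)[of k], of 1 z] by (simp add: add.commute)
    show "(\<lambda>k. L2_norm (\<lambda>x. a k (x + z) - u (x + z))) \<longlonglongrightarrow> 0"
      using a(4) L2_norm_shift[OF L2_space_diff[OF a(1) u]] by simp
    show "(\<lambda>k. L2_norm (\<lambda>\<xi>. fourier_L1 (\<lambda>x. a k (x + z)) \<xi> - cis (\<xi> \<bullet> z) * g \<xi>)) \<longlonglongrightarrow> 0"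
      using a(5) unfolding fourier_L1_shift[OF a(2)] by (simp only: right_diff_distrib[symmetric] L2_norm_cis_mult)
    have [measurable]: "g \<in> borel_measurable borel" using g by (rule L2_space_measurable)
    show "(\<lambda>\<xi>. cis (\<xi> \<bullet> z) * g \<xi>) \<in> L2_space"
      by (rule L2_space_bound[OF g]) (auto simp: norm_mult)
  qed (intro L2_space_shift u a)+
qed

lemma L2_space_reflect: "u \<in> L2_space \<Longrightarrow> (\<lambda>x. u (- x)) \<in> L2_space"
  using L2_space_affine[of u "-1" 0] by simp

lemma L2_norm_reflect: "u \<in> L2_space \<Longrightarrow> L2_norm (\<lambda>x. u (- x)) = L2_norm u"
  using integral_lborel_affine[OF L2_space_integrable[of u], of "-1" 0] by (simp add: L2_norm_def)

lemma fourier_L1_cnj: "fourier_L1 (\<lambda>x. cnj (u x)) \<xi> = cnj (fourier_L1 u (- \<xi>))"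
proof -
  have "(LINT x|lborel. cis (- (\<xi> \<bullet> x)) * cnj (u x)) = (LINT x|lborel. cnj (cis (\<xi> \<bullet> x) * u x))"
    by (simp add: cis_cnj)
  also have "\<dots> = cnj (LINT x|lborel. cis (\<xi> \<bullet> x) * u x)" by (rule Bochner_Integration.integral_cnj)
  finally show ?thesis by (simp add: fourier_L1_def)
qed

lemma has_fourier_cnj:
  assumes "has_fourier u g"
  shows "has_fourier (\<lambda>x. cnj (u x)) (\<lambda>\<xi>. cnj (g (- \<xi>)))"
proof -
  obtain a where "fourier_approx a u g"
    using assms(1) by (rule has_fourierE)
  note a = fourier_approxD[OF this]
  note u = has_fourierD(1)[OF assms] and g = has_fourierD(2)[OF assms]
  show ?thesis
  proof (rule has_fourierI[of _ _ "\<lambda>k x. cnj (a k x)"])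
    show "(\<lambda>k. L2_norm (\<lambda>x. cnj (a k x) - cnj (u x))) \<longlonglongrightarrow> 0"
      unfolding L2_norm_cnj_diff by (rule a(4))
    show "(\<lambda>k. L2_norm (\<lambda>\<xi>. fourier_L1 (\<lambda>x. cnj (a k x)) \<xi> - cnj (g (- \<xi>)))) \<longlonglongrightarrow> 0"
      unfolding fourier_L1_cnj L2_norm_cnj_diff
      using a(5) L2_norm_reflect[OF L2_space_diff[OF a(3) g]] by simp
    show "(\<lambda>\<xi>. cnj (g (- \<xi>))) \<in> L2_space" by (intro L2_space_cnj L2_space_reflect g)
  qed (use a u L2_space_cnj in auto)
qed

lemma inner_cnj_eq: "a \<bullet> cnj b = Re (a * b)"
  by (simp add: inner_complex_def)

text \<open>The real part of the multiplication formula, extended from integrable functions by continuity in one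
  argument at a time.\<close>

lemma has_fourier_multiplication:
  assumes "has_fourier u g" "has_fourier v h"
  shows "L2_inner g (\<lambda>x. cnj (v x)) = L2_inner u (\<lambda>x. cnj (h x))"
proof -
  obtain a where "fourier_approx a u g"
    using assms(1) by (rule has_fourierE)
  note a = fourier_approxD[OF this]
  obtain b where "fourier_approx b v h"
    using assms(2) by (rule has_fourierE)
  note b = fourier_approxD[OF this]
  note u = has_fourierD(1)[OF assms(1)] and g = has_fourierD(2)[OF assms(1)]
  note v = has_fourierD(1)[OF assms(2)] and h = has_fourierD(2)[OF assms(2)]
  have int: "integrable lborel (\<lambda>x. p x * q x)" if "p \<in> L2_space" "q \<in> L2_space" for p q :: "'a \<Rightarrow> complex"
    using L2_inner_integrable[OF L2_space_norm[OF that(1)] L2_space_norm[OF that(2)]]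
    by (rule Bochner_Integration.integrable_bound)
       (use that[THEN L2_space_measurable] in \<open>auto simp: norm_mult\<close>)
  have "L2_inner (fourier_L1 (a k)) (\<lambda>x. cnj (b j x)) = L2_inner (a k) (\<lambda>x. cnj (fourier_L1 (b j) x))" for k j
    unfolding L2_inner_def inner_cnj_eq
    using fourier_L1_multiplication[OF a(2) b(2), of k j]
      integral_Re[OF int[OF a(3) b(1)], of k j] integral_Re[OF int[OF a(1) b(3)], of k j] by simp
  then have 1: "L2_inner g (\<lambda>x. cnj (b j x)) = L2_inner u (\<lambda>x. cnj (fourier_L1 (b j) x))" for j
    using L2_inner_tendsto[OF a(3) g L2_space_cnj[OF b(1)] a(5), of j]
      L2_inner_tendsto[OF a(1) u L2_space_cnj[OF b(3)] a(4), of j] by (simp add: LIMSEQ_unique)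
  have "(\<lambda>j. L2_inner (\<lambda>x. cnj (b j x)) g) \<longlonglongrightarrow> L2_inner (\<lambda>x. cnj (v x)) g"
    by (rule L2_inner_tendsto[OF L2_space_cnj[OF b(1)] L2_space_cnj[OF v] g])
       (simp only: L2_norm_cnj_diff b(4))
  moreover have "(\<lambda>j. L2_inner (\<lambda>x. cnj (fourier_L1 (b j) x)) u) \<longlonglongrightarrow> L2_inner (\<lambda>x. cnj (h x)) u"
    by (rule L2_inner_tendsto[OF L2_space_cnj[OF b(3)] L2_space_cnj[OF h] u])
       (simp only: L2_norm_cnj_diff b(5))
  ultimately show ?thesis
    unfolding L2_inner_commute[of _ g] L2_inner_commute[of _ u] 1 by (rule LIMSEQ_unique)
qed

text \<open>
  Fourier inversion. The multiplication formula identifies the adjoint of the transform \<open>F\<close> with the composition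
  of conjugation, \<open>F\<close> and conjugation, and the adjoint of an isometry is a left inverse. In particular \<open>F\<close> is onto.
\<close>

theorem has_fourier_inverse:
  assumes "has_fourier u g"
  shows "has_fourier (\<lambda>\<xi>. cnj (g \<xi>)) (\<lambda>x. cnj (u x))"
proof -
  note u = has_fourierD(1)[OF assms] and g = has_fourierD(2)[OF assms]
  obtain k where k: "has_fourier (\<lambda>\<xi>. cnj (g \<xi>)) k"
    using has_fourier_exists[OF L2_space_cnj[OF g]] .
  note kL = has_fourierD(2)[OF k]
  define d where "d x = k x - cnj (u x)" for x
  have dL: "d \<in> L2_space" unfolding d_def by (intro L2_space_diff kL L2_space_cnj u)
  obtain h where h: "has_fourier (\<lambda>x. cnj (d x)) h" using has_fourier_exists[OF L2_space_cnj[OF dL]] .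
  have cc: "L2_inner (\<lambda>x. cnj (p x)) (\<lambda>x. cnj (q x)) = L2_inner p q" for p q :: "'a \<Rightarrow> complex"
    by (simp add: L2_inner_def inner_complex_def)
  have "L2_inner k d = L2_inner (\<lambda>\<xi>. cnj (g \<xi>)) (\<lambda>x. cnj (h x))"
    using has_fourier_multiplication[OF k h] by simp
  also have "\<dots> = L2_inner u (\<lambda>x. cnj (d x))"
    unfolding cc by (rule has_fourier_Parseval[OF assms h])
  also have "\<dots> = L2_inner (\<lambda>x. cnj (u x)) d"
    using cc[of u "\<lambda>x. cnj (d x)"] by simp
  finally have "L2_inner d d = 0"
    using L2_inner_diff[OF kL L2_space_cnj[OF u] dL] by (simp add: d_def[abs_def])
  then have "AE x in lborel. d x = 0"
    by (intro L2_norm_eq_0 dL) (simp add: L2_inner_self)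
  then show ?thesis
    by (intro has_fourier_cong[OF k] L2_space_measurable L2_space_cnj g u) (auto simp: d_def)
qed

lemma has_fourier_surj:
  fixes g :: "'a::euclidean_space \<Rightarrow> complex"
  assumes "g \<in> L2_space"
  obtains u where "has_fourier u g"
proof -
  obtain k where "has_fourier (\<lambda>x. cnj (g x)) k" using has_fourier_exists[OF L2_space_cnj[OF assms]] .
  from has_fourier_inverse[OF this] show ?thesis by (intro that) simp
qed

section \<open>The fractional Laplacian as a closed operator\<close>

lemma L2_space_of_real: "u \<in> L2_space \<Longrightarrow> (\<lambda>x. complex_of_real (u x)) \<in> L2_space"
  by (rule L2_spaceI) (auto dest: L2_space_measurable L2_space_integrable)

lemma L2_norm_of_real: "L2_norm (\<lambda>x. complex_of_real (u x)) = L2_norm u"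
  by (simp add: L2_norm_def)

lemma L2_inner_of_real: "L2_inner (\<lambda>x. complex_of_real (u x)) (\<lambda>x. complex_of_real (v x)) = L2_inner u v"
  by (simp add: L2_inner_def inner_complex_def)

lemma has_frac_lapD:
  assumes "has_frac_lap \<sigma> u w"
  shows "u \<in> L2_space" "w \<in> L2_space"
  using assms by (auto simp: has_frac_lap_def)

lemma has_frac_lapE:
  assumes "has_frac_lap \<sigma> u w"
  obtains g where "has_fourier (\<lambda>x. complex_of_real (u x)) g"
    "has_fourier (\<lambda>x. complex_of_real (w x)) (\<lambda>\<xi>. of_real (norm \<xi> powr (2 * \<sigma>)) * g \<xi>)"
  using assms by (auto simp: has_frac_lap_def)

lemma has_frac_lap_unique:
  assumes "has_frac_lap \<sigma> u w" "has_frac_lap \<sigma> u' w'" "AE x in lborel. u x = u' x"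
  shows "AE x in lborel. w x = w' x"
proof -
  obtain g where g: "has_fourier (\<lambda>x. complex_of_real (u x)) g"
    "has_fourier (\<lambda>x. complex_of_real (w x)) (\<lambda>\<xi>. of_real (norm \<xi> powr (2 * \<sigma>)) * g \<xi>)"
    using assms(1) by (rule has_frac_lapE)
  obtain g' where g': "has_fourier (\<lambda>x. complex_of_real (u' x)) g'"
    "has_fourier (\<lambda>x. complex_of_real (w' x)) (\<lambda>\<xi>. of_real (norm \<xi> powr (2 * \<sigma>)) * g' \<xi>)"
    using assms(2) by (rule has_frac_lapE)
  have "AE \<xi> in lborel. g \<xi> = g' \<xi>"
    by (rule has_fourier_unique[OF g(1) g'(1)]) (use assms(3) in auto)
  then have "AE x in lborel. complex_of_real (w x) = complex_of_real (w' x)"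
    by (intro has_fourier_injective[OF g(2) g'(2)]) auto
  then show ?thesis by simp
qed

lemma has_frac_lap_add:
  assumes "has_frac_lap \<sigma> u w" "has_frac_lap \<sigma> u' w'"
  shows "has_frac_lap \<sigma> (\<lambda>x. u x + u' x) (\<lambda>x. w x + w' x)"
proof -
  obtain g where g: "has_fourier (\<lambda>x. complex_of_real (u x)) g"
    "has_fourier (\<lambda>x. complex_of_real (w x)) (\<lambda>\<xi>. of_real (norm \<xi> powr (2 * \<sigma>)) * g \<xi>)"
    using assms(1) by (rule has_frac_lapE)
  obtain g' where g': "has_fourier (\<lambda>x. complex_of_real (u' x)) g'"
    "has_fourier (\<lambda>x. complex_of_real (w' x)) (\<lambda>\<xi>. of_real (norm \<xi> powr (2 * \<sigma>)) * g' \<xi>)"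
    using assms(2) by (rule has_frac_lapE)
  show ?thesis
    unfolding has_frac_lap_def
    using has_fourier_add[OF g(1) g'(1)] has_fourier_add[OF g(2) g'(2)]
      assms[THEN has_frac_lapD(1)] assms[THEN has_frac_lapD(2)]
    by (auto intro!: L2_space_add exI[of _ "\<lambda>\<xi>. g \<xi> + g' \<xi>"] simp: distrib_left)
qed

lemma has_frac_lap_cmult:
  assumes "has_frac_lap \<sigma> u w"
  shows "has_frac_lap \<sigma> (\<lambda>x. c * u x) (\<lambda>x. c * w x)"
proof -
  obtain g where g: "has_fourier (\<lambda>x. complex_of_real (u x)) g"
    "has_fourier (\<lambda>x. complex_of_real (w x)) (\<lambda>\<xi>. of_real (norm \<xi> powr (2 * \<sigma>)) * g \<xi>)"
    using assms(1) by (rule has_frac_lapE)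
  show ?thesis
    unfolding has_frac_lap_def
    using has_fourier_cmult[OF g(1), of "of_real c"] has_fourier_cmult[OF g(2), of "of_real c"]
      has_frac_lapD[OF assms]
    by (auto intro!: L2_space_cmult exI[of _ "\<lambda>\<xi>. of_real c * g \<xi>"] simp: mult_ac)
qed

lemma has_frac_lap_diff:
  assumes "has_frac_lap \<sigma> u w" "has_frac_lap \<sigma> u' w'"
  shows "has_frac_lap \<sigma> (\<lambda>x. u x - u' x) (\<lambda>x. w x - w' x)"
  using has_frac_lap_add[OF assms(1) has_frac_lap_cmult[OF assms(2), of "-1"]] by simp

text \<open>Multiplication by a fixed measurable symbol is a closed operator: along a common subsequence both the
  transforms and their multiples by the symbol converge almost everywhere.\<close>

lemma has_frac_lap_closed:
  fixes u :: "'a::euclidean_space \<Rightarrow> real"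
  assumes f: "\<And>k. has_frac_lap \<sigma> (uk k) (wk k)" and u: "u \<in> L2_space" and w: "w \<in> L2_space"
    and lu: "(\<lambda>k::nat. L2_norm (\<lambda>x. uk k x - u x)) \<longlonglongrightarrow> 0" and lw: "(\<lambda>k. L2_norm (\<lambda>x. wk k x - w x)) \<longlonglongrightarrow> 0"
  shows "has_frac_lap \<sigma> u w"
proof -
  let ?m = "\<lambda>\<xi>::'a. complex_of_real (norm \<xi> powr (2 * \<sigma>))"
  have "\<forall>k. \<exists>g. has_fourier (\<lambda>x. complex_of_real (uk k x)) g \<and> has_fourier (\<lambda>x. complex_of_real (wk k x)) (\<lambda>\<xi>. ?m \<xi> * g \<xi>)"
    using f by (auto simp: has_frac_lap_def)
  then obtain gk where gk: "\<And>k. has_fourier (\<lambda>x. complex_of_real (uk k x)) (gk k)"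
    "\<And>k. has_fourier (\<lambda>x. complex_of_real (wk k x)) (\<lambda>\<xi>. ?m \<xi> * gk k \<xi>)" by metis
  obtain g where g: "has_fourier (\<lambda>x. complex_of_real (u x)) g"
    using has_fourier_exists[OF L2_space_of_real[OF u]] .
  obtain h where h: "has_fourier (\<lambda>x. complex_of_real (w x)) h"
    using has_fourier_exists[OF L2_space_of_real[OF w]] .
  have "L2_norm (\<lambda>\<xi>. gk k \<xi> - g \<xi>) = L2_norm (\<lambda>x. uk k x - u x)" for k
    using has_fourier_isometry[OF has_fourier_diff[OF gk(1) g], of k] L2_norm_of_real[of "\<lambda>x. uk k x - u x"] by simp
  then have lg: "(\<lambda>k. L2_norm (\<lambda>\<xi>. gk k \<xi> - g \<xi>)) \<longlonglongrightarrow> 0" using lu by simp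
  have "L2_norm (\<lambda>\<xi>. ?m \<xi> * gk k \<xi> - h \<xi>) = L2_norm (\<lambda>x. wk k x - w x)" for k
    using has_fourier_isometry[OF has_fourier_diff[OF gk(2) h], of k] L2_norm_of_real[of "\<lambda>x. wk k x - w x"] by simp
  then have lh: "(\<lambda>k. L2_norm (\<lambda>\<xi>. ?m \<xi> * gk k \<xi> - h \<xi>)) \<longlonglongrightarrow> 0" using lw by simp
  obtain r where r: "strict_mono (r::nat\<Rightarrow>nat)" "AE \<xi> in lborel. (\<lambda>n. gk (r n) \<xi>) \<longlonglongrightarrow> g \<xi>"
    using L2_AE_subseq[OF has_fourierD(2)[OF gk(1)] has_fourierD(2)[OF g] lg] by blast
  have "(\<lambda>k. L2_norm (\<lambda>\<xi>. ?m \<xi> * gk (r k) \<xi> - h \<xi>)) \<longlonglongrightarrow> 0"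
    using LIMSEQ_subseq_LIMSEQ[OF lh r(1)] by (simp add: o_def)
  from L2_AE_subseq[OF has_fourierD(2)[OF gk(2)] has_fourierD(2)[OF h] this]
  obtain q where q: "strict_mono (q::nat\<Rightarrow>nat)" "AE \<xi> in lborel. (\<lambda>n. ?m \<xi> * gk (r (q n)) \<xi>) \<longlonglongrightarrow> h \<xi>" by blast
  have eq: "AE \<xi> in lborel. ?m \<xi> * g \<xi> = h \<xi>"
    using r(2) q(2)
  proof eventually_elim
    case (elim \<xi>)
    have "(\<lambda>n. gk (r (q n)) \<xi>) \<longlonglongrightarrow> g \<xi>"
      using LIMSEQ_subseq_LIMSEQ[OF elim(1) q(1)] by (simp add: o_def)
    then have "(\<lambda>n. ?m \<xi> * gk (r (q n)) \<xi>) \<longlonglongrightarrow> ?m \<xi> * g \<xi>" by (intro tendsto_intros)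
    then show ?case using elim(2) by (rule LIMSEQ_unique)
  qed
  have [measurable]: "g \<in> borel_measurable borel" using has_fourierD(2)[OF g] by (rule L2_space_measurable)
  have "has_fourier (\<lambda>x. complex_of_real (w x)) (\<lambda>\<xi>. ?m \<xi> * g \<xi>)"
    by (rule has_fourier_cong[OF h]) (use eq w in \<open>auto intro!: L2_space_measurable L2_space_of_real\<close>)
  then show ?thesis
    unfolding has_frac_lap_def using u w g by blast
qed

text \<open>Weak convergence without weak topologies. The Fourier transform of \<open>w0\<close> is approximated by a
  function \<open>p\<close> of bounded support. Against the remainder the images \<open>wk\<close> contribute little, being bounded; against
  \<open>p\<close> the symbol is bounded, can be moved to \<open>p\<close>, and only the norms of \<open>vk\<close> remain.\<close>

lemma has_frac_lap_weakly_null: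
  fixes w0 :: "'a::euclidean_space \<Rightarrow> real"
  assumes \<sigma>: "0 \<le> \<sigma>" and w0: "w0 \<in> L2_space" and f: "\<And>k. has_frac_lap \<sigma> (vk k) (wk k)"
    and v: "(\<lambda>k::nat. L2_norm (vk k)) \<longlonglongrightarrow> 0" and B: "\<And>k. L2_norm (wk k) \<le> B"
  shows "(\<lambda>k. L2_inner w0 (wk k)) \<longlonglongrightarrow> 0"
proof -
  let ?m = "\<lambda>\<xi>::'a. complex_of_real (norm \<xi> powr (2 * \<sigma>))"
  have "\<forall>k. \<exists>g. has_fourier (\<lambda>x. complex_of_real (vk k x)) g \<and> has_fourier (\<lambda>x. complex_of_real (wk k x)) (\<lambda>\<xi>. ?m \<xi> * g \<xi>)"
    using f by (auto simp: has_frac_lap_def)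
  then obtain gk where gk: "\<And>k. has_fourier (\<lambda>x. complex_of_real (vk k x)) (gk k)"
    "\<And>k. has_fourier (\<lambda>x. complex_of_real (wk k x)) (\<lambda>\<xi>. ?m \<xi> * gk k \<xi>)" by metis
  obtain h where h: "has_fourier (\<lambda>x. complex_of_real (w0 x)) h"
    using has_fourier_exists[OF L2_space_of_real[OF w0]] .
  note hL = has_fourierD(2)[OF h] and gL = has_fourierD(2)[OF gk(1)] and mL = has_fourierD(2)[OF gk(2)]
  note [measurable] = L2_space_measurable[OF hL]
  have B0: "0 \<le> B" using B[of 0] L2_norm_nonneg[of "wk 0"] by linarith
  have eq: "L2_inner w0 (wk k) = L2_inner h (\<lambda>\<xi>. ?m \<xi> * gk k \<xi>)" for k
    using has_fourier_Parseval[OF h gk(2)] by (simp add: L2_inner_of_real)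
  have nm: "L2_norm (\<lambda>\<xi>. ?m \<xi> * gk k \<xi>) \<le> B" for k
    using has_fourier_isometry[OF gk(2)] B[of k] by (simp add: L2_norm_of_real)
  have ng: "(\<lambda>k. L2_norm (gk k)) \<longlonglongrightarrow> 0"
    using has_fourier_isometry[OF gk(1)] v by (simp add: L2_norm_of_real)
  define p where "p k \<xi> = indicator {\<xi>. norm \<xi> \<le> real k \<and> norm (h \<xi>) \<le> real k} \<xi> *\<^sub>R h \<xi>" for k \<xi>
  have [measurable]: "p k \<in> borel_measurable borel" for k unfolding p_def by measurable
  have pL: "p k \<in> L2_space" for k
    by (rule L2_space_bounded_support[where B="real k" and R="real k"]) (auto simp: p_def indicator_def)
  have mpL: "(\<lambda>\<xi>. ?m \<xi> * p k \<xi>) \<in> L2_space" for k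
  proof (rule L2_space_bounded_support[where B="real k powr (2 * \<sigma>) * real k" and R="real k"])
    show "norm (?m \<xi> * p k \<xi>) \<le> real k powr (2 * \<sigma>) * real k" for \<xi>
      using \<sigma> by (auto simp: p_def indicator_def norm_mult intro!: mult_mono powr_mono2)
  qed (auto simp: p_def)
  show ?thesis
  proof (rule LIMSEQ_I)
    fix e :: real assume e: "e > 0"
    have "(\<lambda>k. L2_norm (\<lambda>x. p k x - h x)) \<longlonglongrightarrow> 0"
      unfolding p_def by (rule L2_dense_bounded_support[OF hL])
    then have "(\<lambda>k. L2_norm (\<lambda>x. p k x - h x) * B) \<longlonglongrightarrow> 0" by (rule tendsto_mult_left_zero)
    from order_tendstoD(2)[OF this, of "e / 2"] e obtain R where R: "L2_norm (\<lambda>x. p R x - h x) * B < e / 2"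
      by (auto simp: eventually_sequentially)
    have "(\<lambda>k. L2_norm (\<lambda>\<xi>. ?m \<xi> * p R \<xi>) * L2_norm (gk k)) \<longlonglongrightarrow> 0"
      using ng by (rule tendsto_mult_right_zero)
    from order_tendstoD(2)[OF this, of "e / 2"] e
    obtain N where N: "\<And>k. k \<ge> N \<Longrightarrow> L2_norm (\<lambda>\<xi>. ?m \<xi> * p R \<xi>) * L2_norm (gk k) < e / 2"
      by (auto simp: eventually_sequentially)
    have "norm (L2_inner w0 (wk k) - 0) < e" if "k \<ge> N" for k
    proof -
      have "\<bar>L2_inner (\<lambda>x. p R x - h x) (\<lambda>\<xi>. ?m \<xi> * gk k \<xi>)\<bar>
          \<le> L2_norm (\<lambda>x. p R x - h x) * L2_norm (\<lambda>\<xi>. ?m \<xi> * gk k \<xi>)"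
        by (rule L2_Cauchy_Schwarz[OF L2_space_diff[OF pL hL] mL])
      also have "\<dots> \<le> L2_norm (\<lambda>x. p R x - h x) * B" by (intro mult_left_mono nm) simp
      finally have 1: "\<bar>L2_inner (p R) (\<lambda>\<xi>. ?m \<xi> * gk k \<xi>) - L2_inner h (\<lambda>\<xi>. ?m \<xi> * gk k \<xi>)\<bar> < e / 2"
        using R L2_inner_diff[OF pL hL mL, of R k] by simp
      have "L2_inner (p R) (\<lambda>\<xi>. ?m \<xi> * gk k \<xi>) = L2_inner (\<lambda>\<xi>. ?m \<xi> * p R \<xi>) (gk k)"
        unfolding L2_inner_def by (intro Bochner_Integration.integral_cong refl) (simp add: inner_complex_def algebra_simps)
      then have "\<bar>L2_inner (p R) (\<lambda>\<xi>. ?m \<xi> * gk k \<xi>)\<bar> < e / 2"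
        using L2_Cauchy_Schwarz[OF mpL gL, of R k] N[OF that] by simp
      then show ?thesis using 1 unfolding eq real_norm_def diff_0_right by linarith
    qed
    then show "\<exists>no. \<forall>k\<ge>no. norm (L2_inner w0 (wk k) - 0) < e" by blast
  qed
qed

section \<open>The Gagliardo energy, truncations and the Poincare inequality\<close>

definition frac_weight :: "real \<Rightarrow> real \<Rightarrow> ennreal" where
  "frac_weight s r = indicator {0<..} r * ennreal (r powr (- 1 - 2 * s))"

text \<open>Up to a constant factor this is the Gagliardo double integral of \<open>(u (x + z) - u x)\<^sup>2\<close> against the kernel
  \<open>norm z powr (- n - 2 * s)\<close>, where \<open>n\<close> is the dimension: that kernel is a superposition of Gaussians of all widths \<open>r\<close>. Written this
  way the energy is computed with the Fourier transform of one Gaussian and a scaling in \<open>r\<close>, without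
  polar coordinates or rotations.\<close>

definition gagliardo :: "real \<Rightarrow> ('a::euclidean_space \<Rightarrow> real) \<Rightarrow> ennreal" where
  "gagliardo s u = (\<integral>\<^sup>+r. frac_weight s r *
     (\<integral>\<^sup>+y. ennreal (gauss y) * (\<integral>\<^sup>+x. ennreal ((u (x + r *\<^sub>R y) - u x)\<^sup>2) \<partial>lborel) \<partial>lborel) \<partial>lborel)"

text \<open>The Fourier symbol of the Gagliardo energy at frequencies of norm \<open>a\<close>. For \<open>0 < s < 1\<close> it is a
  positive finite multiple of \<open>a powr (2 * s)\<close>.\<close>

definition frac_symbol :: "real \<Rightarrow> real \<Rightarrow> ennreal" where
  "frac_symbol s a = (\<integral>\<^sup>+r. frac_weight s r * ennreal (2 - 2 * exp (- (r * a)\<^sup>2 / 2)) \<partial>lborel)"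

lemma frac_weight_measurable [measurable]: "frac_weight s \<in> borel_measurable borel"
  unfolding frac_weight_def by measurable

lemma norm_cis_minus_1: "(norm (cis t - 1))\<^sup>2 = 2 - 2 * cos t"
proof -
  have "(norm (cis t - 1))\<^sup>2 = (cos t - 1)\<^sup>2 + (sin t)\<^sup>2" by (simp add: cmod_power2)
  also have "\<dots> = ((sin t)\<^sup>2 + (cos t)\<^sup>2) + 1 - 2 * cos t" by (simp add: power2_eq_square algebra_simps)
  finally show ?thesis by simp
qed

lemma nn_integral_difference_fourier:
  fixes u :: "'a::euclidean_space \<Rightarrow> real"
  assumes "has_fourier (\<lambda>x. complex_of_real (u x)) g"
  shows "(\<integral>\<^sup>+x. ennreal ((u (x + z) - u x)\<^sup>2) \<partial>lborel)
    = (\<integral>\<^sup>+\<xi>. ennreal ((2 - 2 * cos (\<xi> \<bullet> z)) * (norm (g \<xi>))\<^sup>2) \<partial>lborel)"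
proof -
  have d: "has_fourier (\<lambda>x. complex_of_real (u (x + z)) - complex_of_real (u x)) (\<lambda>\<xi>. cis (\<xi> \<bullet> z) * g \<xi> - g \<xi>)"
    by (rule has_fourier_diff[OF has_fourier_shift[OF assms] assms])
  have "(\<integral>\<^sup>+x. ennreal ((u (x + z) - u x)\<^sup>2) \<partial>lborel)
      = (\<integral>\<^sup>+x. ennreal ((norm (complex_of_real (u (x + z)) - complex_of_real (u x)))\<^sup>2) \<partial>lborel)"
    by (simp flip: of_real_diff)
  also have "\<dots> = (\<integral>\<^sup>+\<xi>. ennreal ((norm (cis (\<xi> \<bullet> z) * g \<xi> - g \<xi>))\<^sup>2) \<partial>lborel)"
    using L2_nn_norm[OF has_fourierD(1)[OF d]] L2_nn_norm[OF has_fourierD(2)[OF d]]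
      has_fourier_isometry[OF d] by simp
  also have "\<dots> = (\<integral>\<^sup>+\<xi>. ennreal ((2 - 2 * cos (\<xi> \<bullet> z)) * (norm (g \<xi>))\<^sup>2) \<partial>lborel)"
  proof (intro nn_integral_cong)
    fix \<xi>
    have "cis (\<xi> \<bullet> z) * g \<xi> - g \<xi> = (cis (\<xi> \<bullet> z) - 1) * g \<xi>" by (simp add: algebra_simps)
    then have "(norm (cis (\<xi> \<bullet> z) * g \<xi> - g \<xi>))\<^sup>2 = (norm (cis (\<xi> \<bullet> z) - 1))\<^sup>2 * (norm (g \<xi>))\<^sup>2"
      by (simp only: norm_mult power_mult_distrib)
    then show "ennreal ((norm (cis (\<xi> \<bullet> z) * g \<xi> - g \<xi>))\<^sup>2) = ennreal ((2 - 2 * cos (\<xi> \<bullet> z)) * (norm (g \<xi>))\<^sup>2)"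
      by (simp only: norm_cis_minus_1)
  qed
  finally show ?thesis .
qed

lemma nn_integral_gauss_cos:
  fixes \<xi> :: "'a::euclidean_space"
  shows "(\<integral>\<^sup>+y. ennreal (gauss y * (2 - 2 * cos (\<xi> \<bullet> y))) \<partial>lborel) = ennreal (2 - 2 * exp (- (norm \<xi>)\<^sup>2 / 2))"
proof -
  have ci: "integrable lborel (\<lambda>y. cis (\<xi> \<bullet> y) * complex_of_real (gauss y))"
    by (intro integrable_cis_mult integrable_of_real integrable_gauss)
  have gc: "integrable lborel (\<lambda>y. gauss y * cos (\<xi> \<bullet> y))"
    using integrable_Re[OF ci] by (simp add: mult.commute)
  have gc': "(LINT y|lborel. gauss y * cos (\<xi> \<bullet> y)) = exp (- (norm \<xi>)\<^sup>2 / 2)"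
    using integral_Re[OF ci] gauss_fourier[of \<xi>] by (simp add: mult.commute)
  have eq: "gauss y * (2 - 2 * cos (\<xi> \<bullet> y)) = 2 * gauss y - 2 * (gauss y * cos (\<xi> \<bullet> y))" for y
    by (simp add: algebra_simps)
  have int: "integrable lborel (\<lambda>y. gauss y * (2 - 2 * cos (\<xi> \<bullet> y)))"
    unfolding eq using integrable_gauss gc by auto
  have "(LINT y|lborel. gauss y * (2 - 2 * cos (\<xi> \<bullet> y))) = 2 - 2 * exp (- (norm \<xi>)\<^sup>2 / 2)"
    unfolding eq using integrable_gauss[where 'a='a] gc by (simp add: integral_gauss gc')
  moreover have "0 \<le> gauss y * (2 - 2 * cos (\<xi> \<bullet> y))" for y
    by (simp add: gauss_nonneg)
  ultimately show ?thesis
    using nn_integral_eq_integral[OF int] by simp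
qed

text \<open>Plancherel for the differences \<open>u (x + z) - u x\<close>, whose transform is \<open>(cis (\<xi> \<bullet> z) - 1) * g \<xi>\<close>, followed by
  Tonelli and the Fourier transform of the Gaussian.\<close>

lemma gagliardo_fourier:
  fixes u :: "'a::euclidean_space \<Rightarrow> real"
  assumes g: "has_fourier (\<lambda>x. complex_of_real (u x)) g"
  shows "gagliardo s u = (\<integral>\<^sup>+\<xi>. ennreal ((norm (g \<xi>))\<^sup>2) * frac_symbol s (norm \<xi>) \<partial>lborel)"
proof -
  let ?k = "\<lambda>r y \<xi>. ennreal (gauss y) * ennreal ((2 - 2 * cos (\<xi> \<bullet> (r *\<^sub>R y))) * (norm (g \<xi>))\<^sup>2)"
  let ?e = "\<lambda>r \<xi>. ennreal ((norm (g \<xi>))\<^sup>2) * ennreal (2 - 2 * exp (- (r * norm \<xi>)\<^sup>2 / 2))"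
  have [measurable]: "g \<in> borel_measurable borel" using has_fourierD(2)[OF g] by (rule L2_space_measurable)
  have inner: "(\<integral>\<^sup>+y. ennreal (gauss y) * (\<integral>\<^sup>+x. ennreal ((u (x + r *\<^sub>R y) - u x)\<^sup>2) \<partial>lborel) \<partial>lborel)
      = (\<integral>\<^sup>+\<xi>. ?e r \<xi> \<partial>lborel)" for r
  proof -
    have "(\<integral>\<^sup>+y. ennreal (gauss y) * (\<integral>\<^sup>+x. ennreal ((u (x + r *\<^sub>R y) - u x)\<^sup>2) \<partial>lborel) \<partial>lborel)
        = (\<integral>\<^sup>+y. (\<integral>\<^sup>+\<xi>. ?k r y \<xi> \<partial>lborel) \<partial>lborel)"
      unfolding nn_integral_difference_fourier[OF g] by (subst nn_integral_cmult) auto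
    also have "\<dots> = (\<integral>\<^sup>+\<xi>. (\<integral>\<^sup>+y. ?k r y \<xi> \<partial>lborel) \<partial>lborel)"
      by (rule lborel_pair.Fubini') measurable
    also have "\<dots> = (\<integral>\<^sup>+\<xi>. ?e r \<xi> \<partial>lborel)"
    proof (intro nn_integral_cong)
      fix \<xi> :: 'a
      have "(\<integral>\<^sup>+y. ?k r y \<xi> \<partial>lborel)
          = (\<integral>\<^sup>+y. ennreal ((norm (g \<xi>))\<^sup>2) * ennreal (gauss y * (2 - 2 * cos ((r *\<^sub>R \<xi>) \<bullet> y))) \<partial>lborel)"
        by (intro nn_integral_cong) (simp add: gauss_nonneg ennreal_mult[symmetric] mult_ac)
      also have "\<dots> = ennreal ((norm (g \<xi>))\<^sup>2) * ennreal (2 - 2 * exp (- (norm (r *\<^sub>R \<xi>))\<^sup>2 / 2))"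
        by (subst nn_integral_cmult) (simp, simp only: nn_integral_gauss_cos)
      also have "(norm (r *\<^sub>R \<xi>))\<^sup>2 = (r * norm \<xi>)\<^sup>2" by (simp add: power_mult_distrib)
      finally show "(\<integral>\<^sup>+y. ?k r y \<xi> \<partial>lborel)
        = ?e r \<xi>" .
    qed
    finally show ?thesis .
  qed
  have "gagliardo s u = (\<integral>\<^sup>+r. (\<integral>\<^sup>+\<xi>. frac_weight s r * (?e r \<xi>) \<partial>lborel) \<partial>lborel)"
    unfolding gagliardo_def inner by (subst nn_integral_cmult) auto
  also have "\<dots> = (\<integral>\<^sup>+\<xi>. (\<integral>\<^sup>+r. frac_weight s r * (?e r \<xi>) \<partial>lborel) \<partial>lborel)"
    by (rule lborel_pair.Fubini') measurable
  also have "\<dots> = (\<integral>\<^sup>+\<xi>. ennreal ((norm (g \<xi>))\<^sup>2) * frac_symbol s (norm \<xi>) \<partial>lborel)"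
    unfolding frac_symbol_def
    by (subst nn_integral_cmult[symmetric]) (auto intro!: nn_integral_cong simp: mult_ac)
  finally show ?thesis .
qed

text \<open>The substitution \<open>r / a\<close> for \<open>r\<close>.\<close>

lemma frac_symbol_scale:
  assumes "0 < s" "0 \<le> a"
  shows "frac_symbol s a = ennreal (a powr (2 * s)) * frac_symbol s 1"
proof (cases "a = 0")
  case False
  then have a: "a > 0" using assms(2) by simp
  have "frac_symbol s a = ennreal \<bar>1 / a\<bar> * (\<integral>\<^sup>+r. frac_weight s (0 + (1 / a) * r) *
      ennreal (2 - 2 * exp (- ((0 + (1 / a) * r) * a)\<^sup>2 / 2)) \<partial>lborel)"
    unfolding frac_symbol_def by (rule nn_integral_real_affine) (use a in auto)
  also have "\<dots> = ennreal \<bar>1 / a\<bar> * (\<integral>\<^sup>+r. ennreal (a powr (1 + 2 * s)) * (frac_weight s r * ennreal (2 - 2 * exp (- (r * 1)\<^sup>2 / 2))) \<partial>lborel)"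
  proof (rule arg_cong[where f="\<lambda>t. ennreal \<bar>1 / a\<bar> * t"], rule nn_integral_cong)
    fix r :: real
    have "frac_weight s (0 + (1 / a) * r) = ennreal (a powr (1 + 2 * s)) * frac_weight s r"
    proof (cases "r > 0")
      case True
      have "(r / a) powr (- 1 - 2 * s) = a powr (1 + 2 * s) * r powr (- 1 - 2 * s)"
        using True a powr_minus_divide[of a "1 + 2 * s"] by (simp add: powr_divide)
      then show ?thesis using True a by (simp add: frac_weight_def ennreal_mult[symmetric])
    next
      case False
      then show ?thesis using a by (simp add: frac_weight_def zero_less_divide_iff)
    qed
    then show "frac_weight s (0 + (1 / a) * r) * ennreal (2 - 2 * exp (- ((0 + (1 / a) * r) * a)\<^sup>2 / 2))
      = ennreal (a powr (1 + 2 * s)) * (frac_weight s r * ennreal (2 - 2 * exp (- (r * 1)\<^sup>2 / 2)))"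
      using a by (simp add: mult_ac)
  qed
  also have "\<dots> = ennreal (\<bar>1 / a\<bar> * a powr (1 + 2 * s)) * frac_symbol s 1"
    unfolding frac_symbol_def by (subst nn_integral_cmult) (simp, simp only: ennreal_mult[OF abs_ge_zero powr_ge_zero] mult.assoc)
  also have "\<bar>1 / a\<bar> * a powr (1 + 2 * s) = a powr (2 * s)"
    using a by (simp add: powr_add)
  finally show ?thesis .
qed (use assms in \<open>simp add: frac_symbol_def\<close>)

text \<open>Near 0 the factor \<open>2 - 2 * exp (- r\<^sup>2 / 2)\<close> is at most \<open>r\<^sup>2\<close>, and \<open>r powr (1 - 2 * s)\<close> is integrable there because
  \<open>s < 1\<close>; at infinity the factor is at most 2, and \<open>r powr (- 1 - 2 * s)\<close> is integrable because \<open>s > 0\<close>.\<close>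

lemma frac_symbol_finite:
  assumes "0 < s" "s < 1"
  shows "frac_symbol s 1 < \<infinity>"
proof -
  have "frac_symbol s 1 \<le> (\<integral>\<^sup>+r. ennreal (indicator {0..1} r * r powr (1 - 2 * s)) + ennreal (indicator {1..} r * (2 * r powr (- 1 - 2 * s))) \<partial>lborel)"
    unfolding frac_symbol_def
  proof (intro nn_integral_mono)
    fix r :: real
    have e: "2 - 2 * exp (- (r * 1)\<^sup>2 / 2) \<le> min (r\<^sup>2) 2"
      using exp_ge_add_one_self[of "- r\<^sup>2 / 2"] by simp
    consider "r \<le> 0" | "0 < r" "r < 1" | "r \<ge> 1" by linarith
    then show "frac_weight s r * ennreal (2 - 2 * exp (- (r * 1)\<^sup>2 / 2))
      \<le> ennreal (indicator {0..1} r * r powr (1 - 2 * s)) + ennreal (indicator {1..} r * (2 * r powr (- 1 - 2 * s)))"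
    proof cases
      case 1 then show ?thesis by (simp add: frac_weight_def)
    next
      case 2
      have "r powr (- 1 - 2 * s) * (2 - 2 * exp (- (r * 1)\<^sup>2 / 2)) \<le> r powr (- 1 - 2 * s) * r\<^sup>2"
        using e by (intro mult_left_mono) auto
      also have "r\<^sup>2 = r powr 2" using 2 by (simp add: powr_numeral)
      also have "r powr (- 1 - 2 * s) * r powr 2 = r powr (1 - 2 * s)"
        using 2 by (subst powr_add[symmetric]) simp
      finally show ?thesis using 2 by (simp add: frac_weight_def ennreal_mult[symmetric] ennreal_leI)
    next
      case 3
      have "r powr (- 1 - 2 * s) * (2 - 2 * exp (- (r * 1)\<^sup>2 / 2)) \<le> r powr (- 1 - 2 * s) * 2"
        using e by (intro mult_left_mono) auto
      then have "ennreal (r powr (- 1 - 2 * s) * (2 - 2 * exp (- (r * 1)\<^sup>2 / 2))) \<le> ennreal (2 * r powr (- 1 - 2 * s))"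
        by (intro ennreal_leI) simp
      moreover have "frac_weight s r * ennreal (2 - 2 * exp (- (r * 1)\<^sup>2 / 2))
          = ennreal (r powr (- 1 - 2 * s) * (2 - 2 * exp (- (r * 1)\<^sup>2 / 2)))"
        using 3 by (simp add: frac_weight_def ennreal_mult[symmetric])
      moreover have "indicator {1..} r * (2 * r powr (- 1 - 2 * s)) = 2 * r powr (- 1 - 2 * s)"
        using 3 by simp
      ultimately show ?thesis by (simp only: add_increasing[OF zero_le])
    qed
  qed
  also have "\<dots> = (\<integral>\<^sup>+r. ennreal (indicator {0..1} r * r powr (1 - 2 * s)) \<partial>lborel)
      + (\<integral>\<^sup>+r. ennreal (indicator {1..} r * (2 * r powr (- 1 - 2 * s))) \<partial>lborel)"
    by (rule nn_integral_add) auto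
  also have "\<dots> < \<infinity>"
  proof -
    have 1: "((\<lambda>r. r powr (1 - 2 * s)) has_integral (1 powr (1 - 2 * s + 1) / (1 - 2 * s + 1))) {0..1::real}"
      by (rule has_integral_powr_from_0) (use assms in auto)
    have 2: "((\<lambda>r. 2 * r powr (- 1 - 2 * s)) has_integral (2 * (-(1 powr (- 1 - 2 * s + 1)) / (- 1 - 2 * s + 1)))) {1::real..}"
      by (intro has_integral_mult_right has_integral_powr_to_inf) (use assms in auto)
    have "(\<integral>\<^sup>+r. ennreal (indicator {0..1} r * r powr (1 - 2 * s)) \<partial>lborel) = ennreal (1 powr (1 - 2 * s + 1) / (1 - 2 * s + 1))"
      using nn_integral_has_integral_lebesgue[OF _ 1] by (simp add: nn_integral_completion)
    moreover have "(\<integral>\<^sup>+r. ennreal (indicator {1..} r * (2 * r powr (- 1 - 2 * s))) \<partial>lborel) = ennreal (2 * (-(1 powr (- 1 - 2 * s + 1)) / (- 1 - 2 * s + 1)))"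
      using nn_integral_has_integral_lebesgue[OF _ 2] by (simp add: nn_integral_completion)
    ultimately show ?thesis by simp
  qed
  finally show ?thesis .
qed

lemma open_not_AE_avoided:
  assumes "open U" "U \<noteq> {}"
  shows "\<not> (AE x in lborel. x \<notin> U)"
proof
  assume "AE x in lborel. x \<notin> U"
  then have "U \<in> null_sets lborel" using assms(1) by (subst AE_iff_null_sets) auto
  then have "negligible U" by (simp add: negligible_iff_null_sets null_sets_completionI)
  then show False using open_not_negligible[OF assms] by simp
qed

lemma frac_symbol_pos: "0 < frac_symbol s 1"
proof (rule ccontr)
  assume "\<not> 0 < frac_symbol s 1"
  then have "frac_symbol s 1 = 0" by simp
  then have "AE r in lborel. frac_weight s r * ennreal (2 - 2 * exp (- (r * 1)\<^sup>2 / 2)) = 0"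
    unfolding frac_symbol_def by (subst (asm) nn_integral_0_iff_AE) auto
  then have "AE r in lborel. r \<notin> {1<..<2::real}"
  proof eventually_elim
    case (elim r)
    show ?case
    proof
      assume r: "r \<in> {1<..<2}"
      then have "exp (- (r * 1)\<^sup>2 / 2) < 1" by simp
      then show False using elim r by (simp add: frac_weight_def ennreal_eq_0_iff)
    qed
  qed
  then show False using open_not_AE_avoided[of "{1<..<2::real}"] by simp
qed

lemma frac_lap_gagliardo:
  fixes u :: "'a::euclidean_space \<Rightarrow> real"
  assumes "0 < s" "has_fourier (\<lambda>x. complex_of_real (u x)) g"
  shows "gagliardo s u = frac_symbol s 1 * (\<integral>\<^sup>+\<xi>. ennreal ((norm (of_real (norm \<xi> powr (2 * (s / 2))) * g \<xi>))\<^sup>2) \<partial>lborel)"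
proof -
  have [measurable]: "g \<in> borel_measurable borel" using has_fourierD(2)[OF assms(2)] by (rule L2_space_measurable)
  have "gagliardo s u = (\<integral>\<^sup>+\<xi>. frac_symbol s 1 * ennreal ((norm (of_real (norm \<xi> powr (2 * (s / 2))) * g \<xi>))\<^sup>2) \<partial>lborel)"
    unfolding gagliardo_fourier[OF assms(2)]
  proof (intro nn_integral_cong)
    fix \<xi> :: 'a
    have "(norm \<xi> powr s)\<^sup>2 = norm \<xi> powr (2 * s)"
      by (cases "\<xi> = 0") (simp_all add: power2_eq_square powr_add[symmetric])
    then have "(norm (of_real (norm \<xi> powr (2 * (s / 2))) * g \<xi>))\<^sup>2 = norm \<xi> powr (2 * s) * (norm (g \<xi>))\<^sup>2"
      by (simp add: norm_mult power_mult_distrib)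
    then show "ennreal ((norm (g \<xi>))\<^sup>2) * frac_symbol s (norm \<xi>)
      = frac_symbol s 1 * ennreal ((norm (of_real (norm \<xi> powr (2 * (s / 2))) * g \<xi>))\<^sup>2)"
      unfolding frac_symbol_scale[OF assms(1) norm_ge_zero] by (simp add: ennreal_mult mult_ac)
  qed
  then show ?thesis by (simp add: nn_integral_cmult)
qed

lemma gagliardo_eq_frac_lap:
  assumes "0 < s" "has_frac_lap (s / 2) u w"
  shows "gagliardo s u = frac_symbol s 1 * ennreal ((L2_norm w)\<^sup>2)"
proof -
  obtain g where g: "has_fourier (\<lambda>x. complex_of_real (u x)) g"
    "has_fourier (\<lambda>x. complex_of_real (w x)) (\<lambda>\<xi>. of_real (norm \<xi> powr (2 * (s / 2))) * g \<xi>)"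
    using assms(2) by (rule has_frac_lapE)
  show ?thesis
    unfolding frac_lap_gagliardo[OF assms(1) g(1)]
    using L2_nn_norm[OF has_fourierD(2)[OF g(2)]] has_fourier_isometry[OF g(2)] L2_norm_of_real[of w] by simp
qed

text \<open>Passing to \<open>\<bar>u\<bar>\<close> increases no difference \<open>\<bar>u (x + z) - u x\<bar>\<close>, hence not the Gagliardo energy. Thus the
  multiple of the transform of \<open>\<bar>u\<bar>\<close> by the symbol is square integrable, and by inversion it is the transform of a
  function \<open>W\<close>. This function is real: the symbol is even and \<open>\<bar>u\<bar>\<close> is real, so \<open>W\<close> and its conjugate have
  the same transform.\<close>

theorem has_frac_lap_abs:
  fixes u :: "'a::euclidean_space \<Rightarrow> real"
  assumes s: "0 < s" "s < 1" and u: "has_frac_lap (s / 2) u w"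
  obtains w' where "has_frac_lap (s / 2) (\<lambda>x. \<bar>u x\<bar>) w'" "L2_norm w' \<le> L2_norm w"
proof -
  let ?m = "\<lambda>\<xi>::'a. complex_of_real (norm \<xi> powr (2 * (s / 2)))"
  have aL: "(\<lambda>x. \<bar>u x\<bar>) \<in> L2_space" using L2_space_norm[OF has_frac_lapD(1)[OF u]] by simp
  obtain g where g: "has_fourier (\<lambda>x. complex_of_real \<bar>u x\<bar>) g"
    using has_fourier_exists[OF L2_space_of_real[OF aL]] .
  have [measurable]: "g \<in> borel_measurable borel" using has_fourierD(2)[OF g] by (rule L2_space_measurable)
  have "gagliardo s (\<lambda>x. \<bar>u x\<bar>) \<le> gagliardo s u"
    unfolding gagliardo_def
    by (intro nn_integral_mono mult_left_mono ennreal_leI abs_le_square_iff[THEN iffD1]) auto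
  then have "frac_symbol s 1 * (\<integral>\<^sup>+\<xi>. ennreal ((norm (?m \<xi> * g \<xi>))\<^sup>2) \<partial>lborel) \<le> frac_symbol s 1 * ennreal ((L2_norm w)\<^sup>2)"
    unfolding frac_lap_gagliardo[OF s(1) g] gagliardo_eq_frac_lap[OF s(1) u] .
  then have le: "(\<integral>\<^sup>+\<xi>. ennreal ((norm (?m \<xi> * g \<xi>))\<^sup>2) \<partial>lborel) \<le> ennreal ((L2_norm w)\<^sup>2)"
    using frac_symbol_pos[of s] frac_symbol_finite[OF s] by (simp add: ennreal_mult_le_mult_iff)
  have hL: "(\<lambda>\<xi>. ?m \<xi> * g \<xi>) \<in> L2_space" and hn: "L2_norm (\<lambda>\<xi>. ?m \<xi> * g \<xi>) \<le> L2_norm w"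
    using L2_space_nn_bound[OF _ le] by auto
  obtain W where W: "has_fourier W (\<lambda>\<xi>. ?m \<xi> * g \<xi>)" using has_fourier_surj[OF hL] .
  have "has_fourier (\<lambda>x. complex_of_real \<bar>u x\<bar>) (\<lambda>\<xi>. cnj (g (- \<xi>)))"
    using has_fourier_cnj[OF g] by simp
  from has_fourier_unique[OF this g] have "AE \<xi> in lborel. cnj (g (- \<xi>)) = g \<xi>" by simp
  then have "AE \<xi> in lborel. cnj (?m (- \<xi>) * g (- \<xi>)) = ?m \<xi> * g \<xi>" by eventually_elim simp
  from has_fourier_injective[OF has_fourier_cnj[OF W] W this] have "AE x in lborel. cnj (W x) = W x" .
  then have WR: "AE x in lborel. complex_of_real (Re (W x)) = W x"
    by eventually_elim (metis Reals_cnj_iff of_real_Re)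
  note [measurable] = L2_space_measurable[OF has_fourierD(1)[OF W]]
  have W': "has_fourier (\<lambda>x. complex_of_real (Re (W x))) (\<lambda>\<xi>. ?m \<xi> * g \<xi>)"
    by (rule has_fourier_cong[OF W _ WR]) auto
  have "(\<lambda>x. Re (W x)) \<in> L2_space"
    by (rule L2_space_bound[OF has_fourierD(1)[OF W]]) (auto simp: abs_Re_le_cmod)
  then have "has_frac_lap (s / 2) (\<lambda>x. \<bar>u x\<bar>) (\<lambda>x. Re (W x))"
    unfolding has_frac_lap_def using aL g W' by auto
  moreover have "L2_norm (\<lambda>x. Re (W x)) \<le> L2_norm w"
    using has_fourier_isometry[OF W'] hn L2_norm_of_real[of "\<lambda>x. Re (W x)"] by simp
  ultimately show ?thesis by (rule that)
qed

lemma far_translates_orthogonal: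
  fixes u :: "'a::euclidean_space \<Rightarrow> real"
  assumes u: "u \<in> L2_space" and R: "AE x in lborel. R < norm x \<longrightarrow> u x = 0" and z: "2 * R < norm z"
  shows "(\<integral>\<^sup>+x. ennreal ((u (x + z) - u x)\<^sup>2) \<partial>lborel) = ennreal (2 * (L2_norm u)\<^sup>2)"
proof -
  have "AE x in lborel. R < norm (z + 1 *\<^sub>R x) \<longrightarrow> u (z + 1 *\<^sub>R x) = 0"
    by (rule AE_lborel_affine[OF R]) simp
  with R have "AE x in lborel. u (x + z) \<bullet> u x = 0"
  proof eventually_elim
    case (elim x)
    have "norm z \<le> norm (z + x) + norm x" using norm_triangle_ineq4[of "z + x" x] by simp
    then have "R < norm x \<or> R < norm (z + x)" using z by linarith
    then show ?case using elim by (auto simp: add.commute)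
  qed
  then have "L2_inner (\<lambda>x. u (x + z)) u = 0"
    unfolding L2_inner_def by (rule integral_eq_zero_AE)
  then have "(L2_norm (\<lambda>x. u (x + z) - u x))\<^sup>2 = 2 * (L2_norm u)\<^sup>2"
    using L2_norm_diff_sq[OF L2_space_shift[OF u] u, of z] L2_norm_shift[OF u, of z] by simp
  then show ?thesis
    using L2_nn_norm[OF L2_space_diff[OF L2_space_shift[OF u] u], of z] by simp
qed

text \<open>If \<open>u\<close> vanishes outside a ball of radius \<open>R\<close>, then for \<open>norm z > 2 * R\<close> the functions \<open>u\<close> and \<open>u (\<cdot> + z)\<close> are orthogonal and
  their squared distance is twice the squared norm of \<open>u\<close>. The Gagliardo energy gives such \<open>z\<close> a positive total
  weight \<open>A\<close>.\<close>

theorem frac_Poincare: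
  fixes s R :: real
  assumes s: "0 < s" "s < 1"
  obtains K where "0 \<le> K" "\<And>(u :: 'a::euclidean_space \<Rightarrow> real) w. has_frac_lap (s / 2) u w \<Longrightarrow>
    AE x in lborel. R < norm x \<longrightarrow> u x = 0 \<Longrightarrow> L2_norm u \<le> K * L2_norm w"
proof -
  let ?U = "\<lambda>r. {y::'a. 2 * R < norm (r *\<^sub>R y)}"
  define A where "A = (\<integral>\<^sup>+r. frac_weight s r *
     (\<integral>\<^sup>+y. ennreal (gauss y) * indicator (?U r) y \<partial>lborel) \<partial>lborel)"
  have A0: "A \<noteq> 0"
  proof
    assume "A = 0"
    then have "AE r in lborel. frac_weight s r *
        (\<integral>\<^sup>+y. ennreal (gauss y) * indicator (?U r) y \<partial>lborel) = 0"
      unfolding A_def by (subst (asm) nn_integral_0_iff_AE) auto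
    then have "AE r in lborel. r \<notin> {1<..<2::real}"
    proof eventually_elim
      case (elim r)
      show ?case
      proof
        assume r: "r \<in> {1<..<2}"
        then have "frac_weight s r \<noteq> 0" by (simp add: frac_weight_def ennreal_eq_0_iff)
        then have "(\<integral>\<^sup>+y. ennreal (gauss y) * indicator (?U r) y \<partial>lborel) = 0"
          using elim by simp
        then have "AE y in lborel. ennreal (gauss y) * indicator (?U r) y = 0"
          by (subst (asm) nn_integral_0_iff_AE) auto
        then have ae: "AE y in lborel. y \<notin> (?U r)"
        proof eventually_elim
          case (elim y)
          then show ?case using gauss_pos[of y] by (auto simp: indicator_def ennreal_eq_0_iff split: if_splits)
        qed
        have op: "open (?U r)" by (intro open_Collect_less continuous_intros)
        obtain b :: 'a where b: "b \<in> Basis" using nonempty_Basis by blast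
        have "2 * R < 1 * (2 * \<bar>R\<bar> + 1)" using abs_ge_self[of R] by simp
        also have "\<dots> < r * (2 * \<bar>R\<bar> + 1)" using r by (intro mult_strict_right_mono) auto
        finally have "norm (r *\<^sub>R ((2 * \<bar>R\<bar> + 1) *\<^sub>R b)) > 2 * R"
          using r b by simp
        then have "(?U r) \<noteq> {}" by blast
        with ae op show False using open_not_AE_avoided by blast
      qed
    qed
    then show False using open_not_AE_avoided[of "{1<..<2::real}"] by simp
  qed
  \<comment> \<open>A positive real lower bound for the extended number \<open>A\<close>.\<close>
  define c where "c = enn2real (min A 1)"
  have cA: "ennreal c \<le> A" "c > 0"
  proof -
    have fin: "min A 1 < top" by (rule le_less_trans[OF min.cobounded2]) simp
    then have "ennreal c = min A 1" unfolding c_def by simp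
    then show "ennreal c \<le> A" by simp
    show "c > 0" unfolding c_def using fin A0 by (simp add: enn2real_positive_iff zero_less_iff_neq_zero)
  qed
  define S where "S = enn2real (frac_symbol s 1)"
  have S: "frac_symbol s 1 = ennreal S" "S \<ge> 0" unfolding S_def using frac_symbol_finite[OF s] by auto
  show ?thesis
  proof (rule that[of "sqrt (S / (2 * c))"])
    show "0 \<le> sqrt (S / (2 * c))" using S cA by simp
    fix u w :: "'a \<Rightarrow> real"
    assume f: "has_frac_lap (s / 2) u w" and ae: "AE x in lborel. R < norm x \<longrightarrow> u x = 0"
    note uL = has_frac_lapD(1)[OF f]
    have J: "(\<integral>\<^sup>+y. ennreal (gauss y) * (indicator (?U r) y * ennreal (2 * (L2_norm u)\<^sup>2)) \<partial>lborel)
        = (\<integral>\<^sup>+y. ennreal (gauss y) * indicator (?U r) y \<partial>lborel) * ennreal (2 * (L2_norm u)\<^sup>2)" for r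
      unfolding mult.assoc[symmetric] by (rule nn_integral_multc) measurable
    have "A * ennreal (2 * (L2_norm u)\<^sup>2) = (\<integral>\<^sup>+r. frac_weight s r *
        (\<integral>\<^sup>+y. ennreal (gauss y) * (indicator (?U r) y * ennreal (2 * (L2_norm u)\<^sup>2)) \<partial>lborel) \<partial>lborel)"
      unfolding A_def J
      by (subst nn_integral_multc[symmetric]) (measurable, simp only: mult.assoc)
    also have "\<dots> \<le> gagliardo s u"
      unfolding gagliardo_def
    proof (intro nn_integral_mono mult_left_mono)
      fix r :: real and y :: 'a
      show "indicator (?U r) y * ennreal (2 * (L2_norm u)\<^sup>2)
          \<le> (\<integral>\<^sup>+x. ennreal ((u (x + r *\<^sub>R y) - u x)\<^sup>2) \<partial>lborel)"
        using far_translates_orthogonal[OF uL ae, of "r *\<^sub>R y"] by (auto simp: indicator_def)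
    qed auto
    also have "\<dots> = ennreal (S * (L2_norm w)\<^sup>2)"
      using gagliardo_eq_frac_lap[OF s(1) f] S by (simp add: ennreal_mult)
    finally have "ennreal c * ennreal (2 * (L2_norm u)\<^sup>2) \<le> ennreal (S * (L2_norm w)\<^sup>2)"
      using mult_right_mono[OF cA(1), of "ennreal (2 * (L2_norm u)\<^sup>2)"] by (meson order_trans zero_le)
    then have "c * (2 * (L2_norm u)\<^sup>2) \<le> S * (L2_norm w)\<^sup>2"
      using cA(2) S(2) by (simp add: ennreal_mult[symmetric])
    then have "(L2_norm u)\<^sup>2 \<le> (S / (2 * c)) * (L2_norm w)\<^sup>2"
      using cA(2) by (simp add: field_simps)
    also have "\<dots> = (sqrt (S / (2 * c)) * L2_norm w)\<^sup>2"
      using S(2) cA(2) by (simp add: power_mult_distrib)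
    finally show "L2_norm u \<le> sqrt (S / (2 * c)) * L2_norm w"
      using S(2) cA(2) by (intro power2_le_imp_le[of "L2_norm u"]) auto
  qed
qed

section \<open>The energy form on the fractional Sobolev space\<close>

lemma Hs_space_has_frac_lap:
  assumes "u \<in> Hs_space s"
  shows "has_frac_lap (s / 2) u (frac_lap (s / 2) u)"
  using assms unfolding Hs_space_def frac_lap_def by (auto intro: someI[of "has_frac_lap (s / 2) u"])

lemma Hs_spaceI: "has_frac_lap (s / 2) u w \<Longrightarrow> u \<in> Hs_space s"
  unfolding Hs_space_def by (auto dest: has_frac_lapD)

lemma Hs_space_L2: "u \<in> Hs_space s \<Longrightarrow> u \<in> L2_space"
  by (simp add: Hs_space_def)

lemma Hs_space_add: "u \<in> Hs_space s \<Longrightarrow> v \<in> Hs_space s \<Longrightarrow> (\<lambda>x. u x + v x) \<in> Hs_space s"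
  by (rule Hs_spaceI[OF has_frac_lap_add[OF Hs_space_has_frac_lap Hs_space_has_frac_lap]])

lemma Hs_space_diff: "u \<in> Hs_space s \<Longrightarrow> v \<in> Hs_space s \<Longrightarrow> (\<lambda>x. u x - v x) \<in> Hs_space s"
  by (rule Hs_spaceI[OF has_frac_lap_diff[OF Hs_space_has_frac_lap Hs_space_has_frac_lap]])

lemma Hs_space_cmult: "u \<in> Hs_space s \<Longrightarrow> (\<lambda>x. c * u x) \<in> Hs_space s"
  by (rule Hs_spaceI[OF has_frac_lap_cmult[OF Hs_space_has_frac_lap]])

text \<open>The fractional Laplacian is an arbitrary representative, so its linearity holds only almost everywhere; the
  energy form and the norm do not see the difference, which makes them genuinely bilinear and
  homogeneous.\<close>

lemma frac_lap_AE_eq: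
  assumes "has_frac_lap (s / 2) u w"
  shows "AE x in lborel. frac_lap (s / 2) u x = w x"
  by (rule has_frac_lap_unique[OF Hs_space_has_frac_lap[OF Hs_spaceI[OF assms]] assms]) simp

lemma frac_lap_dual_eq_L2_inner:
  assumes "has_frac_lap (s / 2) u w" "has_frac_lap (s / 2) v z"
  shows "frac_lap_dual s u v = L2_inner w z"
proof -
  have "L2_inner (frac_lap (s / 2) u) (frac_lap (s / 2) v) = L2_inner w z"
    using assms[THEN Hs_spaceI, THEN Hs_space_has_frac_lap, THEN has_frac_lapD(2)]
      assms[THEN has_frac_lapD(2)] assms[THEN frac_lap_AE_eq]
    by (intro L2_inner_cong_AE L2_space_measurable)
  then show ?thesis by (simp add: frac_lap_dual_def L2_inner_def)
qed

lemma Ht_norm_eq_L2_norm: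
  assumes "has_frac_lap (s / 2) u w"
  shows "Ht_norm s u = L2_norm w"
  unfolding Ht_norm_def
  using Hs_space_has_frac_lap[OF Hs_spaceI[OF assms], THEN has_frac_lapD(2)]
      assms[THEN has_frac_lapD(2)] assms[THEN frac_lap_AE_eq]
  by (intro L2_norm_cong_AE L2_space_measurable)

lemma Ht_norm_nonneg [simp]: "0 \<le> Ht_norm s u"
  by (simp add: Ht_norm_def)

lemma frac_lap_dual_self: "frac_lap_dual s u u = (Ht_norm s u)\<^sup>2"
  unfolding frac_lap_dual_def Ht_norm_def L2_norm_sq by (simp add: power2_eq_square)

lemma frac_lap_dual_commute: "frac_lap_dual s u v = frac_lap_dual s v u"
  by (simp add: frac_lap_dual_def mult.commute)

lemma frac_lap_dual_L2_inner: "frac_lap_dual s u v = L2_inner (frac_lap (s / 2) u) (frac_lap (s / 2) v)"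
  by (simp add: frac_lap_dual_def L2_inner_def)

lemma frac_lap_dual_add:
  assumes "u \<in> Hs_space s" "v \<in> Hs_space s" "w \<in> Hs_space s"
  shows "frac_lap_dual s (\<lambda>x. u x + v x) w = frac_lap_dual s u w + frac_lap_dual s v w"
  unfolding frac_lap_dual_eq_L2_inner[OF has_frac_lap_add[OF assms(1,2)[THEN Hs_space_has_frac_lap]] assms(3)[THEN Hs_space_has_frac_lap]]
  unfolding frac_lap_dual_L2_inner
  by (intro L2_inner_add assms[THEN Hs_space_has_frac_lap, THEN has_frac_lapD(2)])

lemma frac_lap_dual_diff:
  assumes "u \<in> Hs_space s" "v \<in> Hs_space s" "w \<in> Hs_space s"
  shows "frac_lap_dual s (\<lambda>x. u x - v x) w = frac_lap_dual s u w - frac_lap_dual s v w"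
  unfolding frac_lap_dual_eq_L2_inner[OF has_frac_lap_diff[OF assms(1,2)[THEN Hs_space_has_frac_lap]] assms(3)[THEN Hs_space_has_frac_lap]]
  unfolding frac_lap_dual_L2_inner
  by (intro L2_inner_diff assms[THEN Hs_space_has_frac_lap, THEN has_frac_lapD(2)])

lemma frac_lap_dual_cmult:
  assumes "u \<in> Hs_space s" "w \<in> Hs_space s"
  shows "frac_lap_dual s (\<lambda>x. c * u x) w = c * frac_lap_dual s u w"
  unfolding frac_lap_dual_eq_L2_inner[OF has_frac_lap_cmult[OF assms(1)[THEN Hs_space_has_frac_lap]] assms(2)[THEN Hs_space_has_frac_lap]]
  unfolding frac_lap_dual_L2_inner
  using L2_inner_scaleR[of c "frac_lap (s / 2) u"] by simp

lemma frac_lap_dual_add_right: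
  assumes "w \<in> Hs_space s" "u \<in> Hs_space s" "v \<in> Hs_space s"
  shows "frac_lap_dual s w (\<lambda>x. u x + v x) = frac_lap_dual s w u + frac_lap_dual s w v"
  using frac_lap_dual_add[OF assms(2,3,1)] by (simp add: frac_lap_dual_commute[of s w])

lemma frac_lap_dual_diff_right:
  assumes "w \<in> Hs_space s" "u \<in> Hs_space s" "v \<in> Hs_space s"
  shows "frac_lap_dual s w (\<lambda>x. u x - v x) = frac_lap_dual s w u - frac_lap_dual s w v"
  using frac_lap_dual_diff[OF assms(2,3,1)] by (simp add: frac_lap_dual_commute[of s w])

lemma frac_lap_dual_cmult_right:
  assumes "w \<in> Hs_space s" "u \<in> Hs_space s"
  shows "frac_lap_dual s w (\<lambda>x. c * u x) = c * frac_lap_dual s w u"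
  using frac_lap_dual_cmult[OF assms(2,1)] by (simp add: frac_lap_dual_commute[of s w])

lemmas frac_lap_dual_linear =
  frac_lap_dual_add frac_lap_dual_diff frac_lap_dual_cmult
  frac_lap_dual_add_right frac_lap_dual_diff_right frac_lap_dual_cmult_right

lemma frac_lap_dual_Cauchy_Schwarz:
  assumes "u \<in> Hs_space s" "v \<in> Hs_space s"
  shows "\<bar>frac_lap_dual s u v\<bar> \<le> Ht_norm s u * Ht_norm s v"
  unfolding frac_lap_dual_L2_inner Ht_norm_def
  by (intro L2_Cauchy_Schwarz assms[THEN Hs_space_has_frac_lap, THEN has_frac_lapD(2)])

lemma Ht_norm_add:
  assumes "u \<in> Hs_space s" "v \<in> Hs_space s"
  shows "Ht_norm s (\<lambda>x. u x + v x) \<le> Ht_norm s u + Ht_norm s v"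
  unfolding Ht_norm_eq_L2_norm[OF has_frac_lap_add[OF assms[THEN Hs_space_has_frac_lap]]] Ht_norm_def[of s u] Ht_norm_def[of s v]
  by (intro L2_triangle assms[THEN Hs_space_has_frac_lap, THEN has_frac_lapD(2)])

lemma Ht_norm_cmult:
  assumes "u \<in> Hs_space s"
  shows "Ht_norm s (\<lambda>x. c * u x) = \<bar>c\<bar> * Ht_norm s u"
  unfolding Ht_norm_eq_L2_norm[OF has_frac_lap_cmult[OF assms[THEN Hs_space_has_frac_lap]]]
  unfolding Ht_norm_def
  using L2_norm_scaleR[of c "frac_lap (s / 2) u"] by simp

lemma Ht_norm_diff:
  assumes "u \<in> Hs_space s" "v \<in> Hs_space s"
  shows "Ht_norm s (\<lambda>x. u x - v x) \<le> Ht_norm s u + Ht_norm s v"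
  using Ht_norm_add[OF assms(1) Hs_space_cmult[OF assms(2), of "-1"]] Ht_norm_cmult[OF assms(2), of "-1"] by simp

lemma Ht_norm_minus_commute:
  assumes "u \<in> Hs_space s" "v \<in> Hs_space s"
  shows "Ht_norm s (\<lambda>x. u x - v x) = Ht_norm s (\<lambda>x. v x - u x)"
  using Ht_norm_cmult[OF Hs_space_diff[OF assms], of "-1"] by simp

lemma Hs_space_abs:
  fixes u :: "'a::euclidean_space \<Rightarrow> real"
  assumes s: "0 < s" "s < 1" and u: "u \<in> Hs_space s"
  shows "(\<lambda>x. \<bar>u x\<bar>) \<in> Hs_space s" "Ht_norm s (\<lambda>x. \<bar>u x\<bar>) \<le> Ht_norm s u"
proof -
  obtain w where w: "has_frac_lap (s / 2) (\<lambda>x. \<bar>u x\<bar>) w" "L2_norm w \<le> L2_norm (frac_lap (s / 2) u)"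
    using has_frac_lap_abs[OF s Hs_space_has_frac_lap[OF u]] .
  show "(\<lambda>x. \<bar>u x\<bar>) \<in> Hs_space s" by (rule Hs_spaceI[OF w(1)])
  show "Ht_norm s (\<lambda>x. \<bar>u x\<bar>) \<le> Ht_norm s u"
    unfolding Ht_norm_eq_L2_norm[OF w(1)] unfolding Ht_norm_def by (rule w(2))
qed

lemma max_0_eq: "max a 0 = (1 / 2) * (\<bar>a\<bar> + (a::real))"
  by simp

text \<open>
  With \<open>u\<^sup>+ = (\<bar>u\<bar> + u) / 2\<close> the right side minus the left side of the middle claim is a quarter of the
  difference between the energies of \<open>u\<close> and of \<open>\<bar>u\<bar>\<close>. Equivalently the positive and the negative part of \<open>u\<close> have nonpositive mutual
  energy.
\<close>

lemma
  fixes u :: "'a::euclidean_space \<Rightarrow> real"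
  assumes s: "0 < s" "s < 1" and u: "u \<in> Hs_space s"
  shows Hs_space_pos_part: "(\<lambda>x. max (u x) 0) \<in> Hs_space s"
    and frac_lap_dual_pos_part: "(Ht_norm s (\<lambda>x. max (u x) 0))\<^sup>2 \<le> frac_lap_dual s u (\<lambda>x. max (u x) 0)"
    and Ht_norm_pos_part: "Ht_norm s (\<lambda>x. max (u x) 0) \<le> Ht_norm s u"
proof -
  note au = Hs_space_abs[OF s u]
  note sum = Hs_space_add[OF au(1) u]
  show p: "(\<lambda>x. max (u x) 0) \<in> Hs_space s"
    unfolding max_0_eq by (intro Hs_space_cmult sum)
  have sq: "(Ht_norm s (\<lambda>x. \<bar>u x\<bar>))\<^sup>2 \<le> (Ht_norm s u)\<^sup>2"
    by (intro power_mono au) simp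
  show le: "(Ht_norm s (\<lambda>x. max (u x) 0))\<^sup>2 \<le> frac_lap_dual s u (\<lambda>x. max (u x) 0)"
    unfolding frac_lap_dual_self[symmetric] max_0_eq
    using sq frac_lap_dual_commute[of s u "\<lambda>x. \<bar>u x\<bar>"]
    by (simp only: frac_lap_dual_linear sum au u Hs_space_cmult frac_lap_dual_self[symmetric]) argo
  show "Ht_norm s (\<lambda>x. max (u x) 0) \<le> Ht_norm s u"
  proof (cases "Ht_norm s (\<lambda>x. max (u x) 0) = 0")
    case False
    then have pos: "0 < Ht_norm s (\<lambda>x. max (u x) 0)" by (simp add: less_le)
    have "Ht_norm s (\<lambda>x. max (u x) 0) * Ht_norm s (\<lambda>x. max (u x) 0) \<le> Ht_norm s u * Ht_norm s (\<lambda>x. max (u x) 0)"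
      using le frac_lap_dual_Cauchy_Schwarz[OF u p] by (simp add: power2_eq_square)
    then show ?thesis using pos by simp
  qed simp
qed

lemma frac_lap_dual_weakly_null:
  fixes v :: "nat \<Rightarrow> 'a::euclidean_space \<Rightarrow> real"
  assumes s: "0 < s" and u: "u \<in> Hs_space s" and v: "\<And>k. v k \<in> Hs_space s"
    and lim: "(\<lambda>k. L2_norm (v k)) \<longlonglongrightarrow> 0" and B: "\<And>k. Ht_norm s (v k) \<le> B"
  shows "(\<lambda>k. frac_lap_dual s u (v k)) \<longlonglongrightarrow> 0"
  unfolding frac_lap_dual_L2_inner
  by (rule has_frac_lap_weakly_null[of "s / 2" _ v _ B])
     (use s u v lim B Hs_space_has_frac_lap has_frac_lapD(2)[OF Hs_space_has_frac_lap] in \<open>auto simp: Ht_norm_def\<close>)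

text \<open>Continuity of the positive part at a nonpositive function \<open>g0\<close>. The squared norm of the positive part of \<open>g k\<close> is at most its
  energy product with \<open>g k\<close>. Replacing \<open>g k\<close> by \<open>g0\<close> there costs a null sequence, and the positive parts are
  bounded and dominated by \<open>g k - g0\<close>, so they converge weakly to 0.\<close>

lemma Ht_norm_pos_part_tendsto_0:
  fixes g :: "nat \<Rightarrow> 'a::euclidean_space \<Rightarrow> real"
  assumes s: "0 < s" "s < 1" and g: "\<And>k. g k \<in> Hs_space s" and g0: "g0 \<in> Hs_space s" and neg: "\<And>x. g0 x \<le> 0"
    and l2: "(\<lambda>k. L2_norm (\<lambda>x. g k x - g0 x)) \<longlonglongrightarrow> 0"
    and ht: "(\<lambda>k. Ht_norm s (\<lambda>x. g k x - g0 x)) \<longlonglongrightarrow> 0"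
  shows "(\<lambda>k. Ht_norm s (\<lambda>x. max (g k x) 0)) \<longlonglongrightarrow> 0"
proof -
  let ?p = "\<lambda>k x. max (g k x) 0"
  have p: "?p k \<in> Hs_space s" for k by (rule Hs_space_pos_part[OF s g])
  obtain C where C: "\<And>k. Ht_norm s (\<lambda>x. g k x - g0 x) \<le> C"
    using convergent_imp_Bseq[OF convergentI[OF ht]] by (auto simp: Bseq_def)
  have B: "Ht_norm s (?p k) \<le> C + Ht_norm s g0" for k
    using Ht_norm_pos_part[OF s g, of k] Ht_norm_add[OF Hs_space_diff[OF g g0] g0, of k] C[of k] by simp
  have "(\<lambda>k. L2_norm (?p k)) \<longlonglongrightarrow> 0"
  proof (rule Lim_null_comparison[OF _ l2])
    have "L2_norm (?p k) \<le> L2_norm (\<lambda>x. g k x - g0 x)" for k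
    proof (rule L2_norm_mono)
      show "AE x in lborel. norm (?p k x) \<le> norm (g k x - g0 x)"
      proof (rule AE_I2)
        fix x show "norm (?p k x) \<le> norm (g k x - g0 x)" using neg[of x] by auto
      qed
    qed (use p g g0 in \<open>auto intro: L2_space_diff Hs_space_L2 L2_space_measurable\<close>)
    then show "\<forall>\<^sub>F k in sequentially. norm (L2_norm (?p k)) \<le> L2_norm (\<lambda>x. g k x - g0 x)" by simp
  qed
  then have w: "(\<lambda>k. frac_lap_dual s g0 (?p k)) \<longlonglongrightarrow> 0"
    by (rule frac_lap_dual_weakly_null[OF s(1) g0 p _ B])
  have "(Ht_norm s (?p k))\<^sup>2 \<le> Ht_norm s (\<lambda>x. g k x - g0 x) * (C + Ht_norm s g0) + frac_lap_dual s g0 (?p k)" for k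
  proof -
    have "(Ht_norm s (?p k))\<^sup>2 \<le> frac_lap_dual s (g k) (?p k)"
      by (rule frac_lap_dual_pos_part[OF s g])
    also have "\<dots> = frac_lap_dual s (\<lambda>x. g k x - g0 x) (?p k) + frac_lap_dual s g0 (?p k)"
      using frac_lap_dual_diff[OF g g0 p, of k k] by simp
    also have "frac_lap_dual s (\<lambda>x. g k x - g0 x) (?p k) \<le> Ht_norm s (\<lambda>x. g k x - g0 x) * Ht_norm s (?p k)"
      using frac_lap_dual_Cauchy_Schwarz[OF Hs_space_diff[OF g g0] p, of k k] by linarith
    also have "\<dots> \<le> Ht_norm s (\<lambda>x. g k x - g0 x) * (C + Ht_norm s g0)"
      by (intro mult_left_mono B) simp
    finally show ?thesis by simp
  qed
  moreover have "(\<lambda>k. Ht_norm s (\<lambda>x. g k x - g0 x) * (C + Ht_norm s g0) + frac_lap_dual s g0 (?p k)) \<longlonglongrightarrow> 0"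
    using tendsto_add[OF tendsto_mult_left_zero[OF ht, of "C + Ht_norm s g0"] w] by simp
  ultimately have "(\<lambda>k. (Ht_norm s (?p k))\<^sup>2) \<longlonglongrightarrow> 0"
    by (intro Lim_null_comparison[of "\<lambda>k. (Ht_norm s (?p k))\<^sup>2"]) auto
  then have "(\<lambda>k. sqrt ((Ht_norm s (?p k))\<^sup>2)) \<longlonglongrightarrow> sqrt 0" by (rule tendsto_real_sqrt)
  then show ?thesis by simp
qed

section \<open>Functions vanishing outside a bounded domain, and their dual\<close>

lemma Ht_spaceD:
  assumes "u \<in> Ht_space s \<Omega>"
  shows "u \<in> Hs_space s" "AE x in lborel. x \<notin> closure \<Omega> \<longrightarrow> u x = 0"
  using assms by (auto simp: Ht_space_def)

lemma Ht_space_add: "u \<in> Ht_space s \<Omega> \<Longrightarrow> v \<in> Ht_space s \<Omega> \<Longrightarrow> (\<lambda>x. u x + v x) \<in> Ht_space s \<Omega>"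
  unfolding Ht_space_def by (auto intro: Hs_space_add)

lemma Ht_space_diff: "u \<in> Ht_space s \<Omega> \<Longrightarrow> v \<in> Ht_space s \<Omega> \<Longrightarrow> (\<lambda>x. u x - v x) \<in> Ht_space s \<Omega>"
  unfolding Ht_space_def by (auto intro: Hs_space_diff)

lemma Ht_space_cmult: "u \<in> Ht_space s \<Omega> \<Longrightarrow> (\<lambda>x. c * u x) \<in> Ht_space s \<Omega>"
  unfolding Ht_space_def by (auto intro: Hs_space_cmult)

lemma Ht_Poincare:
  fixes \<Omega> :: "'a::euclidean_space set"
  assumes s: "0 < s" "s < 1" and \<Omega>: "bounded \<Omega>"
  obtains K where "0 \<le> K" "\<And>u. u \<in> Ht_space s \<Omega> \<Longrightarrow> L2_norm u \<le> K * Ht_norm s u"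
proof -
  obtain R where R: "\<And>x. x \<in> closure \<Omega> \<Longrightarrow> norm x \<le> R"
    using bounded_closure[OF \<Omega>] by (auto simp: bounded_iff)
  obtain K where K: "0 \<le> K" "\<And>(u :: 'a \<Rightarrow> real) w. has_frac_lap (s / 2) u w \<Longrightarrow>
    AE x in lborel. R < norm x \<longrightarrow> u x = 0 \<Longrightarrow> L2_norm u \<le> K * L2_norm w"
    using frac_Poincare[OF s] by blast
  show ?thesis
  proof (rule that[OF K(1)])
    fix u assume u: "u \<in> Ht_space s \<Omega>"
    have "AE x in lborel. R < norm x \<longrightarrow> u x = 0"
      using Ht_spaceD(2)[OF u]
    proof eventually_elim
      case (elim x)
      then show ?case using R[of x] by auto
    qed
    then show "L2_norm u \<le> K * Ht_norm s u"
      unfolding Ht_norm_def by (rule K(2)[OF Hs_space_has_frac_lap[OF Ht_spaceD(1)[OF u]]])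
  qed
qed

lemma Ht_tendsto_L2:
  fixes \<Omega> :: "'a::euclidean_space set"
  assumes s: "0 < s" "s < 1" and \<Omega>: "bounded \<Omega>"
    and v: "\<And>k. v k \<in> Ht_space s \<Omega>" "u \<in> Ht_space s \<Omega>"
    and lim: "(\<lambda>k::nat. Ht_norm s (\<lambda>x. v k x - u x)) \<longlonglongrightarrow> 0"
  shows "(\<lambda>k. L2_norm (\<lambda>x. v k x - u x)) \<longlonglongrightarrow> 0"
proof -
  obtain K where K: "0 \<le> K" "\<And>u. u \<in> Ht_space s \<Omega> \<Longrightarrow> L2_norm u \<le> K * Ht_norm s u"
    using Ht_Poincare[OF s \<Omega>] by blast
  show ?thesis
  proof (rule Lim_null_comparison)
    show "\<forall>\<^sub>F k in sequentially. norm (L2_norm (\<lambda>x. v k x - u x)) \<le> K * Ht_norm s (\<lambda>x. v k x - u x)"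
      using K(2)[OF Ht_space_diff[OF v]] by simp
    show "(\<lambda>k. K * Ht_norm s (\<lambda>x. v k x - u x)) \<longlonglongrightarrow> 0" using lim by (rule tendsto_mult_right_zero)
  qed
qed

text \<open>By the Poincare inequality the functions themselves and their fractional Laplacians are both Cauchy sequences in the
  mean, and the operator is closed. An almost everywhere convergent subsequence keeps the limit zero
  outside the domain.\<close>

lemma Ht_complete:
  fixes \<Omega> :: "'a::euclidean_space set"
  assumes s: "0 < s" "s < 1" and \<Omega>: "bounded \<Omega>" and v: "\<And>k. v k \<in> Ht_space s \<Omega>"
    and cauchy: "\<And>e. e > 0 \<Longrightarrow> \<exists>N. \<forall>m\<ge>N. \<forall>n\<ge>N. Ht_norm s (\<lambda>x. v m x - v n x) < e"
  shows "\<exists>u\<in>Ht_space s \<Omega>. (\<lambda>k::nat. Ht_norm s (\<lambda>x. v k x - u x)) \<longlonglongrightarrow> 0"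
proof -
  obtain K where K: "0 \<le> K" "\<And>u. u \<in> Ht_space s \<Omega> \<Longrightarrow> L2_norm u \<le> K * Ht_norm s u"
    using Ht_Poincare[OF s \<Omega>] by blast
  note vH = v[THEN Ht_spaceD(1)]
  note vf = vH[THEN Hs_space_has_frac_lap]
  have "\<exists>u\<in>L2_space. (\<lambda>k. L2_norm (\<lambda>x. v k x - u x)) \<longlonglongrightarrow> 0"
  proof (rule L2_complete[OF Hs_space_L2[OF vH]])
    fix e :: real assume e: "e > 0"
    then obtain N where N: "\<And>m n. m \<ge> N \<Longrightarrow> n \<ge> N \<Longrightarrow> Ht_norm s (\<lambda>x. v m x - v n x) < e / (K + 1)"
      using cauchy[of "e / (K + 1)"] K(1) by auto
    have "L2_norm (\<lambda>x. v m x - v n x) < e" if "m \<ge> N" "n \<ge> N" for m n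
    proof -
      have "L2_norm (\<lambda>x. v m x - v n x) \<le> K * Ht_norm s (\<lambda>x. v m x - v n x)"
        by (rule K(2)[OF Ht_space_diff[OF v v]])
      also have "\<dots> \<le> K * (e / (K + 1))"
        by (intro mult_left_mono K(1) less_imp_le N that)
      also have "\<dots> < e" using K(1) e by (simp add: field_simps)
      finally show ?thesis .
    qed
    then show "\<exists>N. \<forall>m\<ge>N. \<forall>n\<ge>N. L2_norm (\<lambda>x. v m x - v n x) < e" by blast
  qed
  then obtain u where u: "u \<in> L2_space" "(\<lambda>k. L2_norm (\<lambda>x. v k x - u x)) \<longlonglongrightarrow> 0" by blast
  have eq: "Ht_norm s (\<lambda>x. v m x - v n x) = L2_norm (\<lambda>x. frac_lap (s / 2) (v m) x - frac_lap (s / 2) (v n) x)" for m n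
    by (rule Ht_norm_eq_L2_norm[OF has_frac_lap_diff[OF vf vf]])
  have "\<exists>w\<in>L2_space. (\<lambda>k. L2_norm (\<lambda>x. frac_lap (s / 2) (v k) x - w x)) \<longlonglongrightarrow> 0"
    by (rule L2_complete[OF has_frac_lapD(2)[OF vf]]) (use cauchy in \<open>simp add: eq\<close>)
  then obtain w where w: "w \<in> L2_space" "(\<lambda>k. L2_norm (\<lambda>x. frac_lap (s / 2) (v k) x - w x)) \<longlonglongrightarrow> 0" by blast
  have uw: "has_frac_lap (s / 2) u w" by (rule has_frac_lap_closed[OF vf u(1) w(1) u(2) w(2)])
  obtain r where r: "strict_mono (r::nat\<Rightarrow>nat)" "AE x in lborel. (\<lambda>n. v (r n) x) \<longlonglongrightarrow> u x"
    using L2_AE_subseq[OF Hs_space_L2[OF vH] u] by blast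
  have "AE x in lborel. \<forall>k. x \<notin> closure \<Omega> \<longrightarrow> v k x = 0"
    using v[THEN Ht_spaceD(2)] by (subst AE_all_countable) auto
  with r(2) have "AE x in lborel. x \<notin> closure \<Omega> \<longrightarrow> u x = 0"
  proof eventually_elim
    case (elim x)
    then show ?case using LIMSEQ_unique[OF elim(1)] by auto
  qed
  then have uV: "u \<in> Ht_space s \<Omega>" unfolding Ht_space_def using Hs_spaceI[OF uw] by auto
  have "Ht_norm s (\<lambda>x. v k x - u x) = L2_norm (\<lambda>x. frac_lap (s / 2) (v k) x - w x)" for k
    by (rule Ht_norm_eq_L2_norm[OF has_frac_lap_diff[OF vf uw]])
  then have "(\<lambda>k. Ht_norm s (\<lambda>x. v k x - u x)) \<longlonglongrightarrow> 0" using w(2) by (simp only:)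
  then show ?thesis using uV by blast
qed

lemma Ht_dualD:
  assumes "f \<in> Ht_dual s \<Omega>"
  shows "\<And>v w. v \<in> Ht_space s \<Omega> \<Longrightarrow> w \<in> Ht_space s \<Omega> \<Longrightarrow> f (\<lambda>x. v x + w x) = f v + f w"
    "\<And>c v. v \<in> Ht_space s \<Omega> \<Longrightarrow> f (\<lambda>x. c * v x) = c * f v"
    "\<And>v w. v \<in> Ht_space s \<Omega> \<Longrightarrow> w \<in> Ht_space s \<Omega> \<Longrightarrow> f (\<lambda>x. v x - w x) = f v - f w"
proof -
  show 1: "f (\<lambda>x. v x + w x) = f v + f w" if "v \<in> Ht_space s \<Omega>" "w \<in> Ht_space s \<Omega>" for v w
    using assms that by (auto simp: Ht_dual_def)
  show 2: "f (\<lambda>x. c * v x) = c * f v" if "v \<in> Ht_space s \<Omega>" for c v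
    using assms that by (auto simp: Ht_dual_def)
  show "f (\<lambda>x. v x - w x) = f v - f w" if "v \<in> Ht_space s \<Omega>" "w \<in> Ht_space s \<Omega>" for v w
    using 1[OF that(1) Ht_space_cmult[OF that(2), of "-1"]] 2[OF that(2), of "-1"] by simp
qed

lemma Ht_dual_bound:
  assumes "f \<in> Ht_dual s \<Omega>"
  obtains C where "0 \<le> C" "\<And>v. v \<in> Ht_space s \<Omega> \<Longrightarrow> \<bar>f v\<bar> \<le> C * Ht_norm s v"
proof -
  obtain C where C: "\<And>v. v \<in> Ht_space s \<Omega> \<Longrightarrow> \<bar>f v\<bar> \<le> C * Ht_norm s v"
    using assms unfolding Ht_dual_def by blast
  show ?thesis
  proof (rule that[of "max C 0"])
    fix v assume "v \<in> Ht_space s \<Omega>"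
    from C[OF this] show "\<bar>f v\<bar> \<le> max C 0 * Ht_norm s v"
      by (rule order_trans) (intro mult_right_mono, auto)
  qed simp
qed

lemma Ht_dual_diff:
  assumes "f \<in> Ht_dual s \<Omega>" "g \<in> Ht_dual s \<Omega>"
  shows "(\<lambda>v. f v - g v) \<in> Ht_dual s \<Omega>"
proof -
  obtain C where C: "\<And>v. v \<in> Ht_space s \<Omega> \<Longrightarrow> \<bar>f v\<bar> \<le> C * Ht_norm s v"
    using Ht_dual_bound[OF assms(1)] by blast
  obtain D where D: "\<And>v. v \<in> Ht_space s \<Omega> \<Longrightarrow> \<bar>g v\<bar> \<le> D * Ht_norm s v"
    using Ht_dual_bound[OF assms(2)] by blast
  have "\<bar>f v - g v\<bar> \<le> (C + D) * Ht_norm s v" if "v \<in> Ht_space s \<Omega>" for v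
    using C[OF that] D[OF that] by (simp add: distrib_right)
  moreover have "f (\<lambda>x. v x + w x) - g (\<lambda>x. v x + w x) = (f v - g v) + (f w - g w)"
    if "v \<in> Ht_space s \<Omega>" "w \<in> Ht_space s \<Omega>" for v w
    using Ht_dualD(1)[OF assms(1) that] Ht_dualD(1)[OF assms(2) that] by simp
  moreover have "f (\<lambda>x. c * v x) - g (\<lambda>x. c * v x) = c * (f v - g v)" if "v \<in> Ht_space s \<Omega>" for c v
    using Ht_dualD(2)[OF assms(1) that] Ht_dualD(2)[OF assms(2) that] by (simp add: right_diff_distrib)
  ultimately show ?thesis unfolding Ht_dual_def by blast
qed

lemma Ht_dual_norm_bound:
  assumes f: "f \<in> Ht_dual s \<Omega>" and v: "v \<in> Ht_space s \<Omega>"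
  shows "\<bar>f v\<bar> \<le> Ht_dual_norm s \<Omega> f * Ht_norm s v"
proof -
  obtain C where C: "0 \<le> C" "\<And>v. v \<in> Ht_space s \<Omega> \<Longrightarrow> \<bar>f v\<bar> \<le> C * Ht_norm s v"
    using Ht_dual_bound[OF f] by blast
  show ?thesis
  proof (cases "Ht_norm s v = 0")
    case True
    then show ?thesis using C(2)[OF v] by simp
  next
    case False
    then have pos: "0 < Ht_norm s v" by (simp add: less_le)
    let ?w = "\<lambda>x. (1 / Ht_norm s v) * v x"
    have w: "?w \<in> Ht_space s \<Omega>" by (rule Ht_space_cmult[OF v])
    have wn: "Ht_norm s ?w = 1" unfolding Ht_norm_cmult[OF Ht_spaceD(1)[OF v]] using pos by simp
    have "bdd_above ((\<lambda>v. \<bar>f v\<bar>) ` {v \<in> Ht_space s \<Omega>. Ht_norm s v \<le> 1})"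
    proof (rule bdd_aboveI2)
      fix v assume "v \<in> {v \<in> Ht_space s \<Omega>. Ht_norm s v \<le> 1}"
      then show "\<bar>f v\<bar> \<le> C" using C(2)[of v] mult_left_mono[of "Ht_norm s v" 1 C] C(1) by auto
    qed
    then have "\<bar>f ?w\<bar> \<le> Ht_dual_norm s \<Omega> f"
      unfolding Ht_dual_norm_def using w wn by (intro cSUP_upper) auto
    moreover have "\<bar>f ?w\<bar> = \<bar>f v\<bar> / Ht_norm s v"
      using Ht_dualD(2)[OF f v, of "1 / Ht_norm s v"] pos by (simp add: abs_mult)
    ultimately have "\<bar>f v\<bar> / Ht_norm s v \<le> Ht_dual_norm s \<Omega> f" by (simp only:)
    then show ?thesis using pos by (simp only: pos_divide_le_eq)
  qed
qed

section \<open>Variational inequalities and the obstacle problem\<close>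

text \<open>The energy \<open>J\<close> is minimized on \<open>C\<close>. Comparing \<open>J\<close> at the midpoint of two members of a minimizing sequence shows that
  the sequence is Cauchy (parallelogram law), and the first variation of \<open>J\<close> at the minimizer in the
  direction of \<open>v\<close> is the inequality.\<close>

lemma variational_inequality_solvable:
  fixes \<Omega> :: "'a::euclidean_space set"
  assumes s: "0 < s" "s < 1" and \<Omega>: "bounded \<Omega>" and f: "f \<in> Ht_dual s \<Omega>"
    and C: "C \<subseteq> Ht_space s \<Omega>" "C \<noteq> {}"
    and convex: "\<And>u v t. u \<in> C \<Longrightarrow> v \<in> C \<Longrightarrow> 0 \<le> t \<Longrightarrow> t \<le> 1 \<Longrightarrow> (\<lambda>x. u x + t * (v x - u x)) \<in> C"
    and closed: "\<And>c v. (\<And>k::nat. c k \<in> C) \<Longrightarrow> v \<in> Ht_space s \<Omega> \<Longrightarrow>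
      (\<lambda>k. Ht_norm s (\<lambda>x. c k x - v x)) \<longlonglongrightarrow> 0 \<Longrightarrow> v \<in> C"
  obtains u where "u \<in> C" "\<And>v. v \<in> C \<Longrightarrow> f (\<lambda>x. v x - u x) \<le> frac_lap_dual s u (\<lambda>x. v x - u x)"
proof -
  let ?a = "frac_lap_dual s"
  obtain K where K: "0 \<le> K" "\<And>v. v \<in> Ht_space s \<Omega> \<Longrightarrow> \<bar>f v\<bar> \<le> K * Ht_norm s v"
    using Ht_dual_bound[OF f] by blast
  define J where "J v = ?a v v - 2 * f v" for v
  have CV: "v \<in> Ht_space s \<Omega>" and CH: "v \<in> Hs_space s" if "v \<in> C" for v
    using C(1) Ht_spaceD(1) that by blast+
  have step: "J (\<lambda>x. u x + t * (v x - u x)) = J u + 2 * t * (?a u (\<lambda>x. v x - u x) - f (\<lambda>x. v x - u x)) + t\<^sup>2 * (Ht_norm s (\<lambda>x. v x - u x))\<^sup>2"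
    if "u \<in> Ht_space s \<Omega>" "v \<in> Ht_space s \<Omega>" for u v t
  proof -
    let ?d = "\<lambda>x. v x - u x"
    have d: "?d \<in> Ht_space s \<Omega>" by (rule Ht_space_diff[OF that(2,1)])
    note td = Ht_space_cmult[OF d, of t]
    have "?a (\<lambda>x. u x + t * ?d x) (\<lambda>x. u x + t * ?d x) = ?a u u + 2 * t * ?a u ?d + t\<^sup>2 * ?a ?d ?d"
      using frac_lap_dual_add[OF that(1)[THEN Ht_spaceD(1)] td[THEN Ht_spaceD(1)] Ht_space_add[OF that(1) td, THEN Ht_spaceD(1)]]
        frac_lap_dual_add_right[OF that(1)[THEN Ht_spaceD(1)] that(1)[THEN Ht_spaceD(1)] td[THEN Ht_spaceD(1)]]
        frac_lap_dual_add_right[OF td[THEN Ht_spaceD(1)] that(1)[THEN Ht_spaceD(1)] td[THEN Ht_spaceD(1)]]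
        frac_lap_dual_cmult[OF d[THEN Ht_spaceD(1)] td[THEN Ht_spaceD(1)], of t]
        frac_lap_dual_cmult[OF d[THEN Ht_spaceD(1)] that(1)[THEN Ht_spaceD(1)], of t]
        frac_lap_dual_cmult_right[OF that(1)[THEN Ht_spaceD(1)] d[THEN Ht_spaceD(1)], of t]
        frac_lap_dual_cmult_right[OF d[THEN Ht_spaceD(1)] d[THEN Ht_spaceD(1)], of t]
        frac_lap_dual_commute[of s ?d u]
      by (simp only: power2_eq_square)
    moreover have "f (\<lambda>x. u x + t * ?d x) = f u + t * f ?d"
      using Ht_dualD(1)[OF f that(1) td] Ht_dualD(2)[OF f d, of t] by simp
    ultimately show ?thesis unfolding J_def frac_lap_dual_self[symmetric] by (simp add: algebra_simps)
  qed
  have lower: "- K\<^sup>2 \<le> J v" if "v \<in> C" for v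
  proof -
    have "2 * f v \<le> 2 * (K * Ht_norm s v)" using K(2)[OF CV[OF that]] by simp
    moreover have "0 \<le> (Ht_norm s v - K)\<^sup>2" by simp
    ultimately show ?thesis unfolding J_def frac_lap_dual_self by (simp add: power2_diff mult_ac)
  qed
  define I where "I = Inf (J ` C)"
  have bdd: "bdd_below (J ` C)" using lower by (intro bdd_belowI2[of _ "- K\<^sup>2"]) auto
  have I_le: "I \<le> J v" if "v \<in> C" for v unfolding I_def by (rule cINF_lower[OF bdd that])
  have "\<exists>c\<in>C. J c < I + 1 / real (Suc k)" for k
  proof -
    have "Inf (J ` C) < I + 1 / real (Suc k)" unfolding I_def by simp
    then show ?thesis using cINF_less_iff[OF C(2) bdd] by blast
  qed
  then obtain c where c: "\<And>k. c k \<in> C" "\<And>k. J (c k) < I + 1 / real (Suc k)" by metis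
  have dist: "(Ht_norm s (\<lambda>x. c m x - c n x))\<^sup>2 \<le> 2 * (J (c m) - I) + 2 * (J (c n) - I)" for m n
  proof -
    have mid: "(\<lambda>x. c n x + (1/2) * (c m x - c n x)) \<in> C" by (rule convex[OF c(1) c(1)]) auto
    have "J (\<lambda>x. c n x + (1/2) * (c m x - c n x)) \<ge> I" by (rule I_le[OF mid])
    moreover note step[OF CV[OF c(1)] CV[OF c(1)], of n "1/2" m] step[OF CV[OF c(1)] CV[OF c(1)], of n 1 m]
    ultimately show ?thesis by (simp add: power2_eq_square)
  qed
  have invlim: "(\<lambda>k. 1 / real (Suc k)) \<longlonglongrightarrow> 0" by (rule LIMSEQ_Suc[OF lim_1_over_n])
  have "\<exists>u\<in>Ht_space s \<Omega>. (\<lambda>k. Ht_norm s (\<lambda>x. c k x - u x)) \<longlonglongrightarrow> 0"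
  proof (rule Ht_complete[OF s \<Omega> CV[OF c(1)]])
    fix e :: real assume e: "e > 0"
    then have "e\<^sup>2 / 4 > 0" by simp
    from order_tendstoD(2)[OF invlim this] obtain N where N: "\<And>k. k \<ge> N \<Longrightarrow> 1 / real (Suc k) < e\<^sup>2 / 4"
      by (auto simp: eventually_sequentially)
    have "Ht_norm s (\<lambda>x. c m x - c n x) < e" if "m \<ge> N" "n \<ge> N" for m n
    proof (rule power2_less_imp_less)
      have "J (c k) < I + e\<^sup>2 / 4" if "k \<ge> N" for k
        using c(2)[of k] add_strict_left_mono[OF N[OF that], of I] by (rule less_trans)
      from this[OF that(1)] this[OF that(2)] show "(Ht_norm s (\<lambda>x. c m x - c n x))\<^sup>2 < e\<^sup>2"
        using dist[of m n] by argo
    qed (use e in simp)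
    then show "\<exists>N. \<forall>m\<ge>N. \<forall>n\<ge>N. Ht_norm s (\<lambda>x. c m x - c n x) < e" by blast
  qed
  then obtain u where u: "u \<in> Ht_space s \<Omega>" "(\<lambda>k. Ht_norm s (\<lambda>x. c k x - u x)) \<longlonglongrightarrow> 0" by blast
  have uC: "u \<in> C" by (rule closed[OF c(1) u])
  have Ju: "J u \<le> I"
  proof (rule LIMSEQ_le[OF tendsto_const])
    let ?b = "\<lambda>k. I + 1 / real (Suc k) + 2 * ((Ht_norm s u + K) * Ht_norm s (\<lambda>x. c k x - u x))"
    have "?b \<longlonglongrightarrow> I + 0 + 2 * ((Ht_norm s u + K) * 0)" by (intro tendsto_intros invlim u)
    then show "?b \<longlonglongrightarrow> I" by simp
    have "J u \<le> ?b k" for k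
    proof -
      let ?d = "\<lambda>x. c k x - u x"
      have "J (c k) = J u + 2 * (?a u ?d - f ?d) + (Ht_norm s ?d)\<^sup>2"
        using step[OF u(1) CV[OF c(1)], of 1 k] by simp
      then have "J u \<le> J (c k) + 2 * (f ?d - ?a u ?d)" by simp
      also have "f ?d - ?a u ?d \<le> (Ht_norm s u + K) * Ht_norm s ?d"
        using K(2)[OF Ht_space_diff[OF CV[OF c(1)] u(1)], of k]
          frac_lap_dual_Cauchy_Schwarz[OF Ht_spaceD(1)[OF u(1)] Ht_spaceD(1)[OF Ht_space_diff[OF CV[OF c(1)] u(1)]], of k]
        by (simp add: distrib_right)
      finally show ?thesis using c(2)[of k] by simp
    qed
    then show "\<exists>N. \<forall>n\<ge>N. J u \<le> ?b n" by blast
  qed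
  show ?thesis
  proof (rule that[OF uC])
    fix v assume v: "v \<in> C"
    let ?d = "\<lambda>x. v x - u x"
    define b where "b = ?a u ?d - f ?d"
    define q where "q = (Ht_norm s ?d)\<^sup>2"
    have q: "0 \<le> q" by (simp add: q_def)
    have t: "0 \<le> 2 * t * b + t\<^sup>2 * q" if "0 \<le> t" "t \<le> 1" for t
      using I_le[OF convex[OF uC v that]] Ju step[OF u(1) CV[OF v], of t] by (simp add: b_def q_def)
    have "0 \<le> b"
    proof (rule ccontr)
      assume "\<not> 0 \<le> b"
      then have b: "b < 0" by simp
      \<comment> \<open>Small enough for the linear term to dominate: \<open>t * q < - 2 * b\<close>.\<close>
      define t where "t = min 1 (- b / (q + 1))"
      have t0: "0 < t" "t \<le> 1" using b q by (auto simp: t_def divide_less_0_iff)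
      have "t * (q + 1) \<le> - b"
      proof -
        have "t \<le> - b / (q + 1)" by (simp add: t_def)
        moreover have "0 < q + 1" using q by simp
        ultimately show ?thesis by (simp only: pos_le_divide_eq)
      qed
      then have "2 * b + t * q < 0" using b t0 by (simp add: distrib_left)
      then have "t * (2 * b + t * q) < 0" using t0 by (simp add: mult_pos_neg)
      then show False using t[of t] t0 by (simp add: power2_eq_square algebra_simps)
    qed
    then show "f ?d \<le> ?a u ?d" by (simp add: b_def)
  qed
qed

text \<open>The variational inequality on the whole space, tested with \<open>F + v\<close> and \<open>F - v\<close>.\<close>

lemma Ht_Riesz:
  fixes \<Omega> :: "'a::euclidean_space set"
  assumes s: "0 < s" "s < 1" and \<Omega>: "bounded \<Omega>" and f: "f \<in> Ht_dual s \<Omega>"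
  obtains F where "F \<in> Ht_space s \<Omega>" "\<And>v. v \<in> Ht_space s \<Omega> \<Longrightarrow> f v = frac_lap_dual s F v"
proof -
  have "(\<lambda>x::'a. 0) \<in> Hs_space s"
  proof (rule Hs_spaceI)
    have "has_fourier (\<lambda>x::'a. 0) (fourier_L1 (\<lambda>x. 0))"
      by (rule has_fourier_fourier_L1) (auto simp: L2_space_zero)
    moreover have "fourier_L1 (\<lambda>x::'a. 0) = (\<lambda>\<xi>. 0)" by (auto simp: fourier_L1_def)
    ultimately have z: "has_fourier (\<lambda>x::'a. 0) (\<lambda>\<xi>. 0)" by simp
    show "has_frac_lap (s / 2) (\<lambda>x::'a. 0) (\<lambda>x. 0)"
      unfolding has_frac_lap_def using z by (auto simp: L2_space_zero intro!: exI[of _ "\<lambda>\<xi>. 0"])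
  qed
  then have ne: "Ht_space s \<Omega> \<noteq> {}" by (auto simp: Ht_space_def)
  obtain F where F: "F \<in> Ht_space s \<Omega>" "\<And>v. v \<in> Ht_space s \<Omega> \<Longrightarrow> f (\<lambda>x. v x - F x) \<le> frac_lap_dual s F (\<lambda>x. v x - F x)"
    by (rule variational_inequality_solvable[OF s \<Omega> f order_refl ne])
       (auto intro!: Ht_space_add Ht_space_cmult Ht_space_diff)
  have le: "f v \<le> frac_lap_dual s F v" if "v \<in> Ht_space s \<Omega>" for v
    using F(2)[OF Ht_space_add[OF that F(1)]] by simp
  show ?thesis
  proof (rule that[OF F(1)])
    fix v assume v: "v \<in> Ht_space s \<Omega>"
    show "f v = frac_lap_dual s F v"
      using le[OF v] le[OF Ht_space_cmult[OF v, of "-1"]] Ht_dualD(2)[OF f v, of "-1"]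
        frac_lap_dual_cmult_right[OF Ht_spaceD(1)[OF F(1)] Ht_spaceD(1)[OF v], of "-1"] by simp
  qed
qed

lemma obstacle_setD:
  assumes "v \<in> obstacle_set s \<Omega> \<psi>"
  shows "v \<in> Ht_space s \<Omega>" "AE x in lborel. x \<in> \<Omega> \<longrightarrow> \<psi> x \<le> v x"
  using assms by (auto simp: obstacle_set_def)

lemma obstacle_problem_solvable:
  fixes \<Omega> :: "'a::euclidean_space set"
  assumes s: "0 < s" "s < 1" and \<Omega>: "bounded \<Omega>" and f: "f \<in> Ht_dual s \<Omega>"
    and ne: "obstacle_set s \<Omega> \<psi> \<noteq> {}"
  obtains u where "solves_obstacle s \<Omega> \<psi> f u"
proof -
  let ?C = "obstacle_set s \<Omega> \<psi>"
  have C: "?C \<subseteq> Ht_space s \<Omega>" by (auto simp: obstacle_set_def)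
  have convex: "(\<lambda>x. u x + t * (v x - u x)) \<in> ?C" if "u \<in> ?C" "v \<in> ?C" "0 \<le> t" "t \<le> 1" for u v t
  proof -
    have "AE x in lborel. x \<in> \<Omega> \<longrightarrow> \<psi> x \<le> u x + t * (v x - u x)"
      using obstacle_setD(2)[OF that(1)] obstacle_setD(2)[OF that(2)]
    proof eventually_elim
      case (elim x)
      show ?case
      proof
        assume "x \<in> \<Omega>"
        then have "(1 - t) * \<psi> x \<le> (1 - t) * u x" "t * \<psi> x \<le> t * v x"
          using elim that by (auto intro: mult_left_mono)
        then show "\<psi> x \<le> u x + t * (v x - u x)" by (simp add: algebra_simps)
      qed
    qed
    then show ?thesis
      unfolding obstacle_set_def using that C by (auto intro!: Ht_space_add Ht_space_cmult Ht_space_diff)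
  qed
  have closed: "v \<in> ?C" if c: "\<And>k::nat. c k \<in> ?C" and v: "v \<in> Ht_space s \<Omega>"
      and lim: "(\<lambda>k. Ht_norm s (\<lambda>x. c k x - v x)) \<longlonglongrightarrow> 0" for c v
  proof -
    note cV = c[THEN obstacle_setD(1)]
    note l2 = Ht_tendsto_L2[OF s \<Omega> cV v lim]
    obtain r where r: "strict_mono (r::nat\<Rightarrow>nat)" "AE x in lborel. (\<lambda>n. c (r n) x) \<longlonglongrightarrow> v x"
      using L2_AE_subseq[OF Hs_space_L2[OF Ht_spaceD(1)[OF cV]] Hs_space_L2[OF Ht_spaceD(1)[OF v]] l2] by blast
    have "AE x in lborel. \<forall>k. x \<in> \<Omega> \<longrightarrow> \<psi> x \<le> c k x"
      using c[THEN obstacle_setD(2)] by (subst AE_all_countable) auto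
    with r(2) have "AE x in lborel. x \<in> \<Omega> \<longrightarrow> \<psi> x \<le> v x"
    proof eventually_elim
      case (elim x)
      show ?case
      proof
        assume "x \<in> \<Omega>"
        then show "\<psi> x \<le> v x" using elim by (intro LIMSEQ_le_const[OF elim(1)]) auto
      qed
    qed
    then show ?thesis using v by (simp add: obstacle_set_def)
  qed
  show ?thesis
  proof (rule variational_inequality_solvable[OF s \<Omega> f C ne])
    show "(\<lambda>x. u x + t * (v x - u x)) \<in> ?C" if "u \<in> ?C" "v \<in> ?C" "0 \<le> t" "t \<le> 1" for u v t
      by (rule convex[OF that])
    show "v \<in> ?C" if "\<And>k::nat. c k \<in> ?C" "v \<in> Ht_space s \<Omega>"
      "(\<lambda>k. Ht_norm s (\<lambda>x. c k x - v x)) \<longlonglongrightarrow> 0" for c v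
      by (rule closed[OF that])
    show thesis if "u \<in> ?C"
      "\<And>v. v \<in> ?C \<Longrightarrow> f (\<lambda>x. v x - u x) \<le> frac_lap_dual s u (\<lambda>x. v x - u x)" for u
      using that by (intro \<open>\<And>u. solves_obstacle s \<Omega> \<psi> f u \<Longrightarrow> thesis\<close>[of u]) (auto simp: solves_obstacle_def)
  qed
qed

lemma solves_obstacleD:
  assumes "solves_obstacle s \<Omega> \<psi> f u"
  shows "u \<in> obstacle_set s \<Omega> \<psi>" "u \<in> Ht_space s \<Omega>" "u \<in> Hs_space s"
    "AE x in lborel. x \<in> \<Omega> \<longrightarrow> \<psi> x \<le> u x"
    "\<And>v. v \<in> obstacle_set s \<Omega> \<psi> \<Longrightarrow> f (\<lambda>x. v x - u x) \<le> frac_lap_dual s u (\<lambda>x. v x - u x)"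
  using assms by (auto simp: solves_obstacle_def obstacle_set_def dest: Ht_spaceD)

lemma obstacle_problem_unique:
  fixes \<Omega> :: "'a::euclidean_space set"
  assumes s: "0 < s" "s < 1" and \<Omega>: "bounded \<Omega>" and f: "f \<in> Ht_dual s \<Omega>"
    and u: "solves_obstacle s \<Omega> \<psi> f u" and v: "solves_obstacle s \<Omega> \<psi> f v"
  shows "AE x in lborel. v x = u x"
proof -
  note uD = solves_obstacleD[OF u] and vD = solves_obstacleD[OF v]
  have d: "(\<lambda>x. v x - u x) \<in> Ht_space s \<Omega>" by (rule Ht_space_diff[OF vD(2) uD(2)])
  have "(Ht_norm s (\<lambda>x. v x - u x))\<^sup>2 \<le> 0"
    using uD(5)[OF vD(1)] vD(5)[OF uD(1)] Ht_dualD(3)[OF f vD(2) uD(2)] Ht_dualD(3)[OF f uD(2) vD(2)]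
      frac_lap_dual_diff_right[OF uD(3) vD(3) uD(3)] frac_lap_dual_diff_right[OF vD(3) uD(3) vD(3)]
      frac_lap_dual_diff[OF vD(3) uD(3) Ht_spaceD(1)[OF d]] frac_lap_dual_diff_right[OF vD(3) vD(3) uD(3)]
    unfolding frac_lap_dual_self[symmetric] by linarith
  then have n0: "Ht_norm s (\<lambda>x. v x - u x) = 0" by simp
  obtain K where K: "0 \<le> K" "\<And>w. w \<in> Ht_space s \<Omega> \<Longrightarrow> L2_norm w \<le> K * Ht_norm s w"
    using Ht_Poincare[OF s \<Omega>] by blast
  have "L2_norm (\<lambda>x. v x - u x) = 0" using K(2)[OF d] n0 L2_norm_nonneg[of "\<lambda>x. v x - u x"] by simp
  from L2_norm_eq_0[OF Hs_space_L2[OF Ht_spaceD(1)[OF d]] this] show ?thesis by simp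
qed

text \<open>If \<open>X > 1\<close>, then \<open>K * P\<close> is at most \<open>K * P * X\<close> and a factor \<open>X\<close> cancels.\<close>

lemma quadratic_bound:
  fixes X P K :: real
  assumes "X\<^sup>2 \<le> X * P + K * (P + X)" "0 \<le> P" "0 \<le> K"
  shows "X \<le> 1 + P + K + K * P"
proof (cases "X \<le> 1")
  case True
  have "0 \<le> K * P" using assms by simp
  then show ?thesis using True assms by linarith
next
  case False
  have "K * P * 1 \<le> K * P * X" using False assms by (intro mult_left_mono) auto
  then have "X * X \<le> X * (P + K + K * P)" using assms(1) by (simp add: power2_eq_square algebra_simps)
  then have "X \<le> P + K + K * P" using False by simp
  then show ?thesis by simp
qed

text \<open>The variational inequality tested with \<open>p\<close>, with the energy estimated by Cauchy--Schwarz.\<close>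

lemma obstacle_Ht_bound:
  fixes \<Omega> :: "'a::euclidean_space set"
  assumes u: "solves_obstacle s \<Omega> \<psi> f u" and f: "f \<in> Ht_dual s \<Omega>"
    and p: "p \<in> obstacle_set s \<Omega> \<psi>" and P: "Ht_norm s p \<le> P" and K: "Ht_dual_norm s \<Omega> f \<le> K" "0 \<le> K"
  shows "Ht_norm s u \<le> 1 + P + K + K * P"
proof (rule quadratic_bound)
  note uD = solves_obstacleD[OF u] and pV = obstacle_setD(1)[OF p]
  note pH = Ht_spaceD(1)[OF pV]
  let ?d = "\<lambda>x. p x - u x"
  have d: "?d \<in> Ht_space s \<Omega>" by (rule Ht_space_diff[OF pV uD(2)])
  have "\<bar>f ?d\<bar> \<le> Ht_dual_norm s \<Omega> f * Ht_norm s ?d" by (rule Ht_dual_norm_bound[OF f d])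
  also have "\<dots> \<le> K * Ht_norm s ?d" by (intro mult_right_mono K) simp
  also have "\<dots> \<le> K * (P + Ht_norm s u)"
    using Ht_norm_diff[OF pH uD(3)] P by (intro mult_left_mono K) simp
  finally have 1: "\<bar>f ?d\<bar> \<le> K * (P + Ht_norm s u)" .
  have "\<bar>frac_lap_dual s u p\<bar> \<le> Ht_norm s u * Ht_norm s p"
    by (rule frac_lap_dual_Cauchy_Schwarz[OF uD(3) pH])
  also have "\<dots> \<le> Ht_norm s u * P" by (intro mult_left_mono P) simp
  finally have 2: "\<bar>frac_lap_dual s u p\<bar> \<le> Ht_norm s u * P" .
  show "(Ht_norm s u)\<^sup>2 \<le> Ht_norm s u * P + K * (P + Ht_norm s u)"
    using uD(5)[OF p] 1 2 frac_lap_dual_diff_right[OF uD(3) pH uD(3)]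
    unfolding frac_lap_dual_self by linarith
  show "0 \<le> P" using P Ht_norm_nonneg order_trans by blast
qed fact

section \<open>Stability of the obstacle problem\<close>

lemma neg_part_eq: "min a 0 = (-1) * max ((-1) * a) (0::real)"
  by simp

lemma Hs_space_neg_part:
  fixes u :: "'a::euclidean_space \<Rightarrow> real"
  assumes s: "0 < s" "s < 1" and u: "u \<in> Hs_space s"
  shows "(\<lambda>x. min (u x) 0) \<in> Hs_space s" "Ht_norm s (\<lambda>x. min (u x) 0) \<le> Ht_norm s u"
proof -
  note m = Hs_space_cmult[OF u, of "-1"]
  show "(\<lambda>x. min (u x) 0) \<in> Hs_space s"
    unfolding neg_part_eq by (intro Hs_space_cmult Hs_space_pos_part[OF s m])
  show "Ht_norm s (\<lambda>x. min (u x) 0) \<le> Ht_norm s u"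
    unfolding neg_part_eq Ht_norm_cmult[OF Hs_space_pos_part[OF s m]]
    using Ht_norm_pos_part[OF s m] Ht_norm_cmult[OF u, of "-1"] by simp
qed

text \<open>
  What is added to a function \<open>u\<close> above \<open>\<psi>\<close> to lift it above \<open>\<psi>'\<close>. It is the minimum of \<open>(\<psi>' - u)\<^sup>+\<close> and \<open>(\<psi>' - \<psi>)\<^sup>+\<close>.
  On \<open>\<Omega>\<close>, where \<open>\<psi> \<le> u\<close>, it equals \<open>(\<psi>' - u)\<^sup>+\<close>, so the lifted function is the maximum of \<open>u\<close> and \<open>\<psi>'\<close>. That
  maximum itself would not do: the boundary of \<open>\<Omega>\<close> may have positive measure and \<open>u\<close> may lie below \<open>\<psi>\<close> there, so
  \<open>(\<psi>' - u)\<^sup>+\<close> need not become small as \<open>\<psi>'\<close> tends to \<open>\<psi>\<close>. The bound by \<open>(\<psi>' - \<psi>)\<^sup>+\<close> repairs this. The form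
  below exhibits the correction as the positive part of a function that tends to the nonpositive
  \<open>min (\<psi> - u) 0\<close> as \<open>\<psi>'\<close> tends to \<open>\<psi>\<close>.
\<close>

definition obstacle_correction :: "('a \<Rightarrow> real) \<Rightarrow> ('a \<Rightarrow> real) \<Rightarrow> ('a \<Rightarrow> real) \<Rightarrow> 'a \<Rightarrow> real" where
  "obstacle_correction \<psi> \<psi>' u x = max ((\<psi>' x - \<psi> x) + min (\<psi> x - u x) 0) 0"

lemma
  fixes u :: "'a::euclidean_space \<Rightarrow> real"
  assumes s: "0 < s" "s < 1" and p: "\<psi> \<in> Hs_space s" "\<psi>' \<in> Hs_space s"
    and pos: "(\<lambda>x. max (\<psi>' x) 0) \<in> Ht_space s \<Omega>" and u: "u \<in> obstacle_set s \<Omega> \<psi>"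
  shows obstacle_correction_Ht: "obstacle_correction \<psi> \<psi>' u \<in> Ht_space s \<Omega>"
    and obstacle_correction_admissible: "(\<lambda>x. u x + obstacle_correction \<psi> \<psi>' u x) \<in> obstacle_set s \<Omega> \<psi>'"
    and obstacle_correction_L2: "L2_norm (obstacle_correction \<psi> \<psi>' u) \<le> L2_norm (\<lambda>x. \<psi>' x - \<psi> x)"
    and obstacle_correction_Ht_norm: "Ht_norm s (obstacle_correction \<psi> \<psi>' u)
      \<le> Ht_norm s (\<lambda>x. \<psi>' x - \<psi> x) + Ht_norm s (\<lambda>x. \<psi> x - u x)"
proof -
  note uV = obstacle_setD(1)[OF u] and uge = obstacle_setD(2)[OF u]
  note uH = Ht_spaceD(1)[OF uV]
  note \<phi> = Hs_space_diff[OF p(2,1)] and q = Hs_space_diff[OF p(1) uH]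
  note n = Hs_space_neg_part[OF s q]
  note g = Hs_space_add[OF \<phi> n(1)]
  have eq: "obstacle_correction \<psi> \<psi>' u = (\<lambda>x. max ((\<psi>' x - \<psi> x) + min (\<psi> x - u x) 0) 0)"
    by (simp add: obstacle_correction_def fun_eq_iff)
  have mH: "obstacle_correction \<psi> \<psi>' u \<in> Hs_space s" unfolding eq by (rule Hs_space_pos_part[OF s g])
  have "AE x in lborel. x \<notin> closure \<Omega> \<longrightarrow> obstacle_correction \<psi> \<psi>' u x = 0"
    using Ht_spaceD(2)[OF uV] Ht_spaceD(2)[OF pos]
  proof eventually_elim
    case (elim x)
    then show ?case by (auto simp: obstacle_correction_def max_def min_def split: if_splits)
  qed
  with mH show mV: "obstacle_correction \<psi> \<psi>' u \<in> Ht_space s \<Omega>" by (simp add: Ht_space_def)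
  have "AE x in lborel. x \<in> \<Omega> \<longrightarrow> \<psi>' x \<le> u x + obstacle_correction \<psi> \<psi>' u x"
    using uge by eventually_elim (auto simp: obstacle_correction_def)
  then show "(\<lambda>x. u x + obstacle_correction \<psi> \<psi>' u x) \<in> obstacle_set s \<Omega> \<psi>'"
    using Ht_space_add[OF uV mV] by (simp add: obstacle_set_def)
  show "L2_norm (obstacle_correction \<psi> \<psi>' u) \<le> L2_norm (\<lambda>x. \<psi>' x - \<psi> x)"
  proof (rule L2_norm_mono[OF Hs_space_L2[OF \<phi>]])
    show "obstacle_correction \<psi> \<psi>' u \<in> borel_measurable borel"
      using mH by (intro L2_space_measurable Hs_space_L2)
    have "norm (obstacle_correction \<psi> \<psi>' u x) \<le> norm (\<psi>' x - \<psi> x)" for x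
      by (auto simp: obstacle_correction_def)
    then show "AE x in lborel. norm (obstacle_correction \<psi> \<psi>' u x) \<le> norm (\<psi>' x - \<psi> x)" by simp
  qed
  show "Ht_norm s (obstacle_correction \<psi> \<psi>' u) \<le> Ht_norm s (\<lambda>x. \<psi>' x - \<psi> x) + Ht_norm s (\<lambda>x. \<psi> x - u x)"
    unfolding eq using Ht_norm_pos_part[OF s g] Ht_norm_add[OF \<phi> n(1)] n(2) by linarith
qed

text \<open>The sum of the two variational inequalities, each tested with the other solution lifted above the
  appropriate obstacle. The corrections \<open>m\<close> and \<open>m'\<close> stand for the price of the lifting.\<close>

lemma obstacle_comparison:
  fixes \<Omega> :: "'a::euclidean_space set"
  assumes f: "f \<in> Ht_dual s \<Omega>" "f' \<in> Ht_dual s \<Omega>"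
    and u: "solves_obstacle s \<Omega> \<psi> f u" and u': "solves_obstacle s \<Omega> \<psi>' f' u'"
    and m: "m \<in> Ht_space s \<Omega>" "(\<lambda>x. u x + m x) \<in> obstacle_set s \<Omega> \<psi>'"
    and m': "m' \<in> Ht_space s \<Omega>" "(\<lambda>x. u' x + m' x) \<in> obstacle_set s \<Omega> \<psi>"
  shows "(Ht_norm s (\<lambda>x. u' x - u x))\<^sup>2 \<le> frac_lap_dual s u' m - f' m
    + (frac_lap_dual s u m' - f m') + (f' (\<lambda>x. u' x - u x) - f (\<lambda>x. u' x - u x))"
proof -
  let ?a = "frac_lap_dual s"
  note uD = solves_obstacleD[OF u] and u'D = solves_obstacleD[OF u']
  note mH = Ht_spaceD(1)[OF m(1)] and m'H = Ht_spaceD(1)[OF m'(1)]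
  let ?d = "\<lambda>x. u' x - u x"
  have d: "?d \<in> Ht_space s \<Omega>" by (rule Ht_space_diff[OF u'D(2) uD(2)])
  note dH = Ht_spaceD(1)[OF d]
  have e1: "(\<lambda>x. u x + m x - u' x) = (\<lambda>x. m x - ?d x)" by (simp add: fun_eq_iff)
  have e2: "(\<lambda>x. u' x + m' x - u x) = (\<lambda>x. m' x + ?d x)" by (simp add: fun_eq_iff)
  have "f' m - f' ?d \<le> ?a u' m - ?a u' ?d"
    using u'D(5)[OF m(2)] unfolding e1
      Ht_dualD(3)[OF f(2) m(1) d] frac_lap_dual_diff_right[OF u'D(3) mH dH] .
  moreover have "f m' + f ?d \<le> ?a u m' + ?a u ?d"
    using uD(5)[OF m'(2)] unfolding e2
      Ht_dualD(1)[OF f(1) m'(1) d] frac_lap_dual_add_right[OF uD(3) m'H dH] .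
  moreover have "(Ht_norm s ?d)\<^sup>2 = ?a u' ?d - ?a u ?d"
    unfolding frac_lap_dual_self[symmetric] by (rule frac_lap_dual_diff[OF u'D(3) uD(3) dH])
  ultimately show ?thesis by linarith
qed

theorem theorem4p4:
  fixes s :: real and \<Omega> :: "'a::euclidean_space set"
    and \<psi>h :: "nat \<Rightarrow> 'a \<Rightarrow> real" and \<psi> :: "'a \<Rightarrow> real"
    and fh :: "nat \<Rightarrow> ('a \<Rightarrow> real) \<Rightarrow> real" and f :: "('a \<Rightarrow> real) \<Rightarrow> real"
    and uh :: "nat \<Rightarrow> 'a \<Rightarrow> real"
  assumes "0 < s" and "s < 1"
    and "open \<Omega>" and "connected \<Omega>" and "bounded \<Omega>" and "\<Omega> \<noteq> {}"
    and "\<And>h. \<psi>h h \<in> Hs_space s"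
    and "\<And>h. (\<lambda>x. max (\<psi>h h x) 0) \<in> Ht_space s \<Omega>"
    and "\<And>h. fh h \<in> Ht_dual s \<Omega>"
    and "\<psi> \<in> Hs_space s" and "(\<lambda>h. Hs_norm s (\<lambda>x. \<psi>h h x - \<psi> x)) \<longlonglongrightarrow> 0"
    and "f \<in> Ht_dual s \<Omega>" and "(\<lambda>h. Ht_dual_norm s \<Omega> (\<lambda>v. fh h v - f v)) \<longlonglongrightarrow> 0"
    and "\<And>h. solves_obstacle s \<Omega> (\<psi>h h) (fh h) (uh h)"
  shows "\<exists>u. solves_obstacle s \<Omega> \<psi> f u \<and>
             (\<forall>u'. solves_obstacle s \<Omega> \<psi> f u' \<longrightarrow> (AE x in lborel. u' x = u x)) \<and>
             (\<lambda>h. Ht_norm s (\<lambda>x. uh h x - u x)) \<longlonglongrightarrow> 0"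
proof -
  let ?a = "frac_lap_dual s"
  note s = assms(1,2) and bdd = assms(5) and \<psi>hH = assms(7) and \<psi>hV = assms(8) and fh = assms(9)
    and \<psi>H = assms(10) and f = assms(12) and sol = assms(14)
  let ?\<phi> = "\<lambda>h x. \<psi>h h x - \<psi> x"
  note \<phi>H = Hs_space_diff[OF \<psi>hH \<psi>H]
  have \<phi>2: "(\<lambda>h. L2_norm (?\<phi> h)) \<longlonglongrightarrow> 0" and \<phi>t: "(\<lambda>h. Ht_norm s (?\<phi> h)) \<longlonglongrightarrow> 0"
  proof -
    have "L2_norm v \<le> Hs_norm s v" "Ht_norm s v \<le> Hs_norm s v" for v :: "'a \<Rightarrow> real"
      by (auto simp: Hs_norm_def Ht_norm_def intro!: real_le_rsqrt)
    then show "(\<lambda>h. L2_norm (?\<phi> h)) \<longlonglongrightarrow> 0" "(\<lambda>h. Ht_norm s (?\<phi> h)) \<longlonglongrightarrow> 0"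
      by (intro Lim_null_comparison[OF _ assms(11)]; simp)+
  qed
  have \<psi>V: "(\<lambda>x. max (\<psi> x) 0) \<in> Ht_space s \<Omega>"
  proof -
    obtain r where r: "AE x in lborel. (\<lambda>n. \<psi>h (r n) x) \<longlonglongrightarrow> \<psi> x"
      using L2_AE_subseq[OF Hs_space_L2[OF \<psi>hH] Hs_space_L2[OF \<psi>H] \<phi>2] by blast
    have "AE x in lborel. \<forall>h. x \<notin> closure \<Omega> \<longrightarrow> max (\<psi>h h x) 0 = 0"
      using \<psi>hV[THEN Ht_spaceD(2)] by (subst AE_all_countable) auto
    with r have "AE x in lborel. x \<notin> closure \<Omega> \<longrightarrow> max (\<psi> x) 0 = 0"
    proof eventually_elim
      case (elim x)
      have "(\<lambda>n. max (\<psi>h (r n) x) 0) \<longlonglongrightarrow> max (\<psi> x) 0" by (intro tendsto_intros elim(1))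
      show ?case
      proof
        assume "x \<notin> closure \<Omega>"
        then have "(\<lambda>n. max (\<psi>h (r n) x) 0) = (\<lambda>n. 0)" using elim(2) by auto
        then show "max (\<psi> x) 0 = 0"
          using \<open>(\<lambda>n. max (\<psi>h (r n) x) 0) \<longlonglongrightarrow> max (\<psi> x) 0\<close> LIMSEQ_unique[OF tendsto_const] by metis
      qed
    qed
    then show ?thesis using Hs_space_pos_part[OF s \<psi>H] by (simp add: Ht_space_def)
  qed
  have pos_part_admissible: "(\<lambda>x. max (p x) 0) \<in> obstacle_set s \<Omega> p" if "(\<lambda>x. max (p x) 0) \<in> Ht_space s \<Omega>" for p
    using that by (simp add: obstacle_set_def)
  obtain u where u: "solves_obstacle s \<Omega> \<psi> f u"
    using obstacle_problem_solvable[OF s bdd f] pos_part_admissible[OF \<psi>V] by blast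
  note uD = solves_obstacleD[OF u] and uhD = solves_obstacleD[OF sol]
  define \<delta> where "\<delta> h = Ht_dual_norm s \<Omega> (\<lambda>v. fh h v - f v)" for h
  have \<delta>: "\<delta> \<longlonglongrightarrow> 0" using assms(13) by (simp add: \<delta>_def[abs_def])
  have fdiff: "\<bar>fh h v - f v\<bar> \<le> \<delta> h * Ht_norm s v" if "v \<in> Ht_space s \<Omega>" for h v
    using Ht_dual_norm_bound[OF Ht_dual_diff[OF fh f] that] by (simp add: \<delta>_def)
  obtain Kf where Kf: "0 \<le> Kf" "\<And>v. v \<in> Ht_space s \<Omega> \<Longrightarrow> \<bar>f v\<bar> \<le> Kf * Ht_norm s v"
    using Ht_dual_bound[OF f] by blast
  obtain D where D: "\<And>h. \<bar>\<delta> h\<bar> \<le> D"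
    using convergent_imp_Bseq[OF convergentI[OF \<delta>]] by (auto simp: Bseq_def)
  obtain E where E: "\<And>h. Ht_norm s (?\<phi> h) \<le> E"
    using convergent_imp_Bseq[OF convergentI[OF \<phi>t]] by (auto simp: Bseq_def)
  \<comment> \<open>A common bound for the norms of all data \<open>fh\<close>.\<close>
  define K where "K = D + Kf"
  have fhK: "\<bar>fh h v\<bar> \<le> K * Ht_norm s v" if "v \<in> Ht_space s \<Omega>" for h v
  proof -
    have "\<delta> h * Ht_norm s v \<le> D * Ht_norm s v" using D[of h] by (intro mult_right_mono) auto
    then show ?thesis using fdiff[OF that, of h] Kf(2)[OF that] by (simp add: K_def distrib_right)
  qed
  define P where "P = E + Ht_norm s \<psi>"
  have \<psi>hP: "Ht_norm s (\<psi>h h) \<le> P" for h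
    using Ht_norm_add[OF \<phi>H \<psi>H, of h] E[of h] by (simp add: P_def)
  define B where "B = 1 + P + K + K * P"
  have K0: "0 \<le> K" using D[of 0] Kf(1) by (simp add: K_def)
  have uhB: "Ht_norm s (uh h) \<le> B" for h
    unfolding B_def
  proof (rule obstacle_Ht_bound[OF sol fh pos_part_admissible[OF \<psi>hV]])
    show "Ht_norm s (\<lambda>x. max (\<psi>h h x) 0) \<le> P"
      using Ht_norm_pos_part[OF s \<psi>hH] \<psi>hP by (rule order_trans)
    have "{v \<in> Ht_space s \<Omega>. Ht_norm s v \<le> 1} \<noteq> {}"
      using Ht_space_cmult[OF uD(2), of 0] Ht_norm_cmult[OF uD(3), of 0] by auto
    then show "Ht_dual_norm s \<Omega> (fh h) \<le> K"
      unfolding Ht_dual_norm_def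
    proof (rule cSUP_least)
      fix v assume v: "v \<in> {v \<in> Ht_space s \<Omega>. Ht_norm s v \<le> 1}"
      then have "K * Ht_norm s v \<le> K * 1" by (intro mult_left_mono K0) auto
      then show "\<bar>fh h v\<bar> \<le> K" using fhK[of v h] v by simp
    qed
  qed (rule K0)
  define m where "m h = obstacle_correction \<psi> (\<psi>h h) u" for h
  define m' where "m' h = obstacle_correction (\<psi>h h) \<psi> (uh h)" for h
  note mC = obstacle_correction_Ht[OF s \<psi>H \<psi>hH \<psi>hV uD(1), folded m_def]
    obstacle_correction_admissible[OF s \<psi>H \<psi>hH \<psi>hV uD(1), folded m_def]
  note m'C = obstacle_correction_Ht[OF s \<psi>hH \<psi>H \<psi>V uhD(1), folded m'_def]
    obstacle_correction_admissible[OF s \<psi>hH \<psi>H \<psi>V uhD(1), folded m'_def]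
  \<comment> \<open>The corrections of the fixed function \<open>u\<close> are positive parts of a sequence with a nonpositive limit.\<close>
  have m_lim: "(\<lambda>h. Ht_norm s (m h)) \<longlonglongrightarrow> 0"
  proof -
    note n = Hs_space_neg_part(1)[OF s Hs_space_diff[OF \<psi>H uD(3)]]
    have "(\<lambda>h. Ht_norm s (\<lambda>x. max (?\<phi> h x + min (\<psi> x - u x) 0) 0)) \<longlonglongrightarrow> 0"
      by (rule Ht_norm_pos_part_tendsto_0[OF s Hs_space_add[OF \<phi>H n] n]) (use \<phi>2 \<phi>t in simp_all)
    then show ?thesis unfolding m_def obstacle_correction_def .
  qed
  \<comment> \<open>The corrections of the varying \<open>uh\<close> are only bounded and null in the mean, hence weakly null.\<close>
  have m'2: "(\<lambda>h. L2_norm (m' h)) \<longlonglongrightarrow> 0"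
  proof (rule Lim_null_comparison[OF _ \<phi>2])
    have "L2_norm (m' h) \<le> L2_norm (?\<phi> h)" for h
      using obstacle_correction_L2[OF s \<psi>hH \<psi>H \<psi>V uhD(1), of h] L2_norm_minus_commute[of \<psi> "\<psi>h h"]
      by (simp add: m'_def)
    then show "\<forall>\<^sub>F h in sequentially. norm (L2_norm (m' h)) \<le> L2_norm (?\<phi> h)" by simp
  qed
  have m'B: "Ht_norm s (m' h) \<le> E + (P + B)" for h
    using obstacle_correction_Ht_norm[OF s \<psi>hH \<psi>H \<psi>V uhD(1), of h, folded m'_def]
      Ht_norm_minus_commute[OF \<psi>H \<psi>hH, of h] Ht_norm_diff[OF \<psi>hH uhD(3), of h h] E[of h] \<psi>hP[of h] uhB[of h]
    by linarith
  have weak: "(\<lambda>h. ?a v (m' h)) \<longlonglongrightarrow> 0" if "v \<in> Hs_space s" for v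
    by (rule frac_lap_dual_weakly_null[OF s(1) that Ht_spaceD(1)[OF m'C(1)] m'2 m'B])
  obtain F where F: "F \<in> Ht_space s \<Omega>" "\<And>v. v \<in> Ht_space s \<Omega> \<Longrightarrow> f v = ?a F v"
    using Ht_Riesz[OF s bdd f] by blast
  have fweak: "(\<lambda>h. f (m' h)) \<longlonglongrightarrow> 0"
    unfolding F(2)[OF m'C(1)] by (rule weak[OF Ht_spaceD(1)[OF F(1)]])
  let ?b = "\<lambda>h. (B + K) * Ht_norm s (m h) + (?a u (m' h) - f (m' h)) + \<bar>\<delta> h\<bar> * (B + Ht_norm s u)"
  have est: "(Ht_norm s (\<lambda>x. uh h x - u x))\<^sup>2 \<le> ?b h" for h
  proof -
    let ?d = "\<lambda>x. uh h x - u x"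
    have d: "?d \<in> Ht_space s \<Omega>" by (rule Ht_space_diff[OF uhD(2) uD(2)])
    have "(Ht_norm s ?d)\<^sup>2 \<le> ?a (uh h) (m h) - fh h (m h) + (?a u (m' h) - f (m' h)) + (fh h ?d - f ?d)"
      by (rule obstacle_comparison[OF f fh u sol mC m'C])
    moreover have "?a (uh h) (m h) \<le> B * Ht_norm s (m h)"
      using frac_lap_dual_Cauchy_Schwarz[OF uhD(3) Ht_spaceD(1)[OF mC(1)], of h h]
        mult_right_mono[OF uhB[of h] Ht_norm_nonneg[of s "m h"]] by linarith
    moreover have "- fh h (m h) \<le> K * Ht_norm s (m h)" using fhK[OF mC(1), of h h] by linarith
    moreover have "fh h ?d - f ?d \<le> \<bar>\<delta> h\<bar> * (B + Ht_norm s u)"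
    proof -
      have "fh h ?d - f ?d \<le> \<bar>\<delta> h\<bar> * Ht_norm s ?d"
        using fdiff[OF d, of h] mult_right_mono[OF abs_ge_self[of "\<delta> h"] Ht_norm_nonneg[of s ?d]] by linarith
      also have "\<dots> \<le> \<bar>\<delta> h\<bar> * (B + Ht_norm s u)"
        using Ht_norm_diff[OF uhD(3) uD(3), of h] uhB[of h] by (intro mult_left_mono) auto
      finally show ?thesis .
    qed
    ultimately show ?thesis by (simp add: distrib_right)
  qed
  have "?b \<longlonglongrightarrow> (B + K) * 0 + (0 - 0) + \<bar>0\<bar> * (B + Ht_norm s u)"
    by (intro tendsto_intros m_lim weak[OF uD(3)] fweak \<delta>)
  then have "?b \<longlonglongrightarrow> 0" by simp
  then have "(\<lambda>h. (Ht_norm s (\<lambda>x. uh h x - u x))\<^sup>2) \<longlonglongrightarrow> 0"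
    by (rule Lim_null_comparison[rotated]) (use est in simp)
  then have "(\<lambda>h. sqrt ((Ht_norm s (\<lambda>x. uh h x - u x))\<^sup>2)) \<longlonglongrightarrow> sqrt 0" by (rule tendsto_real_sqrt)
  then have "(\<lambda>h. Ht_norm s (\<lambda>x. uh h x - u x)) \<longlonglongrightarrow> 0" by simp
  then show ?thesis using u obstacle_problem_unique[OF s bdd f u] by blast
qed

end
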